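(* Let $k\geqslant 1$ be an integer, let $n=2k$, let $K$ be a field and $R=K[x_1,\ldots,x_{2k}]$. Let $P_{2k}$ be the path graph on $2k$ vertices with cover ideal $J(P_{2k})\subseteq R$. Then for every integer $t\geqslant 1$, $$\operatorname{depth} R/J(P_{2k})^t = \begin{cases} k-1+ \left\lfloor \dfrac{k+t}{2t+1}\right\rfloor & \text{ for all } 1\leqslant t\leqslant k-1,\\ k-1 & \text{ for all } t\geqslant k. \end{cases}$$
   Context: For $n\geqslant 2$, $P_n$ denotes the path graph with $n$ vertices, with vertex set $\{1,\ldots,n\}$ (vertex $i$ corresponding to the variable $x_i$) and edges $\{i,i+1\}$ for $i=1,\ldots,n-1$. For a simple graph $G$ on $\{1,\ldots,n\}$ and $R=K[x_1,\ldots,x_n]$ a polynomial ring over a field $K$, the cover ideal of $G$ is the ideal $J(G)$ of $R$ generated by the squarefree monomials $\prod_{i\in\tau}x_i$, where $\tau$ ranges over the minimal vertex covers of $G$ (a vertex cover is a set of vertices meeting every edge; it is minimal if no proper subset is a vertex cover). Equivalently, $J(G)=\bigcap_{\{u,v\}\in E(G)}(x_u,x_v)$; in particular $J(P_n)=\bigcap_{i=1}^{n-1}(x_i,x_{i+1})$. $J(P_n)^t$ is the ordinary $t$-th power of the ideal. For a nonzero finitely generated graded $R$-module $L$, $\operatorname{depth} L=\min\{i\mid H^i_{\mathfrak m}(L)\neq 0\}$, where $\mathfrak m=(x_1,\ldots,x_n)$ and $H^i_{\mathfrak m}$ is local cohomology with support in $\mathfrak m$. $\lfloor x\rfloor$ is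 the largest integer at most $x$. *)

theory Defs
  imports "HOL-Library.Poly_Mapping" "HOL-Algebra.Module"
    "HOL-Algebra.QuotRing" "HOL-Algebra.Ideal_Product"
    "HOL-Algebra.Product_Groups"
begin

section \<open>The polynomial ring \<open>K[x\<^sub>1,\<dots>,x\<^sub>n]\<close>\<close>

text \<open>
  A polynomial is a finitely supported map from exponent vectors to coefficients, with the
  convolution product of \<^typ>\<open>(nat \<Rightarrow>\<^sub>0 nat) \<Rightarrow>\<^sub>0 'a\<close>. That type has one variable for every
  natural number; the carrier below keeps the polynomials in \<open>x\<^sub>1,\<dots>,x\<^sub>n\<close> only.
\<close>

type_synonym 'a mpoly = "(nat \<Rightarrow>\<^sub>0 nat) \<Rightarrow>\<^sub>0 'a"

definition Var :: "nat \<Rightarrow> 'a::field mpoly" where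
  "Var i = Poly_Mapping.single (Poly_Mapping.single i 1) 1"

definition mpoly_ring :: "nat \<Rightarrow> ('a::field mpoly) ring" where
  "mpoly_ring n =
    \<lparr>carrier = {p. \<forall>m\<in>Poly_Mapping.keys p. Poly_Mapping.keys m \<subseteq> {1..n}}, mult = (*), one = 1, zero = 0, add = (+)\<rparr>"


section \<open>Cover ideals\<close>

text \<open>A simple graph is given by its vertex set and its set of two-element edges.\<close>

definition vertex_cover :: "'v set \<Rightarrow> 'v set set \<Rightarrow> 'v set \<Rightarrow> bool" where
  "vertex_cover V E C \<longleftrightarrow> C \<subseteq> V \<and> (\<forall>e\<in>E. C \<inter> e \<noteq> {})"

definition minimal_vertex_cover :: "'v set \<Rightarrow> 'v set set \<Rightarrow> 'v set \<Rightarrow> bool" where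
  "minimal_vertex_cover V E C \<longleftrightarrow> vertex_cover V E C \<and> (\<forall>D. D \<subset> C \<longrightarrow> \<not> vertex_cover V E D)"

definition path_edges :: "nat \<Rightarrow> nat set set" where
  "path_edges n = {{i, i + 1} | i. 1 \<le> i \<and> i + 1 \<le> n}"

definition cover_ideal :: "nat \<Rightarrow> nat set set \<Rightarrow> ('a::field mpoly) set" where
  "cover_ideal n E =
    genideal (mpoly_ring n) {\<Prod>i\<in>\<tau>. Var i | \<tau>. minimal_vertex_cover {1..n} E \<tau>}"


section \<open>Quotient modules and localization\<close>

text \<open>\<open>R/I\<close> as an \<open>R\<close>-module: the quotient ring, with \<open>r \<cdot> (I + a) = (I + r) (I + a)\<close>.\<close>

definition quotient_module :: "('r, 's) ring_scheme \<Rightarrow> 'r set \<Rightarrow> ('r, 'r set) module" where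
  "quotient_module R I =
    \<lparr>carrier = carrier (R Quot I), mult = mult (R Quot I), one = one (R Quot I),
     zero = zero (R Quot I), add = add (R Quot I),
     smult = (\<lambda>r A. (I +>\<^bsub>R\<^esub> r) \<otimes>\<^bsub>R Quot I\<^esub> A)\<rparr>"

text \<open>
  The localization \<open>S\<^sup>-\<^sup>1M\<close> of an \<open>R\<close>-module at a multiplicative set: \<open>u/s = v/t\<close> iff
  \<open>w(tu) = w(sv)\<close> for some \<open>w \<in> S\<close>, and a fraction is the equivalence class of the
  pairs that represent it. The operations are defined on representatives; the unions are over
  equal classes. The record type \<^type>\<open>module\<close> extends \<open>ring\<close>, so its fields for a product on
  the module are left unspecified.
\<close>

definition frac_rel :: "'r set \<Rightarrow> ('r, 'm, 'z) module_scheme \<Rightarrow> (('m \<times> 'r) \<times> ('m \<times> 'r)) set" where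
  "frac_rel S M = {((u, s), (v, t)). u \<in> carrier M \<and> v \<in> carrier M \<and> s \<in> S \<and> t \<in> S \<and>
     (\<exists>w\<in>S. w \<odot>\<^bsub>M\<^esub> (t \<odot>\<^bsub>M\<^esub> u) = w \<odot>\<^bsub>M\<^esub> (s \<odot>\<^bsub>M\<^esub> v))}"

definition fraction :: "'r set \<Rightarrow> ('r, 'm, 'z) module_scheme \<Rightarrow> 'm \<Rightarrow> 'r \<Rightarrow> ('m \<times> 'r) set" where
  "fraction S M u s = frac_rel S M `` {(u, s)}"

definition localization ::
  "('r, 's) ring_scheme \<Rightarrow> 'r set \<Rightarrow> ('r, 'm, 'z) module_scheme \<Rightarrow> ('r, ('m \<times> 'r) set) module" where
  "localization R S M =
    \<lparr>carrier = (carrier M \<times> S) // frac_rel S M,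
     mult = (\<lambda>_ _. undefined), one = undefined,
     zero = fraction S M \<zero>\<^bsub>M\<^esub> \<one>\<^bsub>R\<^esub>,
     add = (\<lambda>X Y. \<Union>(u, s)\<in>X. \<Union>(v, t)\<in>Y.
              fraction S M (t \<odot>\<^bsub>M\<^esub> u \<oplus>\<^bsub>M\<^esub> s \<odot>\<^bsub>M\<^esub> v) (s \<otimes>\<^bsub>R\<^esub> t)),
     smult = (\<lambda>r X. \<Union>(u, s)\<in>X. fraction S M (r \<odot>\<^bsub>M\<^esub> u) s)\<rparr>"

text \<open>The canonical map \<open>S\<^sup>-\<^sup>1M \<rightarrow> T\<^sup>-\<^sup>1M\<close>, \<open>u/s \<mapsto> u/s\<close>, for \<open>S \<subseteq> T\<close>.\<close>

definition localization_map ::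
  "'r set \<Rightarrow> ('r, 'm, 'z) module_scheme \<Rightarrow> ('m \<times> 'r) set \<Rightarrow> ('m \<times> 'r) set" where
  "localization_map T M X = (\<Union>(u, s)\<in>X. fraction T M u s)"


section \<open>Local cohomology and depth\<close>

text \<open>
  Local cohomology with support in a finitely generated ideal \<open>(x\<^sub>1,\<dots>,x\<^sub>n)\<close> of a Noetherian ring
  \<open>R\<close>, as the cohomology of the Cech complex
  \[ 0 \to M \to \bigoplus_i M_{x_i} \to \bigoplus_{i<j} M_{x_i x_j} \to \cdots
       \to M_{x_1 \cdots x_n} \to 0. \]
  The summand \<open>M\<^sub>\<sigma>\<close> belonging to \<open>\<sigma> \<subseteq> {1,\<dots>,n}\<close> is \<open>M\<close> localized at the multiplicative set
  generated by the \<open>x\<^sub>i\<close> with \<open>i \<in> \<sigma>\<close>, which is the localization at the powers of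
  \<open>\<Prod>\<^sub>i\<^sub>\<in>\<^sub>\<sigma> x\<^sub>i\<close>; with this choice \<open>\<sigma> \<subseteq> \<tau>\<close> gives an inclusion of the sets of denominators.
\<close>

definition denominators :: "('r, 's) ring_scheme \<Rightarrow> (nat \<Rightarrow> 'r) \<Rightarrow> nat set \<Rightarrow> 'r set" where
  "denominators R x \<sigma> = {\<Otimes>\<^bsub>R\<^esub>i\<in>\<sigma>. x i [^]\<^bsub>R\<^esub> a i | a :: nat \<Rightarrow> nat. True}"

definition cech_summand ::
  "('r, 's) ring_scheme \<Rightarrow> (nat \<Rightarrow> 'r) \<Rightarrow> ('r, 'm, 'z) module_scheme \<Rightarrow> nat set \<Rightarrow>
   ('r, ('m \<times> 'r) set) module" where
  "cech_summand R x M \<sigma> = localization R (denominators R x \<sigma>) M"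

definition cech_index :: "nat \<Rightarrow> nat \<Rightarrow> nat set set" where
  "cech_index n p = {\<sigma>. \<sigma> \<subseteq> {1..n} \<and> card \<sigma> = p}"

definition cech_cochains ::
  "('r, 's) ring_scheme \<Rightarrow> (nat \<Rightarrow> 'r) \<Rightarrow> nat \<Rightarrow> ('r, 'm, 'z) module_scheme \<Rightarrow> nat \<Rightarrow>
   (nat set \<Rightarrow> ('m \<times> 'r) set) monoid" where
  "cech_cochains R x n M p =
     product_group (cech_index n p) (\<lambda>\<sigma>. add_monoid (cech_summand R x M \<sigma>))"

text \<open>
  \<open>(dc)\<^sub>\<tau> = \<Sum>\<^sub>j (-1)\<^sup>j c\<^bsub>\<tau> - {i\<^sub>j}\<^esub>\<close> for \<open>\<tau> = {i\<^sub>0 < \<dots> < i\<^sub>p}\<close>, with every term mapped to \<open>M\<^sub>\<tau>\<close>.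
\<close>

definition cech_diff ::
  "('r, 's) ring_scheme \<Rightarrow> (nat \<Rightarrow> 'r) \<Rightarrow> nat \<Rightarrow> ('r, 'm, 'z) module_scheme \<Rightarrow> nat \<Rightarrow>
   (nat set \<Rightarrow> ('m \<times> 'r) set) \<Rightarrow> (nat set \<Rightarrow> ('m \<times> 'r) set)" where
  "cech_diff R x n M p c = (\<lambda>\<tau>\<in>cech_index n (p + 1).
     \<Oplus>\<^bsub>cech_summand R x M \<tau>\<^esub>i\<in>\<tau>.
       (let y = localization_map (denominators R x \<tau>) M (c (\<tau> - {i})) in
        if even (card {j \<in> \<tau>. j < i}) then y else \<ominus>\<^bsub>cech_summand R x M \<tau>\<^esub> y))"

definition cech_cocycles ::
  "('r, 's) ring_scheme \<Rightarrow> (nat \<Rightarrow> 'r) \<Rightarrow> nat \<Rightarrow> ('r, 'm, 'z) module_scheme \<Rightarrow> nat \<Rightarrow>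
   (nat set \<Rightarrow> ('m \<times> 'r) set) set" where
  "cech_cocycles R x n M p =
     kernel (cech_cochains R x n M p) (cech_cochains R x n M (p + 1)) (cech_diff R x n M p)"

definition cech_coboundaries ::
  "('r, 's) ring_scheme \<Rightarrow> (nat \<Rightarrow> 'r) \<Rightarrow> nat \<Rightarrow> ('r, 'm, 'z) module_scheme \<Rightarrow> nat \<Rightarrow>
   (nat set \<Rightarrow> ('m \<times> 'r) set) set" where
  "cech_coboundaries R x n M p =
     (case p of 0 \<Rightarrow> {\<one>\<^bsub>cech_cochains R x n M 0\<^esub>}
      | Suc q \<Rightarrow> cech_diff R x n M q ` carrier (cech_cochains R x n M q))"

text \<open>
  \<open>H\<^sup>p\<close> with its additive structure, written as a (multiplicative) group record. The
  \<open>R\<close>-module structure plays no role for the vanishing of \<open>H\<^sup>p\<close>.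
\<close>

definition local_cohomology ::
  "('r, 's) ring_scheme \<Rightarrow> (nat \<Rightarrow> 'r) \<Rightarrow> nat \<Rightarrow> ('r, 'm, 'z) module_scheme \<Rightarrow> nat \<Rightarrow>
   (nat set \<Rightarrow> ('m \<times> 'r) set) set monoid" where
  "local_cohomology R x n M p =
     (cech_cochains R x n M p)\<lparr>carrier := cech_cocycles R x n M p\<rparr>
       Mod (cech_coboundaries R x n M p)"

text \<open>
  The depth of a nonzero finitely generated graded module \<open>L\<close> over \<open>R = K[x\<^sub>1,\<dots>,x\<^sub>n]\<close>, with
  respect to the ideal \<open>(x\<^sub>1,\<dots>,x\<^sub>n)\<close>.
\<close>

definition depth :: "nat \<Rightarrow> ('a::field mpoly, 'm, 'z) module_scheme \<Rightarrow> nat" where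
  "depth n L = (LEAST i. \<not> trivial_group (local_cohomology (mpoly_ring n) Var n L i))"

end

theory Submission
  imports Defs
begin

text \<open>
  The power \<open>J(P\<^sub>n)\<^sup>t\<close> is spanned by the monomials \<open>x\<^sup>b\<close> with \<open>b\<^sub>i + b\<^bsub>i+1\<^esub> \<ge> t\<close> for every edge
  \<open>{i, i+1}\<close>. Hence the Cech complex of \<open>R/J(P\<^sub>n)\<^sup>t\<close> splits into pieces indexed by
  \<open>\<alpha> \<in> \<int>\<^sup>n\<close>, and the piece of degree \<open>\<alpha>\<close> consists of the cochains on the sets
  \<open>\<sigma>\<close> that contain all \<open>i\<close> with \<open>\<alpha>\<^sub>i < 0\<close> and miss both ends of some edge
  with \<open>\<alpha>\<^sub>i + \<alpha>\<^bsub>i+1\<^esub> < t\<close>. Peeling off the last vertex of the path shows that this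
  piece has the cohomology of a point or none at all: the last vertex is forced into \<open>\<sigma>\<close>, or
  isolated (then the piece is acyclic), or matched with its neighbour, in which case the vertex before
  the pair is forced into \<open>\<sigma>\<close> whenever its edge to the pair also has sum less than \<open>t\<close>.
  Cohomology in level \<open>p\<close> thus comes from \<open>f = n - 1 - p\<close> disjoint matched pairs and
  \<open>w = n - 2f\<close> forced vertices. Between two forced vertices there are at most \<open>t\<close> pairs, because
  along consecutive pairs the right exponents strictly decrease within \<open>{0,\<dots>,t-1}\<close>; so \<open>f \<le> (w + 1) t\<close>,
  and every such \<open>f \<ge> 1\<close> occurs. For \<open>n = 2k\<close> the largest possible \<open>f\<close> is
  \<open>k - \<lfloor>(k + t) / (2t + 1)\<rfloor>\<close>.
\<close>

section \<open>Cochains on families of finite sets\<close>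

text \<open>The floor arises as follows. For n = 2k the number of forced vertices is even, w = 2q,
  and f = k - q. So f <= (w + 1) t reads k <= q (2t + 1) + t. The least natural q with this property
  is (k + t) div (2t + 1), and it gives the level n - 1 - f = k - 1 + q. For t >= k one block holds
  all k pairs and q = 0. The families of sets that occur are in general not simplicial complexes but
  differences of two complexes, so relative cohomology is computed, and peeling uses long exact
  sequences in which one term is a cone. Two kinds of families are needed: missing some edge is
  stable under deleting unforced vertices, covering all edges is stable under adding vertices. The
  first pair leads from the first kind to the second and keeps the level; every other peeling step
  lowers the level by one. The Cech summands consist of classes of fractions with operations given
  on representatives. They are replaced by finitely supported coefficient functions on integer
  exponent vectors, on which the differential acts degree by degree.\<close>

definition cobd :: "(nat set \<Rightarrow> 'a::field) \<Rightarrow> nat set \<Rightarrow> 'a" where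
  "cobd c \<tau> = (\<Sum>i\<in>\<tau>. (-1) ^ card {j \<in> \<tau>. j < i} * c (\<tau> - {i}))"

text \<open>The complex of a family \<open>X\<close>: cochains are functions on all sets that vanish
  outside \<open>X\<close>, graded by cardinality, and coboundaries are looked at on members of
  \<open>X\<close> only. The predicate is the vanishing of cohomology in level \<open>p\<close>; the
  type argument fixes the coefficient field.\<close>

definition exact_at :: "'a::field itself \<Rightarrow> nat set set \<Rightarrow> nat \<Rightarrow> bool" where
  "exact_at _ X p \<longleftrightarrow>
     (\<forall>c :: nat set \<Rightarrow> 'a. (\<forall>\<sigma>. \<sigma> \<notin> X \<longrightarrow> c \<sigma> = 0) \<longrightarrow> (\<forall>\<tau>\<in>X. card \<tau> = Suc p \<longrightarrow> cobd c \<tau> = 0) \<longrightarrow>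
       (\<exists>b. (\<forall>\<sigma>. \<sigma> \<notin> X \<longrightarrow> b \<sigma> = 0) \<and> (\<forall>\<sigma>\<in>X. card \<sigma> = p \<longrightarrow> c \<sigma> = cobd b \<sigma>)))"

text \<open>Convexity makes the truncated coboundary square to zero: if \<open>\<tau>\<close> is in
  \<open>X\<close> and \<open>\<tau> - {i}\<close> is not, then no subset of
  \<open>\<tau> - {i}\<close> is in \<open>X\<close>, so cutting off the value at
  \<open>\<tau> - {i}\<close> loses nothing. This is used in the form of
  \<open>cobd_outside\<close>.\<close>

definition interval_closed :: "nat set set \<Rightarrow> bool" where
  "interval_closed X \<longleftrightarrow> (\<forall>\<sigma> \<rho> \<tau>. \<sigma> \<in> X \<longrightarrow> \<tau> \<in> X \<longrightarrow> \<sigma> \<subseteq> \<rho> \<longrightarrow> \<rho> \<subseteq> \<tau> \<longrightarrow> \<rho> \<in> X)"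

lemma exact_atD:
  assumes "exact_at TYPE('a::field) X p"
    and "\<And>\<sigma>. \<sigma> \<notin> X \<Longrightarrow> (c :: nat set \<Rightarrow> 'a) \<sigma> = 0"
    and "\<And>\<tau>. \<tau> \<in> X \<Longrightarrow> card \<tau> = Suc p \<Longrightarrow> cobd c \<tau> = 0"
  obtains b where "\<And>\<sigma>. \<sigma> \<notin> X \<Longrightarrow> b \<sigma> = 0" "\<And>\<sigma>. \<sigma> \<in> X \<Longrightarrow> card \<sigma> = p \<Longrightarrow> c \<sigma> = cobd b \<sigma>"
proof -
  have "\<exists>b. (\<forall>\<sigma>. \<sigma> \<notin> X \<longrightarrow> b \<sigma> = 0) \<and> (\<forall>\<sigma>\<in>X. card \<sigma> = p \<longrightarrow> c \<sigma> = cobd b \<sigma>)"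
    using assms(1)[unfolded exact_at_def, rule_format, of c] assms(2,3) by blast
  then show ?thesis using that by blast
qed

lemma exact_atI:
  assumes "\<And>c :: nat set \<Rightarrow> 'a::field. (\<And>\<sigma>. \<sigma> \<notin> X \<Longrightarrow> c \<sigma> = 0) \<Longrightarrow>
    (\<And>\<tau>. \<tau> \<in> X \<Longrightarrow> card \<tau> = Suc p \<Longrightarrow> cobd c \<tau> = 0) \<Longrightarrow>
    \<exists>b. (\<forall>\<sigma>. \<sigma> \<notin> X \<longrightarrow> b \<sigma> = 0) \<and> (\<forall>\<sigma>\<in>X. card \<sigma> = p \<longrightarrow> c \<sigma> = cobd b \<sigma>)"
  shows "exact_at TYPE('a) X p"
  using assms unfolding exact_at_def by blast

lemma cobd_diff: "cobd (\<lambda>\<sigma>. f \<sigma> - g \<sigma>) \<tau> = cobd f \<tau> - cobd g \<tau>"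
  by (simp add: cobd_def right_diff_distrib sum_subtractf)

lemma cobd_add: "cobd (\<lambda>\<sigma>. f \<sigma> + g \<sigma>) \<tau> = cobd f \<tau> + cobd g \<tau>"
  by (simp add: cobd_def distrib_left sum.distrib)

lemma cobd_cong: "(\<And>i. i \<in> \<tau> \<Longrightarrow> f (\<tau> - {i}) = g (\<tau> - {i})) \<Longrightarrow> cobd f \<tau> = cobd g \<tau>"
  by (simp add: cobd_def)

lemma cobd_zero: "(\<And>i. i \<in> \<tau> \<Longrightarrow> f (\<tau> - {i}) = 0) \<Longrightarrow> cobd f \<tau> = 0"
  by (simp add: cobd_def)

lemma cobd_cobd: "cobd (cobd c) \<tau> = 0"
proof (cases "finite \<tau>")
  case True
  define s :: "nat \<Rightarrow> nat \<Rightarrow> 'a" where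
    "s i j = (-1) ^ card {l \<in> \<tau>. l < i} * (-1) ^ card {l \<in> \<tau> - {i}. l < j} * c (\<tau> - {i, j})" for i j
  have anti: "s i j + s j i = 0" if "i \<in> \<tau>" "j \<in> \<tau>" "i < j" for i j
  proof -
    have 1: "{l \<in> \<tau> - {j}. l < i} = {l \<in> \<tau>. l < i}" using that by auto
    \<comment> \<open>Deleting the smaller \<open>i\<close> first moves \<open>j\<close> down by one
      place, deleting the larger \<open>j\<close> first does not move \<open>i\<close>; hence the
      opposite signs.\<close>
    have "{l \<in> \<tau>. l < j} = insert i {l \<in> \<tau> - {i}. l < j}" using that by auto
    then have 2: "card {l \<in> \<tau>. l < j} = Suc (card {l \<in> \<tau> - {i}. l < j})"
      using True by simp
    show ?thesis unfolding s_def 1 2 by (simp add: insert_commute)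
  qed
  have "cobd (cobd c) \<tau> = (\<Sum>i\<in>\<tau>. \<Sum>j\<in>\<tau> - {i}. s i j)"
    unfolding cobd_def s_def
    by (simp add: sum_distrib_left mult.assoc Diff_insert2[symmetric] insert_commute)
  also have "\<dots> = (\<Sum>i\<in>\<tau>. (\<Sum>j\<in>{j \<in> \<tau>. i < j}. s i j) + (\<Sum>j\<in>{j \<in> \<tau>. j < i}. s i j))"
  proof (rule sum.cong[OF refl])
    fix i assume "i \<in> \<tau>"
    have eq: "\<tau> - {i} = {j \<in> \<tau>. i < j} \<union> {j \<in> \<tau>. j < i}" by auto
    show "(\<Sum>j\<in>\<tau> - {i}. s i j) = (\<Sum>j\<in>{j \<in> \<tau>. i < j}. s i j) + (\<Sum>j\<in>{j \<in> \<tau>. j < i}. s i j)"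
      unfolding eq by (rule sum.union_disjoint) (use True in auto)
  qed
  also have "\<dots> = (\<Sum>i\<in>\<tau>. \<Sum>j\<in>{j \<in> \<tau>. i < j}. s i j) + (\<Sum>i\<in>\<tau>. \<Sum>j\<in>{j \<in> \<tau>. j < i}. s i j)"
    by (simp add: sum.distrib)
  also have "(\<Sum>i\<in>\<tau>. \<Sum>j\<in>{j \<in> \<tau>. j < i}. s i j) = (\<Sum>j\<in>\<tau>. \<Sum>i\<in>{i \<in> \<tau>. j < i}. s i j)"
    using True by (rule sum.swap_restrict) (rule True)
  also have "(\<Sum>i\<in>\<tau>. \<Sum>j\<in>{j \<in> \<tau>. i < j}. s i j) + \<dots> = (\<Sum>i\<in>\<tau>. \<Sum>j\<in>{j \<in> \<tau>. i < j}. s i j + s j i)"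
    by (simp add: sum.distrib)
  also have "\<dots> = 0"
    using anti by (intro sum.neutral ballI) auto
  finally show ?thesis .
qed (simp add: cobd_def)

section \<open>Long exact sequences of convex families\<close>

lemma cobd_outside:
  assumes "interval_closed X" "\<And>\<sigma>. \<sigma> \<notin> X \<Longrightarrow> b \<sigma> = 0" "\<tau> \<in> X" "\<tau> - {i} \<notin> X"
  shows "cobd b (\<tau> - {i}) = 0"
proof (rule cobd_zero)
  fix j assume "j \<in> \<tau> - {i}"
  have "\<tau> - {i} - {j} \<notin> X"
    using assms(1,3,4) unfolding interval_closed_def by (metis Diff_subset)
  then show "b (\<tau> - {i} - {j}) = 0" by (rule assms(2))
qed

text \<open>By \<open>up\<close>, no facet of a member of \<open>Q\<close> is in \<open>U\<close>,
  so the cochains on \<open>U\<close> form a subcomplex of those on \<open>X\<close>, with the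
  cochains on \<open>Q\<close> as quotient. This and the next two lemmas are the exactness of the
  long cohomology sequence at \<open>X\<close>, \<open>Q\<close> and \<open>U\<close>, in terms of
  vanishing.\<close>

lemma exact_at_extension:
  assumes X: "interval_closed X" "X = U \<union> Q" "U \<inter> Q = {}"
    and up: "\<And>\<sigma> i. \<sigma> \<in> Q \<Longrightarrow> \<sigma> - {i} \<notin> U"
    and Q: "exact_at TYPE('a::field) Q p" and U: "exact_at TYPE('a) U p"
  shows "exact_at TYPE('a) X p"
proof (rule exact_atI)
  fix c :: "nat set \<Rightarrow> 'a"
  assume c0: "\<And>\<sigma>. \<sigma> \<notin> X \<Longrightarrow> c \<sigma> = 0" and c: "\<And>\<tau>. \<tau> \<in> X \<Longrightarrow> card \<tau> = Suc p \<Longrightarrow> cobd c \<tau> = 0"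
  define cQ where "cQ \<sigma> = (if \<sigma> \<in> Q then c \<sigma> else 0)" for \<sigma>
  have "cobd cQ \<tau> = 0" if "\<tau> \<in> Q" "card \<tau> = Suc p" for \<tau>
  proof -
    have "cobd cQ \<tau> = cobd c \<tau>"
      by (rule cobd_cong) (use that up c0 X in \<open>auto simp: cQ_def\<close>)
    then show ?thesis using c that X by auto
  qed
  then obtain b where b0: "\<And>\<sigma>. \<sigma> \<notin> Q \<Longrightarrow> b \<sigma> = 0" and b: "\<And>\<sigma>. \<sigma> \<in> Q \<Longrightarrow> card \<sigma> = p \<Longrightarrow> cQ \<sigma> = cobd b \<sigma>"
    using exact_atD[OF Q, of cQ] cQ_def by metis
  \<comment> \<open>In level \<open>p\<close> the cocycle \<open>c - cobd b\<close> vanishes on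
    \<open>Q\<close>, so its truncation to \<open>U\<close> is still a cocycle.\<close>
  define c' where "c' \<sigma> = (if \<sigma> \<in> U then c \<sigma> - cobd b \<sigma> else 0)" for \<sigma>
  have "cobd c' \<tau> = 0" if "\<tau> \<in> U" "card \<tau> = Suc p" for \<tau>
  proof -
    have "cobd c' \<tau> = cobd (\<lambda>\<sigma>. c \<sigma> - cobd b \<sigma>) \<tau>"
    proof (rule cobd_cong)
      fix i assume i: "i \<in> \<tau>"
      then have "card (\<tau> - {i}) = p" using that by (simp add: card_Diff_singleton)
      moreover have "cobd b (\<tau> - {i}) = 0" if "\<tau> - {i} \<notin> X"
        using cobd_outside[OF X(1), of b \<tau> i] b0 \<open>\<tau> \<in> U\<close> X(2) that by auto
      ultimately show "c' (\<tau> - {i}) = c (\<tau> - {i}) - cobd b (\<tau> - {i})"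
        using b[of "\<tau> - {i}"] c0[of "\<tau> - {i}"] X(2,3) by (auto simp: c'_def cQ_def)
    qed
    then show ?thesis using c that X(2) by (simp add: cobd_diff cobd_cobd)
  qed
  then obtain e where e0: "\<And>\<sigma>. \<sigma> \<notin> U \<Longrightarrow> e \<sigma> = 0" and e: "\<And>\<sigma>. \<sigma> \<in> U \<Longrightarrow> card \<sigma> = p \<Longrightarrow> c' \<sigma> = cobd e \<sigma>"
    using exact_atD[OF U, of c'] c'_def by metis
  have "c \<sigma> = cobd (\<lambda>\<sigma>. b \<sigma> + e \<sigma>) \<sigma>" if "\<sigma> \<in> X" "card \<sigma> = p" for \<sigma>
  proof (cases "\<sigma> \<in> U")
    case True
    then show ?thesis using e[of \<sigma>] that by (simp add: cobd_add c'_def algebra_simps)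
  next
    case False
    then have "\<sigma> \<in> Q" using that X by auto
    moreover have "cobd e \<sigma> = 0" by (rule cobd_zero) (use \<open>\<sigma> \<in> Q\<close> up e0 in auto)
    ultimately show ?thesis using b[of \<sigma>] that by (simp add: cobd_add cQ_def)
  qed
  then show "\<exists>b. (\<forall>\<sigma>. \<sigma> \<notin> X \<longrightarrow> b \<sigma> = 0) \<and> (\<forall>\<sigma>\<in>X. card \<sigma> = p \<longrightarrow> c \<sigma> = cobd b \<sigma>)"
    using b0 e0 X(2) by (intro exI[of _ "\<lambda>\<sigma>. b \<sigma> + e \<sigma>"]) auto
qed

lemma exact_at_quotient:
  assumes X: "interval_closed X" "X = U \<union> Q" "U \<inter> Q = {}"
    and up: "\<And>\<sigma> i. \<sigma> \<in> Q \<Longrightarrow> \<sigma> - {i} \<notin> U"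
    and ex: "exact_at TYPE('a::field) X p" and U: "exact_at TYPE('a) U (Suc p)"
  shows "exact_at TYPE('a) Q p"
proof (rule exact_atI)
  fix c :: "nat set \<Rightarrow> 'a"
  assume c0: "\<And>\<sigma>. \<sigma> \<notin> Q \<Longrightarrow> c \<sigma> = 0" and c: "\<And>\<tau>. \<tau> \<in> Q \<Longrightarrow> card \<tau> = Suc p \<Longrightarrow> cobd c \<tau> = 0"
  \<comment> \<open>The connecting map: in level \<open>Suc p\<close>, the coboundary of the
    extension of \<open>c\<close> by zero lives on \<open>U\<close>.\<close>
  define u where "u \<sigma> = (if \<sigma> \<in> U then cobd c \<sigma> else 0)" for \<sigma>
  have "cobd u \<tau> = 0" if "\<tau> \<in> U" "card \<tau> = Suc (Suc p)" for \<tau>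
  proof -
    have "cobd u \<tau> = cobd (cobd c) \<tau>"
    proof (rule cobd_cong)
      fix i assume i: "i \<in> \<tau>"
      then have "card (\<tau> - {i}) = Suc p" using that by (simp add: card_Diff_singleton)
      moreover have "cobd c (\<tau> - {i}) = 0" if "\<tau> - {i} \<notin> X"
        using cobd_outside[OF X(1), of c \<tau> i] c0 \<open>\<tau> \<in> U\<close> X(2) that by auto
      ultimately show "u (\<tau> - {i}) = cobd c (\<tau> - {i})"
        using c[of "\<tau> - {i}"] X(2,3) by (auto simp: u_def)
    qed
    then show ?thesis by (simp add: cobd_cobd)
  qed
  then obtain e where e0: "\<And>\<sigma>. \<sigma> \<notin> U \<Longrightarrow> e \<sigma> = 0" and e: "\<And>\<sigma>. \<sigma> \<in> U \<Longrightarrow> card \<sigma> = Suc p \<Longrightarrow> u \<sigma> = cobd e \<sigma>"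
    using exact_atD[OF U, of u] u_def by metis
  define x where "x \<sigma> = c \<sigma> - e \<sigma>" for \<sigma>
  have "cobd x \<tau> = 0" if "\<tau> \<in> X" "card \<tau> = Suc p" for \<tau>
  proof (cases "\<tau> \<in> U")
    case True
    then show ?thesis using e[of \<tau>] that by (simp add: x_def[abs_def] cobd_diff u_def)
  next
    case False
    then have "\<tau> \<in> Q" using that X by auto
    moreover have "cobd e \<tau> = 0" by (rule cobd_zero) (use \<open>\<tau> \<in> Q\<close> up e0 in auto)
    ultimately show ?thesis using c that by (simp add: x_def[abs_def] cobd_diff)
  qed
  moreover have "x \<sigma> = 0" if "\<sigma> \<notin> X" for \<sigma> using that X(2) c0 e0 by (simp add: x_def)
  ultimately obtain b where b0: "\<And>\<sigma>. \<sigma> \<notin> X \<Longrightarrow> b \<sigma> = 0" and b: "\<And>\<sigma>. \<sigma> \<in> X \<Longrightarrow> card \<sigma> = p \<Longrightarrow> x \<sigma> = cobd b \<sigma>"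
    using exact_atD[OF ex, of x] by metis
  define b' where "b' \<sigma> = (if \<sigma> \<in> Q then b \<sigma> else 0)" for \<sigma>
  have "c \<sigma> = cobd b' \<sigma>" if "\<sigma> \<in> Q" "card \<sigma> = p" for \<sigma>
  proof -
    have "cobd b' \<sigma> = cobd b \<sigma>"
      by (rule cobd_cong) (use that up b0 X in \<open>auto simp: b'_def\<close>)
    moreover have "e \<sigma> = 0" using that e0 X(3) by auto
    ultimately show ?thesis using b[of \<sigma>] that X(2) by (simp add: x_def)
  qed
  then show "\<exists>b. (\<forall>\<sigma>. \<sigma> \<notin> Q \<longrightarrow> b \<sigma> = 0) \<and> (\<forall>\<sigma>\<in>Q. card \<sigma> = p \<longrightarrow> c \<sigma> = cobd b \<sigma>)"
    by (intro exI[of _ b']) (auto simp: b'_def)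
qed

lemma exact_at_sub:
  assumes X: "interval_closed X" "X = U \<union> Q" "U \<inter> Q = {}" "\<And>\<sigma>. \<sigma> \<in> X \<Longrightarrow> finite \<sigma>"
    and up: "\<And>\<sigma> i. \<sigma> \<in> Q \<Longrightarrow> \<sigma> - {i} \<notin> U"
    and ex: "exact_at TYPE('a::field) X p" and Q: "\<And>q. p = Suc q \<Longrightarrow> exact_at TYPE('a) Q q"
  shows "exact_at TYPE('a) U p"
proof (rule exact_atI)
  fix c :: "nat set \<Rightarrow> 'a"
  assume c0: "\<And>\<sigma>. \<sigma> \<notin> U \<Longrightarrow> c \<sigma> = 0" and c: "\<And>\<tau>. \<tau> \<in> U \<Longrightarrow> card \<tau> = Suc p \<Longrightarrow> cobd c \<tau> = 0"
  have "cobd c \<tau> = 0" if "\<tau> \<in> X" "card \<tau> = Suc p" for \<tau>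
  proof (cases "\<tau> \<in> U")
    case False
    then have "\<tau> \<in> Q" using that X(2) by blast
    show ?thesis by (rule cobd_zero) (use \<open>\<tau> \<in> Q\<close> up c0 in auto)
  qed (use that c in auto)
  moreover have "c \<sigma> = 0" if "\<sigma> \<notin> X" for \<sigma> using that X(2) c0 by blast
  ultimately obtain b where b0: "\<And>\<sigma>. \<sigma> \<notin> X \<Longrightarrow> b \<sigma> = 0" and b: "\<And>\<sigma>. \<sigma> \<in> X \<Longrightarrow> card \<sigma> = p \<Longrightarrow> c \<sigma> = cobd b \<sigma>"
    using exact_atD[OF ex, of c] by metis
  show "\<exists>b. (\<forall>\<sigma>. \<sigma> \<notin> U \<longrightarrow> b \<sigma> = 0) \<and> (\<forall>\<sigma>\<in>U. card \<sigma> = p \<longrightarrow> c \<sigma> = cobd b \<sigma>)"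
  proof (cases p)
    \<comment> \<open>There is no level below 0. By finiteness the only set of cardinality 0 is
      \<open>{}\<close>, where every coboundary is 0.\<close>
    case 0
    have "c \<sigma> = cobd (\<lambda>_. 0) \<sigma>" if "\<sigma> \<in> U" "card \<sigma> = p" for \<sigma>
      using b[of \<sigma>] X(2) X(4)[of \<sigma>] that 0 by (simp add: cobd_def)
    then show ?thesis by (intro exI[of _ "\<lambda>_. 0"]) auto
  next
    case (Suc q)
    define bQ where "bQ \<sigma> = (if \<sigma> \<in> Q then b \<sigma> else 0)" for \<sigma>
    have "cobd bQ \<tau> = 0" if "\<tau> \<in> Q" "card \<tau> = Suc q" for \<tau>
    proof -
      have "cobd bQ \<tau> = cobd b \<tau>"
        by (rule cobd_cong) (use that up b0 X(2) in \<open>auto simp: bQ_def\<close>)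
      also have "\<dots> = c \<tau>" using b[of \<tau>] that X(2) Suc by simp
      also have "\<dots> = 0" using c0 that X(3) by auto
      finally show ?thesis .
    qed
    then obtain e where e0: "\<And>\<sigma>. \<sigma> \<notin> Q \<Longrightarrow> e \<sigma> = 0" and e: "\<And>\<sigma>. \<sigma> \<in> Q \<Longrightarrow> card \<sigma> = q \<Longrightarrow> bQ \<sigma> = cobd e \<sigma>"
      using exact_atD[OF Q[OF Suc], of bQ] bQ_def by metis
    \<comment> \<open>The part of \<open>b\<close> on \<open>Q\<close> is a cocycle since
      \<open>c\<close> is 0 there; subtracting \<open>cobd e\<close> makes it vanish on
      \<open>Q\<close> and so moves the primitive into \<open>U\<close>.\<close>
    define b' where "b' \<sigma> = (if \<sigma> \<in> U then b \<sigma> - cobd e \<sigma> else 0)" for \<sigma>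
    have "c \<tau> = cobd b' \<tau>" if "\<tau> \<in> U" "card \<tau> = p" for \<tau>
    proof -
      have "cobd b' \<tau> = cobd (\<lambda>\<sigma>. b \<sigma> - cobd e \<sigma>) \<tau>"
      proof (rule cobd_cong)
        fix i assume i: "i \<in> \<tau>"
        then have "card (\<tau> - {i}) = q" using that Suc by (simp add: card_Diff_singleton)
        moreover have "cobd e (\<tau> - {i}) = 0" if "\<tau> - {i} \<notin> X"
          using cobd_outside[OF X(1), of e \<tau> i] e0 \<open>\<tau> \<in> U\<close> X(2) that by auto
        ultimately show "b' (\<tau> - {i}) = b (\<tau> - {i}) - cobd e (\<tau> - {i})"
          using e[of "\<tau> - {i}"] b0[of "\<tau> - {i}"] X(2,3) by (auto simp: b'_def bQ_def)
      qed
      then show ?thesis using b[of \<tau>] that X(2) by (simp add: cobd_diff cobd_cobd)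
    qed
    then show ?thesis by (intro exI[of _ b']) (auto simp: b'_def)
  qed
qed

section \<open>Cones, shifts, links and deletions at the largest vertex\<close>

lemma cobd_insert_top:
  assumes "finite \<sigma>" "\<And>i. i \<in> \<sigma> \<Longrightarrow> i < v"
  shows "cobd c (insert v \<sigma>) = cobd (\<lambda>\<rho>. c (insert v \<rho>)) \<sigma> + (-1) ^ card \<sigma> * c \<sigma>"
proof -
  have v: "v \<notin> \<sigma>" using assms(2) by blast
  have 1: "{j \<in> insert v \<sigma>. j < v} = \<sigma>" using assms(2) by auto
  have 2: "insert v \<sigma> - {v} = \<sigma>" using v by auto
  have 3: "(-1) ^ card {j \<in> insert v \<sigma>. j < i} * c (insert v \<sigma> - {i}) =
        (-1) ^ card {j \<in> \<sigma>. j < i} * c (insert v (\<sigma> - {i}))" if "i \<in> \<sigma>" for i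
  proof -
    have "{j \<in> insert v \<sigma>. j < i} = {j \<in> \<sigma>. j < i}" using assms(2)[OF that] by auto
    moreover have "insert v \<sigma> - {i} = insert v (\<sigma> - {i})" using v that by auto
    ultimately show ?thesis by simp
  qed
  have "(\<Sum>i\<in>\<sigma>. (-1) ^ card {j \<in> insert v \<sigma>. j < i} * c (insert v \<sigma> - {i})) =
        (\<Sum>i\<in>\<sigma>. (-1) ^ card {j \<in> \<sigma>. j < i} * c (insert v (\<sigma> - {i})))"
    by (rule sum.cong[OF refl 3])
  then show ?thesis
    unfolding cobd_def sum.insert[OF assms(1) v] 1 2 by (simp only: add.commute)
qed

text \<open>Membership in \<open>W\<close> does not depend on \<open>v\<close>, so adding
  \<open>v\<close> gives a contracting homotopy. As \<open>v\<close> is the largest vertex, only the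
  sign of the last place has to be tracked.\<close>

lemma exact_at_cone:
  assumes "\<And>\<sigma>. \<sigma> \<in> W \<Longrightarrow> finite \<sigma> \<and> (\<forall>i\<in>\<sigma>. i \<le> v)"
    and W: "\<And>\<sigma>. v \<notin> \<sigma> \<Longrightarrow> insert v \<sigma> \<in> W \<longleftrightarrow> \<sigma> \<in> W"
  shows "exact_at TYPE('a::field) W p"
proof (rule exact_atI)
  fix c :: "nat set \<Rightarrow> 'a"
  assume c0: "\<And>\<sigma>. \<sigma> \<notin> W \<Longrightarrow> c \<sigma> = 0" and c: "\<And>\<tau>. \<tau> \<in> W \<Longrightarrow> card \<tau> = Suc p \<Longrightarrow> cobd c \<tau> = 0"
  \<comment> \<open>The factor is the sign with which \<open>\<sigma>\<close> occurs in the
    coboundary at \<open>insert v \<sigma>\<close>.\<close>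
  define b where "b \<sigma> = (if v \<notin> \<sigma> \<and> \<sigma> \<in> W then (-1) ^ card \<sigma> * c (insert v \<sigma>) else 0)" for \<sigma>
  have top: "finite \<sigma>" "\<And>i. i \<in> \<sigma> \<Longrightarrow> i < v" if "\<sigma> \<in> W" "v \<notin> \<sigma>" for \<sigma>
    using assms(1)[OF that(1)] that(2) by (auto simp: less_le)
  have "c \<sigma> = cobd b \<sigma>" if "\<sigma> \<in> W" "card \<sigma> = p" for \<sigma>
  proof (cases "v \<in> \<sigma>")
    case True
    define \<rho> where "\<rho> = \<sigma> - {v}"
    have \<rho>: "\<sigma> = insert v \<rho>" "v \<notin> \<rho>" using True by (auto simp: \<rho>_def)
    then have "\<rho> \<in> W" using W that by simp
    have "cobd (\<lambda>\<rho>. b (insert v \<rho>)) \<rho> = 0" by (rule cobd_zero) (simp add: b_def)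
    then show ?thesis
      unfolding \<rho>(1) using \<rho>(2) \<open>\<rho> \<in> W\<close>
      by (simp add: cobd_insert_top[OF top[OF \<open>\<rho> \<in> W\<close> \<rho>(2)]] b_def flip: mult.assoc power_mult_distrib)
  next
    case False
    have "card (insert v \<sigma>) = Suc p" "insert v \<sigma> \<in> W" using that False W top by auto
    then have "0 = cobd c (insert v \<sigma>)" using c by simp
    also have "\<dots> = cobd (\<lambda>\<rho>. c (insert v \<rho>)) \<sigma> + (-1) ^ card \<sigma> * c \<sigma>"
      by (rule cobd_insert_top) (use top that False in auto)
    also have "cobd (\<lambda>\<rho>. c (insert v \<rho>)) \<sigma> = - ((-1) ^ card \<sigma>) * cobd b \<sigma>"
      unfolding cobd_def sum_distrib_left
    proof (rule sum.cong[OF refl])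
      fix i assume i: "i \<in> \<sigma>"
      have "card \<sigma> = Suc (card (\<sigma> - {i}))" using i top[OF that(1) False] by (metis card_Suc_Diff1)
      then have "c (insert v (\<sigma> - {i})) = - ((-1) ^ card \<sigma>) * b (\<sigma> - {i})"
        using False c0[of "insert v (\<sigma> - {i})"] W[of "\<sigma> - {i}"]
        by (simp add: b_def flip: mult.assoc power_mult_distrib)
      then show "(-1) ^ card {j \<in> \<sigma>. j < i} * c (insert v (\<sigma> - {i})) =
          - ((-1) ^ card \<sigma>) * ((-1) ^ card {j \<in> \<sigma>. j < i} * b (\<sigma> - {i}))"
        by (simp add: mult_ac)
    qed
    finally have "(-1) ^ card \<sigma> * (c \<sigma> - cobd b \<sigma>) = 0" by (simp add: algebra_simps)
    then show ?thesis by simp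
  qed
  then show "\<exists>b. (\<forall>\<sigma>. \<sigma> \<notin> W \<longrightarrow> b \<sigma> = 0) \<and> (\<forall>\<sigma>\<in>W. card \<sigma> = p \<longrightarrow> c \<sigma> = cobd b \<sigma>)"
    by (intro exI[of _ b]) (auto simp: b_def)
qed

text \<open>In the coboundary at \<open>insert v \<sigma>\<close> the term at
  \<open>\<sigma>\<close> is zero, because every member of the shifted family contains
  \<open>v\<close>; the other signs do not change since \<open>v\<close> is the largest
  vertex.\<close>

lemma exact_at_shift:
  assumes Y: "\<And>\<sigma>. \<sigma> \<in> Y \<Longrightarrow> finite \<sigma> \<and> (\<forall>i\<in>\<sigma>. i < v)"
  shows "exact_at TYPE('a::field) (insert v ` Y) (Suc p) \<longleftrightarrow> exact_at TYPE('a) Y p"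
proof
  have nv: "v \<notin> \<sigma>" if "\<sigma> \<in> Y" for \<sigma> using Y[OF that] by auto
  have card: "card (insert v \<sigma>) = Suc (card \<sigma>)" if "\<sigma> \<in> Y" for \<sigma> using Y[OF that] nv[OF that] by simp
  have top: "cobd c (insert v \<sigma>) = cobd (\<lambda>\<rho>. c (insert v \<rho>)) \<sigma> + (-1) ^ card \<sigma> * c \<sigma>" if "\<sigma> \<in> Y" for \<sigma> and c :: "nat set \<Rightarrow> 'a"
    using cobd_insert_top Y[OF that] by blast
  have mem: "insert v \<sigma> \<in> insert v ` Y \<longleftrightarrow> \<sigma> \<in> Y" if "v \<notin> \<sigma>" for \<sigma>
    using that nv by (auto dest: insert_ident[THEN iffD1, rotated 2])
  have nmem: "\<sigma> \<notin> insert v ` Y" if "v \<notin> \<sigma>" for \<sigma> using that by auto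
  {
    assume ex: "exact_at TYPE('a) Y p"
    show "exact_at TYPE('a) (insert v ` Y) (Suc p)"
    proof (rule exact_atI)
      fix c :: "nat set \<Rightarrow> 'a"
      assume c0: "\<And>\<sigma>. \<sigma> \<notin> insert v ` Y \<Longrightarrow> c \<sigma> = 0"
        and c: "\<And>\<tau>. \<tau> \<in> insert v ` Y \<Longrightarrow> card \<tau> = Suc (Suc p) \<Longrightarrow> cobd c \<tau> = 0"
      define c' where "c' \<sigma> = (if v \<in> \<sigma> then 0 else c (insert v \<sigma>))" for \<sigma>
      have "cobd c' \<tau> = 0" if "\<tau> \<in> Y" "card \<tau> = Suc p" for \<tau>
      proof -
        have "cobd c' \<tau> = cobd (\<lambda>\<rho>. c (insert v \<rho>)) \<tau>"
          by (rule cobd_cong) (use nv[OF that(1)] in \<open>auto simp: c'_def\<close>)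
        then show ?thesis
          using c[of "insert v \<tau>"] top[OF that(1), of c] c0[OF nmem[OF nv[OF that(1)]]] card that by simp
      qed
      moreover have "c' \<sigma> = 0" if "\<sigma> \<notin> Y" for \<sigma> using that mem c0 by (auto simp: c'_def)
      ultimately obtain b where b0: "\<And>\<sigma>. \<sigma> \<notin> Y \<Longrightarrow> b \<sigma> = 0" and b: "\<And>\<sigma>. \<sigma> \<in> Y \<Longrightarrow> card \<sigma> = p \<Longrightarrow> c' \<sigma> = cobd b \<sigma>"
        using exact_atD[OF ex, of c'] by metis
      define b' where "b' \<sigma> = (if v \<in> \<sigma> then b (\<sigma> - {v}) else 0)" for \<sigma>
      have "c (insert v \<sigma>) = cobd b' (insert v \<sigma>)" if "\<sigma> \<in> Y" "card \<sigma> = p" for \<sigma>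
      proof -
        have "cobd (\<lambda>\<rho>. b' (insert v \<rho>)) \<sigma> = cobd b \<sigma>"
          by (rule cobd_cong) (use nv[OF that(1)] in \<open>auto simp: b'_def insert_Diff_if\<close>)
        then show ?thesis
          using top[OF that(1), of b'] b[OF that] nv[OF that(1)] by (simp add: b'_def c'_def)
      qed
      moreover have "b' \<sigma> = 0" if "\<sigma> \<notin> insert v ` Y" for \<sigma>
        using that mem[of "\<sigma> - {v}"] b0[of "\<sigma> - {v}"] by (auto simp: b'_def insert_absorb)
      ultimately show "\<exists>b. (\<forall>\<sigma>. \<sigma> \<notin> insert v ` Y \<longrightarrow> b \<sigma> = 0) \<and>
          (\<forall>\<sigma>\<in>insert v ` Y. card \<sigma> = Suc p \<longrightarrow> c \<sigma> = cobd b \<sigma>)"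
        using card by (intro exI[of _ b']) auto
    qed
  next
    assume ex: "exact_at TYPE('a) (insert v ` Y) (Suc p)"
    show "exact_at TYPE('a) Y p"
    proof (rule exact_atI)
      fix c :: "nat set \<Rightarrow> 'a"
      assume c0: "\<And>\<sigma>. \<sigma> \<notin> Y \<Longrightarrow> c \<sigma> = 0" and c: "\<And>\<tau>. \<tau> \<in> Y \<Longrightarrow> card \<tau> = Suc p \<Longrightarrow> cobd c \<tau> = 0"
      define c' where "c' \<sigma> = (if v \<in> \<sigma> then c (\<sigma> - {v}) else 0)" for \<sigma>
      have c'c: "cobd (\<lambda>\<rho>. c' (insert v \<rho>)) \<sigma> = cobd c \<sigma>" if "\<sigma> \<in> Y" for \<sigma>
          by (rule cobd_cong) (use nv[OF that(1)] in \<open>auto simp: c'_def insert_Diff_if\<close>)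
      have "cobd c' (insert v \<tau>) = 0" if "\<tau> \<in> Y" "card \<tau> = Suc p" for \<tau>
        using top[OF that(1), of c'] c'c[OF that(1)] c[OF that] nv[OF that(1)] by (simp add: c'_def)
      moreover have "c' \<sigma> = 0" if "\<sigma> \<notin> insert v ` Y" for \<sigma>
        using that mem[of "\<sigma> - {v}"] c0[of "\<sigma> - {v}"] by (auto simp: c'_def insert_absorb)
      ultimately obtain b where b0: "\<And>\<sigma>. \<sigma> \<notin> insert v ` Y \<Longrightarrow> b \<sigma> = 0"
        and b: "\<And>\<sigma>. \<sigma> \<in> insert v ` Y \<Longrightarrow> card \<sigma> = Suc p \<Longrightarrow> c' \<sigma> = cobd b \<sigma>"
        using card by - (rule exact_atD[OF ex, of c'], auto)
      define b' where "b' \<sigma> = (if v \<in> \<sigma> then 0 else b (insert v \<sigma>))" for \<sigma>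
      have "c \<sigma> = cobd b' \<sigma>" if "\<sigma> \<in> Y" "card \<sigma> = p" for \<sigma>
      proof -
        have "cobd b' \<sigma> = cobd (\<lambda>\<rho>. b (insert v \<rho>)) \<sigma>"
          by (rule cobd_cong) (use nv[OF that(1)] in \<open>auto simp: b'_def\<close>)
        then show ?thesis
          using b[of "insert v \<sigma>"] top[OF that(1), of b] b0[OF nmem[OF nv[OF that(1)]]] card that nv[OF that(1)]
          by (simp add: c'_def)
      qed
      then show "\<exists>b. (\<forall>\<sigma>. \<sigma> \<notin> Y \<longrightarrow> b \<sigma> = 0) \<and> (\<forall>\<sigma>\<in>Y. card \<sigma> = p \<longrightarrow> c \<sigma> = cobd b \<sigma>)"
        using b0 mem by (intro exI[of _ b']) (auto simp: b'_def)
    qed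
  }
qed

text \<open>The members that stay in \<open>X\<close> without \<open>v\<close> form a cone and a
  subcomplex. The quotient consists of the sets \<open>insert v \<sigma>\<close> with
  \<open>\<sigma>\<close> in the family on the right, and dropping the common vertex
  \<open>v\<close> lowers the level by one.\<close>

lemma exact_at_link:
  assumes X: "interval_closed X" "\<And>\<sigma>. \<sigma> \<in> X \<Longrightarrow> finite \<sigma> \<and> (\<forall>i\<in>\<sigma>. i \<le> v)"
    and up: "\<And>\<sigma>. \<sigma> \<in> X \<Longrightarrow> insert v \<sigma> \<in> X"
  shows "exact_at TYPE('a::field) X (Suc p) \<longleftrightarrow>
    exact_at TYPE('a) {\<sigma>. v \<notin> \<sigma> \<and> \<sigma> \<notin> X \<and> insert v \<sigma> \<in> X} p" (is "_ \<longleftrightarrow> exact_at _ ?Y p")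
proof -
  define U where "U = {\<sigma> \<in> X. \<sigma> - {v} \<in> X}"
  have un: "X = U \<union> insert v ` ?Y"
  proof (intro equalityI subsetI)
    fix \<sigma> assume "\<sigma> \<in> X"
    show "\<sigma> \<in> U \<union> insert v ` ?Y"
    proof (cases "\<sigma> - {v} \<in> X")
      case False
      then have v: "v \<in> \<sigma>" using \<open>\<sigma> \<in> X\<close> by (metis Diff_empty Diff_insert0)
      then have "\<sigma> - {v} \<in> ?Y" "\<sigma> = insert v (\<sigma> - {v})" using False \<open>\<sigma> \<in> X\<close> by (auto simp: insert_absorb)
      then show ?thesis by blast
    qed (use \<open>\<sigma> \<in> X\<close> in \<open>auto simp: U_def\<close>)
  qed (auto simp: U_def)
  have disj: "U \<inter> insert v ` ?Y = {}" by (auto simp: U_def)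
  have closed: "\<sigma> - {i} \<notin> U" if "\<sigma> \<in> insert v ` ?Y" for \<sigma> i
  proof
    assume "\<sigma> - {i} \<in> U"
    then have "\<sigma> - {i} - {v} \<in> X" by (simp add: U_def)
    moreover have "\<sigma> - {i} - {v} \<subseteq> \<sigma> - {v}" "\<sigma> - {v} \<subseteq> \<sigma>" by auto
    moreover have "\<sigma> \<in> X" using that un by auto
    ultimately have "\<sigma> - {v} \<in> X" using X(1) unfolding interval_closed_def by blast
    then show False using that by auto
  qed
  have cone: "exact_at TYPE('a) U q" for q
    by (rule exact_at_cone) (use X(2) up in \<open>auto simp: U_def insert_Diff_if\<close>)
  have "exact_at TYPE('a) X (Suc p) \<longleftrightarrow> exact_at TYPE('a) (insert v ` ?Y) (Suc p)"
    using exact_at_extension[OF X(1) un disj closed _ cone] exact_at_quotient[OF X(1) un disj closed _ cone]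
    by blast
  also have "\<dots> \<longleftrightarrow> exact_at TYPE('a) ?Y p"
  proof (rule exact_at_shift)
    fix \<sigma> assume "\<sigma> \<in> ?Y"
    then have "v \<notin> \<sigma>" "insert v \<sigma> \<in> X" by auto
    then show "finite \<sigma> \<and> (\<forall>i\<in>\<sigma>. i < v)" using X(2)[of "insert v \<sigma>"] by (auto simp: less_le)
  qed
  finally show ?thesis .
qed

text \<open>If \<open>{}\<close> is in \<open>X\<close>, then so is \<open>{v}\<close>, and the
  coboundary of \<open>c\<close> at \<open>{v}\<close> is \<open>c {}\<close>.\<close>

lemma exact_at_link_0:
  assumes up: "\<And>\<sigma>. \<sigma> \<in> X \<Longrightarrow> insert v \<sigma> \<in> X" and fin: "\<And>\<sigma>. \<sigma> \<in> X \<Longrightarrow> finite \<sigma>"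
  shows "exact_at TYPE('a::field) X 0"
proof (rule exact_atI)
  fix c :: "nat set \<Rightarrow> 'a"
  assume c: "\<And>\<tau>. \<tau> \<in> X \<Longrightarrow> card \<tau> = Suc 0 \<Longrightarrow> cobd c \<tau> = 0"
  have "c {} = 0" if "{} \<in> X"
    using c[OF up[OF that]] by (simp add: cobd_def)
  then have "\<forall>\<sigma>\<in>X. card \<sigma> = 0 \<longrightarrow> c \<sigma> = cobd (\<lambda>_. 0) \<sigma>"
    using fin by (auto simp: cobd_def)
  then show "\<exists>b. (\<forall>\<sigma>. \<sigma> \<notin> X \<longrightarrow> b \<sigma> = 0) \<and> (\<forall>\<sigma>\<in>X. card \<sigma> = 0 \<longrightarrow> c \<sigma> = cobd b \<sigma>)"
    by (intro exI[of _ "\<lambda>_. 0"]) auto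
qed

text \<open>The counterpart of \<open>exact_at_link\<close> for families stable under removing
  \<open>v\<close>. Here the cone is the quotient, and no member of the remaining subcomplex
  contains \<open>v\<close>, so the level stays.\<close>

lemma exact_at_deletion:
  assumes X: "interval_closed X" "\<And>\<sigma>. \<sigma> \<in> X \<Longrightarrow> finite \<sigma> \<and> (\<forall>i\<in>\<sigma>. i \<le> v)"
    and down: "\<And>\<sigma>. \<sigma> \<in> X \<Longrightarrow> \<sigma> - {v} \<in> X"
  shows "exact_at TYPE('a::field) X p \<longleftrightarrow>
    exact_at TYPE('a) {\<sigma>. v \<notin> \<sigma> \<and> \<sigma> \<in> X \<and> insert v \<sigma> \<notin> X} p" (is "_ \<longleftrightarrow> exact_at _ ?Y p")
proof -
  define Q where "Q = {\<sigma> \<in> X. insert v \<sigma> \<in> X}"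
  have un: "X = ?Y \<union> Q" by (auto simp: Q_def insert_absorb)
  have disj: "?Y \<inter> Q = {}" by (auto simp: Q_def)
  have closed: "\<sigma> - {i} \<notin> ?Y" if "\<sigma> \<in> Q" for \<sigma> i
  proof
    assume "\<sigma> - {i} \<in> ?Y"
    then have "\<sigma> - {i} \<in> X" "insert v (\<sigma> - {i}) \<notin> X" by auto
    moreover have "\<sigma> - {i} \<subseteq> insert v (\<sigma> - {i})" "insert v (\<sigma> - {i}) \<subseteq> insert v \<sigma>" by auto
    moreover have "insert v \<sigma> \<in> X" using that by (simp add: Q_def)
    ultimately show False using X(1) unfolding interval_closed_def by blast
  qed
  have cone: "exact_at TYPE('a) Q q" for q
  proof (rule exact_at_cone)
    show "insert v \<sigma> \<in> Q \<longleftrightarrow> \<sigma> \<in> Q" if "v \<notin> \<sigma>" for \<sigma>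
      using down[of "insert v \<sigma>"] that by (auto simp: Q_def)
  qed (use X(2) in \<open>auto simp: Q_def\<close>)
  have fin: "\<And>\<sigma>. \<sigma> \<in> X \<Longrightarrow> finite \<sigma>" using X(2) by blast
  show ?thesis
    using exact_at_extension[OF X(1) un disj closed cone] exact_at_sub[OF X(1) un disj fin closed _ cone]
    by blast
qed

section \<open>Degree complexes of the path\<close>

text \<open>What a degree complex becomes when its last pair is peeled off: a set whose only missed
  edge is the last one covers all earlier edges of sum less than \<open>t\<close>.\<close>

definition covers :: "nat \<Rightarrow> nat \<Rightarrow> (nat \<Rightarrow> int) \<Rightarrow> nat set set" where
  "covers t m \<alpha> = {\<sigma>. \<sigma> \<subseteq> {1..m} \<and> (\<forall>i\<in>{1..m}. \<alpha> i < 0 \<longrightarrow> i \<in> \<sigma>) \<and>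
     (\<forall>i\<in>{1..<m}. \<alpha> i + \<alpha> (Suc i) < int t \<longrightarrow> i \<in> \<sigma> \<or> Suc i \<in> \<sigma>)}"

text \<open>For \<open>\<alpha>\<close> supported in \<open>{1..n}\<close> these are the
  \<open>\<sigma>\<close> such that the monomial with exponent \<open>\<alpha>\<close> is nonzero in
  the localization of R/J(P_n)^t at the variables in \<open>\<sigma>\<close>. Only those variables
  may have negative exponents, and multiplying by them raises the sum on each edge that they touch,
  so an untouched edge of small sum is what keeps the monomial nonzero.\<close>

definition degree_complex :: "nat \<Rightarrow> nat \<Rightarrow> (nat \<Rightarrow> int) \<Rightarrow> nat set set" where
  "degree_complex t n \<alpha> = {\<sigma>. \<sigma> \<subseteq> {1..n} \<and> (\<forall>i\<in>{1..n}. \<alpha> i < 0 \<longrightarrow> i \<in> \<sigma>) \<and>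
     (\<exists>i\<in>{1..<n}. \<alpha> i + \<alpha> (Suc i) < int t \<and> i \<notin> \<sigma> \<and> Suc i \<notin> \<sigma>)}"

lemma interval_closed_covers: "interval_closed (covers t m \<alpha>)"
  unfolding interval_closed_def covers_def by blast

lemma interval_closed_degree_complex: "interval_closed (degree_complex t n \<alpha>)"
  unfolding interval_closed_def degree_complex_def by blast

text \<open>The end of the peeling. The family \<open>{{}}\<close> has cohomology in level 0 only,
  by \<open>not_exact_at_point\<close> and \<open>exact_at_point_Suc\<close>.\<close>

lemma covers_0: "covers t 0 \<alpha> = {{}}"
  by (auto simp: covers_def)

lemma exact_at_empty: "exact_at TYPE('a::field) {} p"
  by (auto simp: exact_at_def intro: exI[of _ "\<lambda>_. 0"])

lemma not_exact_at_point: "\<not> exact_at TYPE('a::field) {{}} 0"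
proof
  assume ex: "exact_at TYPE('a) {{}} 0"
  show False
    by (rule exact_atD[OF ex, of "\<lambda>\<sigma>. if \<sigma> = {} then 1 else 0"]) (auto simp: cobd_def split: if_splits)
qed

lemma exact_at_point_Suc: "exact_at TYPE('a::field) {{}} (Suc p)"
  by (auto simp: exact_at_def intro: exI[of _ "\<lambda>_. 0"])

section \<open>Peeling the last vertex off a family of covers\<close>

lemma subset_atLeastAtMost_Suc: "\<sigma> \<subseteq> {1..Suc m} \<Longrightarrow> Suc m \<notin> \<sigma> \<Longrightarrow> \<sigma> \<subseteq> {1..m}"
  by (fastforce simp: subset_iff le_Suc_eq)

lemma ball_Suc_le: "(\<forall>i\<in>{1..Suc m}. P i) \<longleftrightarrow> P (Suc m) \<and> (\<forall>i\<in>{1..m}. P i)"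
  by (simp add: atLeastAtMostSuc_conv)

lemma ball_Suc_less: "(\<forall>i\<in>{1..<Suc (Suc m)}. P i) \<longleftrightarrow> P (Suc m) \<and> (\<forall>i\<in>{1..<Suc m}. P i)"
  by (auto simp: less_Suc_eq)

lemma exact_covers_0:
  "exact_at TYPE('a::field) (covers t (Suc m) \<alpha>) 0"
  by (rule exact_at_link_0[of _ "Suc m"]) (auto simp: covers_def intro: finite_subset)

lemma exact_covers_Suc:
  "exact_at TYPE('a::field) (covers t (Suc m) \<alpha>) (Suc p) \<longleftrightarrow>
   exact_at TYPE('a) {\<sigma>. Suc m \<notin> \<sigma> \<and> \<sigma> \<notin> covers t (Suc m) \<alpha> \<and> insert (Suc m) \<sigma> \<in> covers t (Suc m) \<alpha>} p"
proof (rule exact_at_link[OF interval_closed_covers])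
  fix \<sigma> assume "\<sigma> \<in> covers t (Suc m) \<alpha>"
  then show "finite \<sigma> \<and> (\<forall>i\<in>\<sigma>. i \<le> Suc m)"
    by (auto simp: covers_def intro: finite_subset)
  show "insert (Suc m) \<sigma> \<in> covers t (Suc m) \<alpha>"
    using \<open>\<sigma> \<in> covers t (Suc m) \<alpha>\<close> by (auto simp: covers_def)
qed

text \<open>A forced last vertex covers its edge to \<open>m\<close>, so what remains is a condition
  on the path up to \<open>m\<close>, one level lower.\<close>

lemma exact_covers_forced:
  assumes "\<alpha> (Suc m) < 0"
  shows "exact_at TYPE('a::field) (covers t (Suc m) \<alpha>) (Suc p) \<longleftrightarrow> exact_at TYPE('a) (covers t m \<alpha>) p"
proof -
  have "{\<sigma>. Suc m \<notin> \<sigma> \<and> \<sigma> \<notin> covers t (Suc m) \<alpha> \<and> insert (Suc m) \<sigma> \<in> covers t (Suc m) \<alpha>} = covers t m \<alpha>"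
  proof (intro equalityI subsetI)
    fix \<sigma> assume "\<sigma> \<in> {\<sigma>. Suc m \<notin> \<sigma> \<and> \<sigma> \<notin> covers t (Suc m) \<alpha> \<and> insert (Suc m) \<sigma> \<in> covers t (Suc m) \<alpha>}"
    then show "\<sigma> \<in> covers t m \<alpha>"
      using subset_atLeastAtMost_Suc[of \<sigma> m] by (auto simp: covers_def)
  next
    fix \<sigma> assume \<sigma>: "\<sigma> \<in> covers t m \<alpha>"
    then have "\<sigma> \<subseteq> {1..m}" by (simp add: covers_def)
    then have "Suc m \<notin> \<sigma>" by auto
    moreover have "\<sigma> \<notin> covers t (Suc m) \<alpha>"
      using \<open>Suc m \<notin> \<sigma>\<close> assms unfolding covers_def mem_Collect_eq ball_Suc_le by blast
    moreover have "insert (Suc m) \<sigma> \<in> covers t (Suc m) \<alpha>"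
      using \<sigma> unfolding covers_def mem_Collect_eq ball_Suc_le by (auto simp: less_Suc_eq)
    ultimately show "\<sigma> \<in> {\<sigma>. Suc m \<notin> \<sigma> \<and> \<sigma> \<notin> covers t (Suc m) \<alpha> \<and> insert (Suc m) \<sigma> \<in> covers t (Suc m) \<alpha>}"
      by blast
  qed
  then show ?thesis by (simp add: exact_covers_Suc)
qed

lemma exact_covers_isolated:
  assumes "\<alpha> (Suc m) \<ge> 0" "m = 0 \<or> \<alpha> m < 0 \<or> \<alpha> m + \<alpha> (Suc m) \<ge> int t"
  shows "exact_at TYPE('a::field) (covers t (Suc m) \<alpha>) p"
proof (cases p)
  case (Suc q)
  have "{\<sigma>. Suc m \<notin> \<sigma> \<and> \<sigma> \<notin> covers t (Suc m) \<alpha> \<and> insert (Suc m) \<sigma> \<in> covers t (Suc m) \<alpha>} = {}"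
  proof -
    have "\<sigma> \<in> covers t (Suc m) \<alpha>" if "Suc m \<notin> \<sigma>" "insert (Suc m) \<sigma> \<in> covers t (Suc m) \<alpha>" for \<sigma>
      using that assms unfolding covers_def
      by (cases m) (auto simp: ball_Suc_le ball_Suc_less)
    then show ?thesis by blast
  qed
  then show ?thesis by (simp only: exact_covers_Suc exact_at_empty Suc)
qed (simp add: exact_covers_0)

text \<open>If the edge \<open>{m + 1, m + 2}\<close> has to be covered, the link of \<open>m + 2\<close> modulo its deletion
  consists of the covers that avoid \<open>m + 1\<close>; they contain \<open>m\<close> if \<open>{m, m + 1}\<close> has to be covered too,
  which is recorded by making the degree at \<open>m\<close> negative.\<close>

definition force :: "nat \<Rightarrow> nat \<Rightarrow> (nat \<Rightarrow> int) \<Rightarrow> nat \<Rightarrow> int" where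
  "force t m \<alpha> = (if \<alpha> m + \<alpha> (Suc m) < int t then \<alpha>(m := -1) else \<alpha>)"

text \<open>The new degree at \<open>m\<close> also changes the sum on the edge to
  \<open>m - 1\<close>, but then \<open>m\<close> belongs to the cover and that edge is covered in
  either case. For \<open>m = 0\<close> only a degree off the path is overwritten.\<close>

lemma covers_force:
  assumes "\<alpha> (Suc m) \<ge> 0"
  shows "\<sigma> \<in> covers t m (force t m \<alpha>) \<longleftrightarrow> Suc m \<notin> \<sigma> \<and> \<sigma> \<in> covers t (Suc m) \<alpha>"
proof (cases m)
  case 0
  then show ?thesis using assms by (auto simp: covers_def subset_singleton_iff)
next
  case (Suc l)
  have sub: "\<sigma> \<subseteq> {1..m} \<longleftrightarrow> Suc m \<notin> \<sigma> \<and> \<sigma> \<subseteq> {1..Suc m}"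
    using subset_atLeastAtMost_Suc[of \<sigma> m] by auto
  have edges: "(\<forall>i\<in>{1..<m}. force t m \<alpha> i + force t m \<alpha> (Suc i) < int t \<longrightarrow> i \<in> \<sigma> \<or> Suc i \<in> \<sigma>) \<longleftrightarrow>
    (\<forall>i\<in>{1..<m}. \<alpha> i + \<alpha> (Suc i) < int t \<longrightarrow> i \<in> \<sigma> \<or> Suc i \<in> \<sigma>)"
    if "\<alpha> m + \<alpha> (Suc m) < int t \<longrightarrow> m \<in> \<sigma>"
    using that by (auto simp: force_def Suc ball_Suc_less)
  have forced: "(\<forall>i\<in>{1..m}. force t m \<alpha> i < 0 \<longrightarrow> i \<in> \<sigma>) \<longleftrightarrow>
     (\<forall>i\<in>{1..m}. \<alpha> i < 0 \<longrightarrow> i \<in> \<sigma>) \<and> (\<alpha> m + \<alpha> (Suc m) < int t \<longrightarrow> m \<in> \<sigma>)"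
    using Suc by (auto simp: force_def ball_Suc_le)
  have last: "(\<forall>i\<in>{1..<Suc m}. E i) \<longleftrightarrow> E m \<and> (\<forall>i\<in>{1..<m}. E i)" for E
    using ball_Suc_less[of l E] Suc by simp
  have "\<not> \<alpha> (Suc m) < 0" using assms by simp
  then show ?thesis
    unfolding covers_def ball_Suc_le mem_Collect_eq sub forced last
    using edges by blast
qed

text \<open>A set that becomes a cover only by adding the last vertex fails at the last edge and
  nowhere else, so it avoids \<open>m + 1\<close>. Two vertices go, the level drops by one.\<close>

lemma exact_covers_edge:
  assumes "\<alpha> (Suc m) \<ge> 0" "\<alpha> (Suc (Suc m)) \<ge> 0" "\<alpha> (Suc m) + \<alpha> (Suc (Suc m)) < int t"
  shows "exact_at TYPE('a::field) (covers t (Suc (Suc m)) \<alpha>) (Suc p) \<longleftrightarrow>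
    exact_at TYPE('a) (covers t m (force t m \<alpha>)) p"
proof -
  have "Suc (Suc m) \<notin> \<sigma> \<and> \<sigma> \<notin> covers t (Suc (Suc m)) \<alpha> \<and> insert (Suc (Suc m)) \<sigma> \<in> covers t (Suc (Suc m)) \<alpha> \<longleftrightarrow>
    Suc m \<notin> \<sigma> \<and> \<sigma> \<in> covers t (Suc m) \<alpha>" (is "?L \<longleftrightarrow> ?R") for \<sigma>
  proof
    assume ?L
    then show ?R using assms subset_atLeastAtMost_Suc[of \<sigma> "Suc m"]
      unfolding covers_def mem_Collect_eq ball_Suc_le ball_Suc_less by auto
  next
    assume R: ?R
    then have "\<sigma> \<subseteq> {1..Suc m}" by (simp add: covers_def)
    then have "Suc (Suc m) \<notin> \<sigma>" "\<sigma> \<subseteq> {1..Suc (Suc m)}" by auto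
    then show ?L using R assms
      unfolding covers_def mem_Collect_eq ball_Suc_le ball_Suc_less by auto
  qed
  then show ?thesis
    unfolding exact_covers_Suc by (simp add: covers_force[of \<alpha>, OF assms(1), symmetric])
qed

section \<open>Peeling the last vertex off a degree complex\<close>

lemma degree_complex_bounded: "\<sigma> \<in> degree_complex t n \<alpha> \<Longrightarrow> finite \<sigma> \<and> (\<forall>i\<in>\<sigma>. i \<le> n)"
  by (auto simp: degree_complex_def intro: finite_subset)

lemma bex_Suc_less: "(\<exists>i\<in>{1..<Suc (Suc m)}. P i) \<longleftrightarrow> P (Suc m) \<or> (\<exists>i\<in>{1..<Suc m}. P i)"
  by (auto simp: less_Suc_eq)

text \<open>Every member contains the last vertex, so the missed edge lies in the shorter path and
  the family is a shift.\<close>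

lemma exact_degree_complex_forced:
  assumes "\<alpha> (Suc n) < 0"
  shows "exact_at TYPE('a::field) (degree_complex t (Suc n) \<alpha>) (Suc p) \<longleftrightarrow>
    exact_at TYPE('a) (degree_complex t n \<alpha>) p"
proof -
  have "degree_complex t (Suc n) \<alpha> = insert (Suc n) ` degree_complex t n \<alpha>" (is "?L = ?R")
  proof (intro equalityI subsetI)
    fix \<sigma> assume \<sigma>: "\<sigma> \<in> ?L"
    then have n: "Suc n \<in> \<sigma>" using assms by (auto simp: degree_complex_def)
    have "\<sigma> - {Suc n} \<in> degree_complex t n \<alpha>"
      using \<sigma> n by (cases n) (auto simp: degree_complex_def le_Suc_eq less_Suc_eq)
    then show "\<sigma> \<in> ?R" using n by (metis imageI insert_Diff)
  next
    fix \<sigma> assume "\<sigma> \<in> ?R"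
    then obtain \<rho> where \<rho>: "\<sigma> = insert (Suc n) \<rho>" "\<rho> \<in> degree_complex t n \<alpha>" by blast
    then have "\<rho> \<subseteq> {1..n}" by (simp add: degree_complex_def)
    then show "\<sigma> \<in> ?L" using \<rho>
      by (cases n) (auto simp: degree_complex_def ball_Suc_le bex_Suc_less)
  qed
  moreover have "exact_at TYPE('a) (insert (Suc n) ` degree_complex t n \<alpha>) (Suc p) \<longleftrightarrow>
      exact_at TYPE('a) (degree_complex t n \<alpha>) p"
    by (rule exact_at_shift) (use degree_complex_bounded in fastforce)
  ultimately show ?thesis by simp
qed

lemma exact_degree_complex_forced_0:
  assumes "\<alpha> (Suc n) < 0"
  shows "exact_at TYPE('a::field) (degree_complex t (Suc n) \<alpha>) 0"
proof -
  have "card \<sigma> \<noteq> 0" if "\<sigma> \<in> degree_complex t (Suc n) \<alpha>" for \<sigma>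
  proof -
    have "finite \<sigma>" using degree_complex_bounded[OF that] by blast
    moreover have "Suc n \<in> \<sigma>" using that assms by (simp add: degree_complex_def)
    ultimately show ?thesis by auto
  qed
  then show ?thesis unfolding exact_at_def by (intro allI impI exI[of _ "\<lambda>_. 0"]) fastforce
qed

lemma exact_degree_complex_deletion:
  assumes "\<alpha> (Suc n) \<ge> 0"
  shows "exact_at TYPE('a::field) (degree_complex t (Suc n) \<alpha>) p \<longleftrightarrow>
    exact_at TYPE('a) {\<sigma>. Suc n \<notin> \<sigma> \<and> \<sigma> \<in> degree_complex t (Suc n) \<alpha> \<and>
      insert (Suc n) \<sigma> \<notin> degree_complex t (Suc n) \<alpha>} p"
proof (rule exact_at_deletion[OF interval_closed_degree_complex degree_complex_bounded])
  fix \<sigma> assume "\<sigma> \<in> degree_complex t (Suc n) \<alpha>"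
  then show "\<sigma> - {Suc n} \<in> degree_complex t (Suc n) \<alpha>"
    using assms unfolding degree_complex_def by fastforce
qed

text \<open>The last edge cannot be the missed edge of small sum, so adding the last vertex keeps a
  member in the complex: the family is a cone.\<close>

lemma exact_degree_complex_isolated:
  assumes "\<alpha> (Suc n) \<ge> 0" "n = 0 \<or> \<alpha> n < 0 \<or> \<alpha> n + \<alpha> (Suc n) \<ge> int t"
  shows "exact_at TYPE('a::field) (degree_complex t (Suc n) \<alpha>) p"
proof -
  have "insert (Suc n) \<sigma> \<in> degree_complex t (Suc n) \<alpha>"
    if "Suc n \<notin> \<sigma>" "\<sigma> \<in> degree_complex t (Suc n) \<alpha>" for \<sigma>
    using that assms unfolding degree_complex_def
    by (cases n) (auto simp: ball_Suc_le bex_Suc_less)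
  then have "{\<sigma>. Suc n \<notin> \<sigma> \<and> \<sigma> \<in> degree_complex t (Suc n) \<alpha> \<and>
      insert (Suc n) \<sigma> \<notin> degree_complex t (Suc n) \<alpha>} = {}" by blast
  then show ?thesis by (simp only: exact_degree_complex_deletion[of \<alpha>, OF assms(1)] exact_at_empty)
qed

text \<open>A set that leaves the complex when the last vertex is added misses the last edge and
  covers all others of small sum. This is a deletion and not a link, so the level stays; hence the
  \<open>Suc p\<close> in \<open>degree_complex_exact_bound\<close>.\<close>

lemma exact_degree_complex_edge:
  assumes "\<alpha> (Suc m) \<ge> 0" "\<alpha> (Suc (Suc m)) \<ge> 0" "\<alpha> (Suc m) + \<alpha> (Suc (Suc m)) < int t"
  shows "exact_at TYPE('a::field) (degree_complex t (Suc (Suc m)) \<alpha>) p \<longleftrightarrow>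
    exact_at TYPE('a) (covers t m (force t m \<alpha>)) p"
proof -
  have "Suc (Suc m) \<notin> \<sigma> \<and> \<sigma> \<in> degree_complex t (Suc (Suc m)) \<alpha> \<and>
      insert (Suc (Suc m)) \<sigma> \<notin> degree_complex t (Suc (Suc m)) \<alpha> \<longleftrightarrow>
    Suc m \<notin> \<sigma> \<and> \<sigma> \<in> covers t (Suc m) \<alpha>" (is "?L \<longleftrightarrow> ?R") for \<sigma>
  proof
    assume ?L
    then show ?R using assms subset_atLeastAtMost_Suc[of \<sigma> "Suc m"]
      unfolding covers_def degree_complex_def mem_Collect_eq ball_Suc_le ball_Suc_less bex_Suc_less by auto
  next
    assume R: ?R
    then have "\<sigma> \<subseteq> {1..Suc m}" by (simp add: covers_def)
    then have "Suc (Suc m) \<notin> \<sigma>" "\<sigma> \<subseteq> {1..Suc (Suc m)}" by auto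
    then show ?L using R assms
      unfolding covers_def degree_complex_def mem_Collect_eq ball_Suc_le ball_Suc_less bex_Suc_less by auto
  qed
  then show ?thesis
    unfolding exact_degree_complex_deletion[of \<alpha>, OF assms(2)] by (simp add: covers_force[of \<alpha>, OF assms(1), symmetric])
qed

text \<open>A forced vertex lowers \<open>(m, p)\<close> by \<open>(1, 1)\<close> and a pair by
  \<open>(2, 1)\<close>, so \<open>m - p\<close> counts the pairs and \<open>2 * p - m\<close> the
  forced vertices; the first two conjuncts keep these natural subtractions exact. The budget
  \<open>r\<close> bounds the number of pairs that can be peeled off before the next forced vertex:
  it loses one with each pair and is \<open>t\<close> again after a forced vertex.\<close>

lemma covers_exact_bound:
  assumes "\<not> exact_at TYPE('a::field) (covers t m \<alpha>) p"
    and "0 \<le> r" "r \<le> int t" "m > 0 \<Longrightarrow> \<alpha> m \<ge> 0 \<Longrightarrow> \<alpha> m \<ge> int t - r"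
  shows "m \<le> 2 * p \<and> p \<le> m \<and> int (m - p) \<le> int (2 * p - m) * int t + r"
  using assms
proof (induction m arbitrary: \<alpha> p r rule: less_induct)
  case (less m)
  consider "m = 0" | l where "m = Suc l" "\<alpha> m < 0"
    | l where "m = Suc l" "\<alpha> m \<ge> 0" "l = 0 \<or> \<alpha> l < 0 \<or> \<alpha> l + \<alpha> m \<ge> int t"
    | l where "m = Suc (Suc l)" "\<alpha> m \<ge> 0" "\<alpha> (Suc l) \<ge> 0" "\<alpha> (Suc l) + \<alpha> m < int t"
    by (metis not_le not0_implies_Suc)
  then show ?case
  proof cases
    case 1
    then have "p = 0" using less.prems(1) exact_at_point_Suc by (cases p) (auto simp: covers_0)
    then show ?thesis using 1 less.prems by simp
  next
    case 2
    obtain q where q: "p = Suc q"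
      using less.prems(1) exact_covers_0 2 by (metis not0_implies_Suc)
    then have "\<not> exact_at TYPE('a) (covers t l \<alpha>) q"
      using less.prems(1) 2 exact_covers_forced[where ?'a = 'a, of \<alpha> l] by simp
    \<comment> \<open>Behind a forced vertex the next exponent, if not negative, is only known to be
      at least 0, which is the budget \<open>t\<close>.\<close>
    from less.IH[OF _ this, of "int t"] 2
    have IH: "l \<le> 2 * q \<and> q \<le> l \<and> int (l - q) \<le> int (2 * q - l) * int t + int t" by auto
    then have "int (2 * p - m) = int (2 * q - l) + 1" using 2 q by auto
    then have e: "int (2 * p - m) * int t = int (2 * q - l) * int t + int t" by (simp only: distrib_right mult_1)
    have d: "m - p = l - q" using 2 q by simp
    show ?thesis unfolding e d using IH 2 q less.prems(2) by auto
  next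
    case 3
    then show ?thesis using less.prems(1) exact_covers_isolated[where ?'a = 'a, of \<alpha> l] by auto
  next
    case 4
    obtain q where q: "p = Suc q"
      using less.prems(1) exact_covers_0 4 by (metis not0_implies_Suc)
    \<comment> \<open>The pair has sum less than \<open>t\<close>, so a right exponent of at least
      \<open>t - r\<close> leaves at most \<open>r - 1\<close> for the left one. If the edge to
      \<open>l\<close> has sum at least \<open>t\<close>, the next right exponent is therefore at
      least \<open>t - (r - 1)\<close>.\<close>
    have r: "1 \<le> r" "\<alpha> (Suc l) \<le> r - 1" using less.prems(4) 4 by auto
    have "\<not> exact_at TYPE('a) (covers t l (force t l \<alpha>)) q"
      using less.prems(1) 4 exact_covers_edge[where ?'a = 'a, of \<alpha> l] q by simp
    moreover have "force t l \<alpha> l \<ge> int t - (r - 1)" if "force t l \<alpha> l \<ge> 0"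
      using that r(2) by (auto simp: force_def split: if_splits)
    ultimately have IH: "l \<le> 2 * q \<and> q \<le> l \<and> int (l - q) \<le> int (2 * q - l) * int t + (r - 1)"
      by (intro less.IH) (use 4(1) r less.prems(3) in auto)
    then show ?thesis using 4 q by auto
  qed
qed

lemma degree_complex_exact_bound:
  assumes "\<not> exact_at TYPE('a::field) (degree_complex t n \<alpha>) p"
  shows "p < n \<and> n \<le> 2 * Suc p \<and> int (n - Suc p) \<le> int (2 * Suc p - n) * int t + int t"
  using assms
proof (induction n arbitrary: p rule: less_induct)
  case (less n)
  consider "n = 0" | l where "n = Suc l" "\<alpha> n < 0"
    | l where "n = Suc l" "\<alpha> n \<ge> 0" "l = 0 \<or> \<alpha> l < 0 \<or> \<alpha> l + \<alpha> n \<ge> int t"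
    | l where "n = Suc (Suc l)" "\<alpha> n \<ge> 0" "\<alpha> (Suc l) \<ge> 0" "\<alpha> (Suc l) + \<alpha> n < int t"
    by (metis not_le not0_implies_Suc)
  then show ?case
  proof cases
    case 1
    then have "degree_complex t n \<alpha> = {}" by (auto simp: degree_complex_def)
    then show ?thesis using less.prems exact_at_empty by metis
  next
    case 2
    obtain q where q: "p = Suc q"
      using less.prems(1) exact_degree_complex_forced_0 2 by (metis not0_implies_Suc)
    then have "\<not> exact_at TYPE('a) (degree_complex t l \<alpha>) q"
      using less.prems(1) 2 exact_degree_complex_forced[where ?'a = 'a, of \<alpha> l] by simp
    from less.IH[OF _ this] 2
    have IH: "q < l \<and> l \<le> 2 * Suc q \<and> int (l - Suc q) \<le> int (2 * Suc q - l) * int t + int t" by auto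
    then have "int (2 * Suc p - n) = int (2 * Suc q - l) + 1" using 2 q by auto
    then have e: "int (2 * Suc p - n) * int t = int (2 * Suc q - l) * int t + int t"
      by (simp only: distrib_right mult_1)
    have d: "n - Suc p = l - Suc q" using 2 q by simp
    show ?thesis unfolding e d using IH 2 q by auto
  next
    case 3
    then show ?thesis using less.prems(1) exact_degree_complex_isolated[where ?'a = 'a, of \<alpha> l] by auto
  next
    case 4
    have "\<not> exact_at TYPE('a) (covers t l (force t l \<alpha>)) p"
      using less.prems(1) 4 exact_degree_complex_edge[where ?'a = 'a, of \<alpha> l] by simp
    \<comment> \<open>The right exponent of this first pair is only known to be nonnegative, so the
      left one is at most \<open>t - 1\<close>, and the budget for the remaining pairs is
      \<open>t - 1\<close>.\<close>
    moreover have "force t l \<alpha> l \<ge> int t - (int t - 1)" if "force t l \<alpha> l \<ge> 0"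
      using that 4 by (auto simp: force_def split: if_splits)
    ultimately have IH: "l \<le> 2 * p \<and> p \<le> l \<and> int (l - p) \<le> int (2 * p - l) * int t + (int t - 1)"
      using covers_exact_bound[of t l "force t l \<alpha>" p "int t - 1"] 4 by simp
    then show ?thesis using 4 by auto
  qed
qed

section \<open>Exponent vectors that attain the bound\<close>

lemma covers_cong: "(\<And>i. i \<in> {1..m} \<Longrightarrow> \<alpha> i = \<beta> i) \<Longrightarrow> covers t m \<alpha> = covers t m \<beta>"
  unfolding covers_def by (intro Collect_cong conj_cong refl ball_cong) auto

text \<open>Blocks are filled greedily from the right. Here \<open>r\<close> is the least right
  exponent allowed for the next pair: a block uses the right exponents \<open>r\<close>,
  \<open>r + 1\<close>, and so on, and is full when \<open>r = t\<close>; then a forced vertex is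
  placed and \<open>r\<close> is 0 again. Once \<open>f = 0\<close>, all remaining vertices are
  forced.\<close>

lemma covers_not_exact:
  assumes "m = 2 * f + w" "f + r \<le> (w + 1) * t" "r \<le> t"
  shows "\<exists>\<alpha>. \<not> exact_at TYPE('a::field) (covers t m \<alpha>) (m - f) \<and> (\<alpha> m = -1 \<or> \<alpha> m \<ge> int r \<or> m = 0)"
  using assms
proof (induction m arbitrary: f w r rule: less_induct)
  case (less m)
  consider "m = 0" | l where "m = Suc l" "f = 0" | g where "f = Suc g" "r < t" | g where "f = Suc g" "r = t"
    using less.prems by (cases m; cases f; cases "r = t") auto
  then show ?case
  proof cases
    case 1
    then show ?thesis using not_exact_at_point by (auto simp: covers_0)
  next
    case 2
    then obtain v where v: "w = Suc v" using less.prems(1) by (cases w) auto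
    have "\<exists>\<alpha>. \<not> exact_at TYPE('a) (covers t l \<alpha>) (l - 0) \<and> (\<alpha> l = -1 \<or> \<alpha> l \<ge> int 0 \<or> l = 0)"
      by (rule less.IH[where w = v]) (use 2 v less.prems in auto)
    then obtain \<alpha> where \<alpha>: "\<not> exact_at TYPE('a) (covers t l \<alpha>) l" by auto
    define \<beta> where "\<beta> = \<alpha>(m := -1)"
    have "\<beta> m = -1" by (simp add: \<beta>_def)
    have "covers t l \<beta> = covers t l \<alpha>" by (rule covers_cong) (use 2 in \<open>auto simp: \<beta>_def\<close>)
    then have "\<not> exact_at TYPE('a) (covers t m \<beta>) (Suc l)"
      using \<alpha> exact_covers_forced[where ?'a = 'a, of \<beta> l] 2 \<open>\<beta> m = -1\<close> by simp
    then show ?thesis using 2 \<open>\<beta> m = -1\<close> by auto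
  next
    case 3
    define l where "l = m - 2"
    have l: "m = Suc (Suc l)" "l = 2 * g + w" using 3 less.prems by (auto simp: l_def)
    have "\<exists>\<alpha>. \<not> exact_at TYPE('a) (covers t l \<alpha>) (l - g) \<and> (\<alpha> l = -1 \<or> \<alpha> l \<ge> int (Suc r) \<or> l = 0)"
      by (rule less.IH[where w = w]) (use l 3 less.prems in auto)
    then obtain \<alpha> where \<alpha>: "\<not> exact_at TYPE('a) (covers t l \<alpha>) (l - g)"
      "\<alpha> l = -1 \<or> \<alpha> l \<ge> int (Suc r) \<or> l = 0" by auto
    \<comment> \<open>The left exponent makes the sum \<open>t - 1\<close>. With a next right
      exponent of at least \<open>r + 1\<close> the sum across is at least \<open>t\<close>, so
      \<open>force\<close> changes nothing; if the next vertex has degree \<open>-1\<close>, then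
      \<open>force\<close> only writes \<open>-1\<close> again.\<close>
    define \<beta> where "\<beta> = \<alpha>(Suc l := int t - int r - 1, m := int r)"
    have \<beta>: "\<beta> (Suc l) \<ge> 0" "\<beta> m = int r" "\<beta> (Suc l) + \<beta> m < int t"
      using 3 l(1) by (auto simp: \<beta>_def)
    have "covers t l (force t l \<beta>) = covers t l \<alpha>"
    proof (rule covers_cong)
      fix i assume "i \<in> {1..l}"
      then show "force t l \<beta> i = \<alpha> i"
        using \<alpha>(2) l(1) by (auto simp: force_def \<beta>_def)
    qed
    then have "\<not> exact_at TYPE('a) (covers t m \<beta>) (Suc (l - g))"
      using \<alpha> exact_covers_edge[where ?'a = 'a, of \<beta> l] l 3 \<beta> by simp
    moreover have "m - f = Suc (l - g)" using l 3 by simp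
    ultimately show ?thesis using \<beta>(2) by (intro exI[of _ \<beta>]) auto
  next
    case 4
    \<comment> \<open>The block is full and a pair is left to place, so the capacity bound leaves at
      least one forced vertex for a separator.\<close>
    then have w: "w > 0" using less.prems by (cases w) auto
    then obtain v where v: "w = Suc v" by (cases w) auto
    define l where "l = m - 1"
    have l: "m = Suc l" "l = 2 * f + v" using v less.prems by (auto simp: l_def)
    have "\<exists>\<alpha>. \<not> exact_at TYPE('a) (covers t l \<alpha>) (l - f) \<and> (\<alpha> l = -1 \<or> \<alpha> l \<ge> int 0 \<or> l = 0)"
      by (rule less.IH[where w = v]) (use l 4 v less.prems in auto)
    then obtain \<alpha> where \<alpha>: "\<not> exact_at TYPE('a) (covers t l \<alpha>) (l - f)" by auto
    define \<beta> where "\<beta> = \<alpha>(m := -1)"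
    have "\<beta> m = -1" by (simp add: \<beta>_def)
    have "covers t l \<beta> = covers t l \<alpha>" by (rule covers_cong) (use l in \<open>auto simp: \<beta>_def\<close>)
    then have "\<not> exact_at TYPE('a) (covers t m \<beta>) (Suc (l - f))"
      using \<alpha> exact_covers_forced[where ?'a = 'a, of \<beta> l] l \<open>\<beta> m = -1\<close> by simp
    moreover have "m - f = Suc (l - f)" using l by simp
    ultimately show ?thesis using \<open>\<beta> m = -1\<close> by auto
  qed
qed

lemma degree_complex_not_exact:
  assumes "n = 2 * Suc f + w" "Suc f \<le> (w + 1) * t" "t > 0"
  shows "\<exists>\<alpha>. \<not> exact_at TYPE('a::field) (degree_complex t n \<alpha>) (n - Suc (Suc f))"
proof -
  define l where "l = n - 2"
  have l: "n = Suc (Suc l)" "l = 2 * f + w" using assms by (auto simp: l_def)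
  obtain \<alpha> where \<alpha>: "\<not> exact_at TYPE('a) (covers t l \<alpha>) (l - f)" "\<alpha> l = -1 \<or> \<alpha> l \<ge> int 1 \<or> l = 0"
    using covers_not_exact[OF l(2), where r = 1 and t = t and ?'a = 'a] assms by auto
  \<comment> \<open>The first pair takes the right exponent 0 and the left exponent
    \<open>t - 1\<close>, so the next right exponent has to be at least 1; hence
    \<open>r = 1\<close> above.\<close>
  define \<beta> where "\<beta> = \<alpha>(Suc l := int t - 1, n := 0)"
  have "covers t l (force t l \<beta>) = covers t l \<alpha>"
  proof (rule covers_cong)
    fix i assume "i \<in> {1..l}"
    then show "force t l \<beta> i = \<alpha> i"
      using \<alpha>(2) l(1) by (auto simp: force_def \<beta>_def)
  qed
  then have "\<not> exact_at TYPE('a) (degree_complex t n \<beta>) (l - f)"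
    using \<alpha> exact_degree_complex_edge[where ?'a = 'a, of \<beta> l] l assms(3) by (simp add: \<beta>_def)
  moreover have "n - Suc (Suc f) = l - f" using l by simp
  ultimately show ?thesis by auto
qed

section \<open>Powers of the cover ideal\<close>

abbreviation mon :: "(nat \<Rightarrow>\<^sub>0 nat) \<Rightarrow> 'a::field mpoly" where
  "mon e \<equiv> Poly_Mapping.single e 1"

section \<open>Monomials and the polynomial ring\<close>

lemma lookup_single_mult:
  fixes f :: "'a::field mpoly"
  shows "Poly_Mapping.lookup (Poly_Mapping.single e c * f) (e + k) = c * Poly_Mapping.lookup f k"
  by (simp add: lookup_mult lookup_single when_mult Sum_any_when_dependent_prod_left eq_commute[of e])

lemma lookup_single_mult_eq_0:
  fixes f :: "'a::field mpoly"
  assumes "\<And>b. k \<noteq> e + b"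
  shows "Poly_Mapping.lookup (Poly_Mapping.single e c * f) k = 0"
  using assms by (simp add: lookup_mult lookup_single when_mult)

lemma keys_mon_mult:
  fixes f :: "'a::field mpoly"
  assumes "k \<in> Poly_Mapping.keys (mon e * f)"
  obtains b where "k = e + b" "b \<in> Poly_Mapping.keys f"
  using assms lookup_single_mult_eq_0[of k e 1 f] lookup_single_mult[of e 1 f]
  by (metis in_keys_iff mult_1)

lemma mon_mult: "mon e * mon d = (mon (e + d) :: 'a::field mpoly)"
  by (simp add: mult_single)

lemma sum_singles: "(\<Sum>b\<in>Poly_Mapping.keys f. Poly_Mapping.single b (Poly_Mapping.lookup f b)) = f"
  by (rule poly_mapping_eqI) (simp add: lookup_sum lookup_single when_def in_keys_iff)

lemma mpoly_ring_simps [simp]: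
  "mult (mpoly_ring n) = (*)" "one (mpoly_ring n) = 1" "zero (mpoly_ring n) = 0" "add (mpoly_ring n) = (+)"
  by (simp_all add: mpoly_ring_def)

lemma mpoly_ring_carrier:
  "f \<in> carrier (mpoly_ring n) \<longleftrightarrow> (\<forall>m\<in>Poly_Mapping.keys f. Poly_Mapping.keys m \<subseteq> {1..n})"
  by (simp add: mpoly_ring_def)

lemma keys_add_nat: "Poly_Mapping.keys (a + b) = Poly_Mapping.keys a \<union> Poly_Mapping.keys (b :: nat \<Rightarrow>\<^sub>0 nat)"
  by (auto simp: in_keys_iff lookup_add)

lemma mpoly_ring_closed:
  assumes f: "f \<in> carrier (mpoly_ring n)" and g: "g \<in> carrier (mpoly_ring n)"
  shows "f + g \<in> carrier (mpoly_ring n)" "f * g \<in> carrier (mpoly_ring n)" "- f \<in> carrier (mpoly_ring n)"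
    "f - g \<in> carrier (mpoly_ring n)"
proof -
  have add: "p + q \<in> carrier (mpoly_ring n)"
    if "p \<in> carrier (mpoly_ring n)" "q \<in> carrier (mpoly_ring n)" for p q :: "'a mpoly"
    using that Poly_Mapping.keys_add[of p q] unfolding mpoly_ring_carrier by blast
  have minus: "- p \<in> carrier (mpoly_ring n)" if "p \<in> carrier (mpoly_ring n)" for p :: "'a mpoly"
    using that unfolding mpoly_ring_carrier by (simp add: in_keys_iff)
  show "f + g \<in> carrier (mpoly_ring n)" "- f \<in> carrier (mpoly_ring n)"
    by (intro add minus f g)+
  have "f + - g \<in> carrier (mpoly_ring n)" by (intro add minus f g)
  then show "f - g \<in> carrier (mpoly_ring n)" by simp
  show "f * g \<in> carrier (mpoly_ring n)"
    unfolding mpoly_ring_carrier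
  proof
    fix m assume "m \<in> Poly_Mapping.keys (f * g)"
    then obtain c d where "m = c + d" "c \<in> Poly_Mapping.keys f" "d \<in> Poly_Mapping.keys g"
      using keys_mult[of f g] by blast
    then show "Poly_Mapping.keys m \<subseteq> {1..n}"
      using f g by (auto simp: mpoly_ring_carrier keys_add_nat)
  qed
qed

lemma cring_mpoly_ring: "cring (mpoly_ring n :: 'a::field mpoly ring)"
proof (rule cringI)
  show "abelian_group (mpoly_ring n :: 'a mpoly ring)"
  proof (rule abelian_groupI)
    fix f :: "'a mpoly" assume "f \<in> carrier (mpoly_ring n)"
    then show "\<exists>g\<in>carrier (mpoly_ring n). g \<oplus>\<^bsub>mpoly_ring n\<^esub> f = \<zero>\<^bsub>mpoly_ring n\<^esub>"
      by (intro bexI[of _ "- f"]) (auto simp: mpoly_ring_closed)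
  qed (auto simp: mpoly_ring_closed mpoly_ring_carrier[of 0] ac_simps)
  show "comm_monoid (mpoly_ring n :: 'a mpoly ring)"
    by unfold_locales (auto simp: mpoly_ring_closed mpoly_ring_carrier[of 1] ac_simps)
qed (auto simp: algebra_simps)

lemma mon_in_carrier: "mon e \<in> carrier (mpoly_ring n) \<longleftrightarrow> Poly_Mapping.keys e \<subseteq> {1..n}"
  by (simp add: mpoly_ring_carrier)

lemma a_inv_mpoly_ring: "f \<in> carrier (mpoly_ring n) \<Longrightarrow> \<ominus>\<^bsub>mpoly_ring n\<^esub> f = - f"
  by (rule abelian_group.minus_equality[OF ring.is_abelian_group[OF cring.axioms(1)[OF cring_mpoly_ring]]])
     (auto simp: mpoly_ring_closed)

text \<open>Read on exponents, this is the intersection of the ideals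
  \<open>(x_i, x_{i+1})^t\<close>, the symbolic power of the cover ideal.
  \<open>cover_ideal_power\<close> identifies it with the ordinary power.\<close>

definition edge_ideal :: "nat \<Rightarrow> nat \<Rightarrow> 'a::field mpoly set" where
  "edge_ideal n t = {f \<in> carrier (mpoly_ring n). \<forall>b\<in>Poly_Mapping.keys f.
     \<forall>i\<in>{1..<n}. t \<le> Poly_Mapping.lookup b i + Poly_Mapping.lookup b (Suc i)}"

lemma edge_ideal_zero: "0 \<in> edge_ideal n t"
  by (simp add: edge_ideal_def mpoly_ring_carrier)

lemma edge_ideal_add: "f \<in> edge_ideal n t \<Longrightarrow> g \<in> edge_ideal n t \<Longrightarrow> f + g \<in> edge_ideal n t"
  using Poly_Mapping.keys_add[of f g] unfolding edge_ideal_def by (auto simp: mpoly_ring_closed)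

lemma edge_ideal_uminus: "f \<in> edge_ideal n t \<Longrightarrow> - f \<in> edge_ideal n t"
  unfolding edge_ideal_def by (auto simp: mpoly_ring_closed in_keys_iff)

lemma edge_ideal_mult:
  assumes "f \<in> edge_ideal n s" "g \<in> edge_ideal n t"
  shows "f * g \<in> edge_ideal n (s + t)"
proof -
  have "s + t \<le> Poly_Mapping.lookup b i + Poly_Mapping.lookup b (Suc i)"
    if "b \<in> Poly_Mapping.keys (f * g)" "i \<in> {1..<n}" for b i
  proof -
    obtain c d where cd: "b = c + d" "c \<in> Poly_Mapping.keys f" "d \<in> Poly_Mapping.keys g"
      using \<open>b \<in> _\<close> keys_mult[of f g] by blast
    then have "s \<le> Poly_Mapping.lookup c i + Poly_Mapping.lookup c (Suc i)"
       "t \<le> Poly_Mapping.lookup d i + Poly_Mapping.lookup d (Suc i)"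
      using assms that(2) by (auto simp: edge_ideal_def)
    then show ?thesis by (simp add: cd(1) lookup_add)
  qed
  then show ?thesis using assms by (auto simp: edge_ideal_def mpoly_ring_closed)
qed

lemma edge_ideal_0: "edge_ideal n 0 = carrier (mpoly_ring n)"
  by (auto simp: edge_ideal_def)

lemma ideal_edge_ideal: "ideal (edge_ideal n t) (mpoly_ring n :: 'a::field mpoly ring)"
proof (rule idealI[OF cring.axioms(1)[OF cring_mpoly_ring]])
  show "subgroup (edge_ideal n t :: 'a mpoly set) (add_monoid (mpoly_ring n))"
  proof
    fix f :: "'a mpoly" assume "f \<in> edge_ideal n t"
    then show "inv\<^bsub>add_monoid (mpoly_ring n)\<^esub> f \<in> edge_ideal n t"
      using a_inv_mpoly_ring[of f n] edge_ideal_uminus[of f] by (simp add: a_inv_def edge_ideal_def)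
  qed (auto simp: edge_ideal_zero edge_ideal_add, auto simp: edge_ideal_def)
  fix f g :: "'a mpoly" assume "f \<in> edge_ideal n t" "g \<in> carrier (mpoly_ring n)"
  then show "g \<otimes>\<^bsub>mpoly_ring n\<^esub> f \<in> edge_ideal n t" "f \<otimes>\<^bsub>mpoly_ring n\<^esub> g \<in> edge_ideal n t"
    using edge_ideal_mult[of f n t g 0] by (auto simp: edge_ideal_0 mult.commute)
qed

section \<open>Ordinary powers of the cover ideal\<close>

definition indicator_exp :: "nat set \<Rightarrow> nat \<Rightarrow>\<^sub>0 nat" where
  "indicator_exp \<sigma> = (\<Sum>i\<in>\<sigma>. Poly_Mapping.single i 1)"

lemma lookup_indicator_exp: "finite \<sigma> \<Longrightarrow> Poly_Mapping.lookup (indicator_exp \<sigma>) i = (if i \<in> \<sigma> then 1 else 0)"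
  by (simp add: indicator_exp_def lookup_sum lookup_single when_def)

lemma prod_Var: "finite \<sigma> \<Longrightarrow> (\<Prod>i\<in>\<sigma>. Var i) = (mon (indicator_exp \<sigma>) :: 'a::field mpoly)"
  by (induction \<sigma> rule: finite_induct) (simp_all add: indicator_exp_def Var_def mult_single)

lemma minimal_vertex_cover_below:
  assumes "finite C" "vertex_cover V E C"
  shows "\<exists>D\<subseteq>C. minimal_vertex_cover V E D"
  using assms
proof (induction C rule: finite_psubset_induct)
  case (psubset C)
  show ?case
  proof (cases "minimal_vertex_cover V E C")
    case False
    then obtain D where "D \<subset> C" "vertex_cover V E D" using psubset.prems by (auto simp: minimal_vertex_cover_def)
    then show ?thesis using psubset.IH by (meson psubset_imp_subset subset_trans)
  qed blast
qed

lemma path_vertex_cover_iff: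
  "vertex_cover {1..n} (path_edges n) C \<longleftrightarrow> C \<subseteq> {1..n} \<and> (\<forall>i\<in>{1..<n}. i \<in> C \<or> Suc i \<in> C)"
proof -
  have "path_edges n = (\<lambda>i. {i, Suc i}) ` {1..<n}"
    unfolding path_edges_def by (auto simp: image_iff)
  then show ?thesis by (simp add: vertex_cover_def)
qed

lemma cover_ideal_subset: "cover_ideal n (path_edges n) \<subseteq> (edge_ideal n 1 :: 'a::field mpoly set)"
  unfolding cover_ideal_def
proof (rule ring.genideal_minimal[OF cring.axioms(1)[OF cring_mpoly_ring] ideal_edge_ideal], safe)
  fix \<tau> assume "minimal_vertex_cover {1..n} (path_edges n) \<tau>"
  then have \<tau>: "\<tau> \<subseteq> {1..n}" "\<forall>i\<in>{1..<n}. i \<in> \<tau> \<or> Suc i \<in> \<tau>"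
    using path_vertex_cover_iff by (auto simp only: minimal_vertex_cover_def)
  then have fin: "finite \<tau>" by (rule_tac finite_subset) auto
  then have "Poly_Mapping.keys (indicator_exp \<tau>) \<subseteq> {1..n}"
    using \<tau>(1) by (auto simp: in_keys_iff lookup_indicator_exp split: if_splits)
  then show "(\<Prod>i\<in>\<tau>. Var i) \<in> (edge_ideal n 1 :: 'a mpoly set)"
    unfolding prod_Var[OF fin] edge_ideal_def
    using \<tau> fin by (auto simp: mon_in_carrier lookup_indicator_exp)
qed

lemma cover_ideal_generator:
  assumes "minimal_vertex_cover {1..n} (path_edges n) \<tau>"
  shows "mon (indicator_exp \<tau>) \<in> (cover_ideal n (path_edges n) :: 'a::field mpoly set)"
proof -
  have "\<tau> \<subseteq> {1..n}"
    using assms by (simp add: minimal_vertex_cover_def vertex_cover_def)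
  then have fin: "finite \<tau>" by (rule finite_subset) simp
  then have "(\<Prod>i\<in>\<tau>. Var i) \<in> (cover_ideal n (path_edges n) :: 'a mpoly set)"
    unfolding cover_ideal_def genideal_def using assms by blast
  then show ?thesis by (simp only: prod_Var[OF fin])
qed

text \<open>The path is bipartite with the odd and the even vertices as its parts. The odd vertices with
  positive exponent and the even vertices with exponent at least \<open>t + 1\<close> form a cover, and an edge
  that lies inside it has exponent sum at least \<open>t + 2\<close>.\<close>

lemma single_in_ideal_prod:
  fixes c :: "'a::field"
  assumes b: "Poly_Mapping.keys b \<subseteq> {1..n}"
    and sum: "\<And>i. i \<in> {1..<n} \<Longrightarrow> Suc t \<le> Poly_Mapping.lookup b i + Poly_Mapping.lookup b (Suc i)"
  shows "Poly_Mapping.single b c \<in> ideal_prod (mpoly_ring n) (edge_ideal n t) (cover_ideal n (path_edges n))"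
proof -
  define C where "C = {i \<in> {1..n}. (if odd i then 1 else Suc t) \<le> Poly_Mapping.lookup b i}"
  have "vertex_cover {1..n} (path_edges n) C"
    unfolding path_vertex_cover_iff
  proof (intro conjI ballI)
    fix i assume "i \<in> {1..<n}"
    then show "i \<in> C \<or> Suc i \<in> C"
      using sum[of i] by (cases "odd i") (auto simp: C_def not_less_eq_eq)
  qed (auto simp: C_def)
  moreover have finC: "finite C" by (simp add: C_def)
  ultimately obtain D where D: "D \<subseteq> C" "minimal_vertex_cover {1..n} (path_edges n) D"
    using minimal_vertex_cover_below by blast
  then have fin: "finite D" using finC finite_subset by blast
  define d where "d = b - indicator_exp D"
  have le: "Poly_Mapping.lookup (indicator_exp D) i \<le> Poly_Mapping.lookup b i" for i
    using D(1) by (auto simp: lookup_indicator_exp[OF fin] C_def split: if_splits)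
  have d: "b = d + indicator_exp D"
    by (rule poly_mapping_eqI) (simp add: d_def lookup_add lookup_minus le)
  have "t \<le> Poly_Mapping.lookup d i + Poly_Mapping.lookup d (Suc i)" if "i \<in> {1..<n}" for i
  proof (cases "i \<in> D \<and> Suc i \<in> D")
    case True
    then have "i \<in> C" "Suc i \<in> C" using D(1) by auto
    then have "Suc t \<le> Poly_Mapping.lookup b i \<or> Suc t \<le> Poly_Mapping.lookup b (Suc i)"
      by (cases "odd i") (auto simp: C_def)
    then show ?thesis using True by (auto simp: d_def lookup_minus lookup_indicator_exp[OF fin])
  next
    case False
    then show ?thesis using sum[OF that] by (auto simp: d_def lookup_minus lookup_indicator_exp[OF fin])
  qed
  moreover have "Poly_Mapping.keys d \<subseteq> {1..n}" using b d by (auto simp: keys_add_nat)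
  ultimately have "Poly_Mapping.single d c \<in> edge_ideal n t"
    by (simp add: edge_ideal_def mpoly_ring_carrier)
  moreover have "mon (indicator_exp D) \<in> (cover_ideal n (path_edges n) :: 'a mpoly set)"
    by (rule cover_ideal_generator[OF D(2)])
  ultimately have "Poly_Mapping.single d c * mon (indicator_exp D) \<in>
      ideal_prod (mpoly_ring n) (edge_ideal n t) (cover_ideal n (path_edges n))"
    using ideal_prod.prod[of _ _ _ _ "mpoly_ring n"] by simp
  then show ?thesis by (simp add: mult_single flip: d)
qed

text \<open>For the inclusion into the product a polynomial is cut into its terms, from each of
  which \<open>single_in_ideal_prod\<close> splits off a generator of the cover ideal.\<close>

lemma edge_ideal_Suc:
  "edge_ideal n (Suc t) =
    (ideal_prod (mpoly_ring n) (edge_ideal n t) (cover_ideal n (path_edges n)) :: 'a::field mpoly set)"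
  (is "_ = ?P")
proof (intro equalityI subsetI)
  fix f assume "f \<in> ?P"
  then show "f \<in> edge_ideal n (Suc t)"
  proof induction
    case (prod i j)
    then show ?case using edge_ideal_mult[of i n t j 1] cover_ideal_subset by auto
  qed (simp add: edge_ideal_add)
next
  fix f :: "'a mpoly" assume f: "f \<in> edge_ideal n (Suc t)"
  \<comment> \<open>\<open>ideal_prod\<close> is generated by products and sums, so 0 enters as a
    product of two zeros; it starts the induction over the terms.\<close>
  have zero: "0 \<in> ?P"
  proof -
    have "0 \<in> I" if "ideal I (mpoly_ring n)" for I :: "'a mpoly set"
      using additive_subgroup.zero_closed[OF ideal.axioms(1)[OF that]] by simp
    then have "0 \<in> (cover_ideal n (path_edges n) :: 'a mpoly set)"
      by (auto simp: cover_ideal_def genideal_def)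
    from ideal_prod.prod[OF edge_ideal_zero[of n t] this, where R = "mpoly_ring n"] show ?thesis by simp
  qed
  have mem: "Poly_Mapping.single b (Poly_Mapping.lookup f b) \<in> ?P" if "b \<in> Poly_Mapping.keys f" for b
    by (rule single_in_ideal_prod) (use f that in \<open>auto simp: edge_ideal_def mpoly_ring_carrier\<close>)
  have "(\<Sum>b\<in>A. Poly_Mapping.single b (Poly_Mapping.lookup f b)) \<in> ?P"
    if "finite A" "A \<subseteq> Poly_Mapping.keys f" for A
    using that
  proof (induction A rule: finite_induct)
    case (insert b A)
    then show ?case using mem[of b] ideal_prod.sum[of _ "mpoly_ring n"] by simp
  qed (simp add: zero)
  from this[of "Poly_Mapping.keys f"] show "f \<in> ?P" by (simp add: sum_singles)
qed

lemma cover_ideal_power: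
  "cover_ideal n (path_edges n) [^]\<^bsub>ideals_set (mpoly_ring n)\<^esub> t = (edge_ideal n t :: 'a::field mpoly set)"
  by (induction t) (simp_all add: nat_pow_def ideals_set_def edge_ideal_0 edge_ideal_Suc)

section \<open>Graded components of fractions\<close>

definition exp_int :: "(nat \<Rightarrow>\<^sub>0 nat) \<Rightarrow> nat \<Rightarrow> int" where
  "exp_int b i = int (Poly_Mapping.lookup b i)"

lemma exp_int_eq_iff: "exp_int b = exp_int d \<longleftrightarrow> b = d"
  by (auto simp: fun_eq_iff exp_int_def poly_mapping_eq_iff)

lemma exp_int_add: "exp_int (b + d) i = exp_int b i + exp_int d i"
  by (simp add: exp_int_def lookup_add)

text \<open>Coefficients are extended by zero to integer vectors, so that the exponent
  \<open>\<alpha> + e\<close> can be looked up in the numerator for every degree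
  \<open>\<alpha>\<close> of a fraction with denominator \<open>mon e\<close>.\<close>

definition coeff_at :: "'a::field mpoly \<Rightarrow> (nat \<Rightarrow> int) \<Rightarrow> 'a" where
  "coeff_at f \<gamma> = (if \<gamma> \<in> range exp_int then Poly_Mapping.lookup f (THE b. exp_int b = \<gamma>) else 0)"

lemma coeff_at_exp_int: "coeff_at f (exp_int b) = Poly_Mapping.lookup f b"
  by (simp add: coeff_at_def exp_int_eq_iff)

lemma coeff_at_outside: "\<gamma> \<notin> range exp_int \<Longrightarrow> coeff_at f \<gamma> = 0"
  by (simp add: coeff_at_def)

lemma coeff_at_add: "coeff_at (f + g) \<gamma> = coeff_at f \<gamma> + coeff_at g \<gamma>"
  by (simp add: coeff_at_def lookup_add)

lemma coeff_at_diff: "coeff_at (f - g) \<gamma> = coeff_at f \<gamma> - coeff_at g \<gamma>"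
  by (simp add: coeff_at_def lookup_minus)

lemma coeff_at_mon_mult: "coeff_at (mon e * f) (\<lambda>i. \<gamma> i + exp_int e i) = coeff_at f \<gamma>"
proof (cases "\<gamma> \<in> range exp_int")
  case True
  then obtain b where "\<gamma> = exp_int b" by blast
  then have "(\<lambda>i. \<gamma> i + exp_int e i) = exp_int (e + b)" by (auto simp: exp_int_add)
  then show ?thesis by (simp add: \<open>\<gamma> = _\<close> coeff_at_exp_int lookup_single_mult)
next
  case False
  show ?thesis
  proof (cases "(\<lambda>i. \<gamma> i + exp_int e i) \<in> range exp_int")
    case True
    then obtain b where b: "(\<lambda>i. \<gamma> i + exp_int e i) = exp_int b" by blast
    have "b \<noteq> e + d" for d
    proof
      assume "b = e + d"
      then have "\<gamma> i = exp_int d i" for i using fun_cong[OF b, of i] by (simp add: exp_int_add)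
      then show False using False by blast
    qed
    then show ?thesis using False by (simp add: b coeff_at_exp_int lookup_single_mult_eq_0 coeff_at_outside)
  qed (use False in \<open>simp add: coeff_at_outside\<close>)
qed

text \<open>\<open>degree_complex\<close> reads only the degrees at \<open>{1..n}\<close>. A vector
  that is nonzero elsewhere is no degree of a fraction in these variables; it gets the empty family,
  which is exact in every level.\<close>

definition degree_family :: "nat \<Rightarrow> nat \<Rightarrow> (nat \<Rightarrow> int) \<Rightarrow> nat set set" where
  "degree_family n t \<alpha> = (if \<forall>i. i \<notin> {1..n} \<longrightarrow> \<alpha> i = 0 then degree_complex t n \<alpha> else {})"

text \<open>The components of the fraction \<open>f / x\<^sup>e\<close> in the localization of \<open>R/I\<close> at the variables in
  \<open>\<sigma>\<close>: this localization has the monomials \<open>x\<^sup>\<alpha>\<close> with \<open>\<sigma> \<in> degree_family n t \<alpha>\<close> as a basis.\<close>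

definition components :: "nat \<Rightarrow> nat \<Rightarrow> nat set \<Rightarrow> 'a::field mpoly \<Rightarrow> (nat \<Rightarrow>\<^sub>0 nat) \<Rightarrow> (nat \<Rightarrow> int) \<Rightarrow> 'a" where
  "components n t \<sigma> f e \<alpha> = (if \<sigma> \<in> degree_family n t \<alpha> then coeff_at f (\<lambda>i. \<alpha> i + exp_int e i) else 0)"

definition graded_pieces :: "nat \<Rightarrow> nat \<Rightarrow> nat set \<Rightarrow> ((nat \<Rightarrow> int) \<Rightarrow> 'a::field) set" where
  "graded_pieces n t \<sigma> = {\<phi>. finite {\<alpha>. \<phi> \<alpha> \<noteq> 0} \<and> (\<forall>\<alpha>. \<phi> \<alpha> \<noteq> 0 \<longrightarrow> \<sigma> \<in> degree_family n t \<alpha>)}"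

lemma components_add: "components n t \<sigma> (f + g) e \<alpha> = components n t \<sigma> f e \<alpha> + components n t \<sigma> g e \<alpha>"
  by (simp add: components_def coeff_at_add)

lemma components_diff: "components n t \<sigma> (f - g) e \<alpha> = components n t \<sigma> f e \<alpha> - components n t \<sigma> g e \<alpha>"
  by (simp add: components_def coeff_at_diff)

lemma components_mon_mult: "components n t \<sigma> (mon d * f) (d + e) = components n t \<sigma> f e"
proof
  fix \<alpha>
  have "(\<lambda>i. \<alpha> i + exp_int (d + e) i) = (\<lambda>i. (\<alpha> i + exp_int e i) + exp_int d i)"
    by (simp add: exp_int_add ac_simps)
  then show "components n t \<sigma> (mon d * f) (d + e) \<alpha> = components n t \<sigma> f e \<alpha>"
    by (simp add: components_def coeff_at_mon_mult)
qed

lemma exp_int_outside: "Poly_Mapping.keys e \<subseteq> \<sigma> \<Longrightarrow> i \<notin> \<sigma> \<Longrightarrow> exp_int e i = 0"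
  by (auto simp: exp_int_def in_keys_iff)

text \<open>At a missed edge the denominator has exponent 0, so \<open>\<alpha>\<close> agrees there
  with the exponents of a term of \<open>f\<close>, whose sum on this edge would be both less than
  \<open>t\<close> and at least \<open>t\<close>.\<close>

lemma components_edge_ideal:
  assumes f: "f \<in> edge_ideal n t" and e: "Poly_Mapping.keys e \<subseteq> \<sigma>"
  shows "components n t \<sigma> f e \<alpha> = 0"
proof (rule ccontr)
  assume "components n t \<sigma> f e \<alpha> \<noteq> 0"
  then have mem: "\<sigma> \<in> degree_family n t \<alpha>" and coeff: "coeff_at f (\<lambda>i. \<alpha> i + exp_int e i) \<noteq> 0"
    by (auto simp: components_def split: if_splits)
  then obtain b where b: "(\<lambda>i. \<alpha> i + exp_int e i) = exp_int b" using coeff_at_outside by blast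
  then have "b \<in> Poly_Mapping.keys f" using coeff by (simp add: coeff_at_exp_int in_keys_iff)
  moreover obtain i where i: "i \<in> {1..<n}" "\<alpha> i + \<alpha> (Suc i) < int t" "i \<notin> \<sigma>" "Suc i \<notin> \<sigma>"
    using mem by (auto simp: degree_family_def degree_complex_def split: if_splits)
  ultimately have "t \<le> Poly_Mapping.lookup b i + Poly_Mapping.lookup b (Suc i)"
    using f by (auto simp: edge_ideal_def)
  moreover have "\<alpha> i = int (Poly_Mapping.lookup b i)" "\<alpha> (Suc i) = int (Poly_Mapping.lookup b (Suc i))"
    using fun_cong[OF b, of i] fun_cong[OF b, of "Suc i"] exp_int_outside[OF e] i(3,4)
    by (auto simp: exp_int_def[of b])
  ultimately show False using i(2) by linarith
qed

text \<open>Multiplying by the \<open>t\<close>-th power of every variable in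
  \<open>\<sigma>\<close> settles all edges that meet \<open>\<sigma>\<close>. A term
  \<open>b\<close> that still violates an edge would have \<open>b - e\<close> as a degree in the
  family, so its coefficient is a component and vanishes.\<close>

lemma edge_ideal_if_components_0:
  fixes f :: "'a::field mpoly"
  assumes f: "f \<in> carrier (mpoly_ring n)" and e: "Poly_Mapping.keys e \<subseteq> \<sigma>" and \<sigma>: "\<sigma> \<subseteq> {1..n}"
    and zero: "\<And>\<alpha>. components n t \<sigma> f e \<alpha> = 0"
  shows "\<exists>w. Poly_Mapping.keys w \<subseteq> \<sigma> \<and> mon w * f \<in> edge_ideal n t"
proof -
  have fin: "finite \<sigma>" using \<sigma> by (rule finite_subset) simp
  define w where "w = (\<Sum>i\<in>\<sigma>. Poly_Mapping.single i t)"
  have lookup_w: "Poly_Mapping.lookup w i = (if i \<in> \<sigma> then t else 0)" for i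
    using fin by (simp add: w_def lookup_sum lookup_single when_def)
  have w: "Poly_Mapping.keys w \<subseteq> \<sigma>" by (auto simp: in_keys_iff lookup_w split: if_splits)
  have "t \<le> Poly_Mapping.lookup (w + b) i + Poly_Mapping.lookup (w + b) (Suc i)"
    if b: "b \<in> Poly_Mapping.keys f" and i: "i \<in> {1..<n}" for b i
  proof (rule ccontr)
    assume less: "\<not> t \<le> Poly_Mapping.lookup (w + b) i + Poly_Mapping.lookup (w + b) (Suc i)"
    then have i': "i \<notin> \<sigma>" "Suc i \<notin> \<sigma>" by (auto simp: lookup_add lookup_w split: if_splits)
    define \<alpha> where "\<alpha> j = exp_int b j - exp_int e j" for j
    have "Poly_Mapping.keys b \<subseteq> {1..n}" "Poly_Mapping.keys e \<subseteq> {1..n}"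
      using f b e \<sigma> by (auto simp: mpoly_ring_carrier)
    then have "\<forall>j. j \<notin> {1..n} \<longrightarrow> \<alpha> j = 0"
      using exp_int_outside by (simp add: \<alpha>_def)
    moreover have "\<alpha> i + \<alpha> (Suc i) < int t"
      using less i' exp_int_outside[OF e] by (simp add: \<alpha>_def exp_int_def[of b] lookup_add)
    moreover have "j \<in> \<sigma>" if "\<alpha> j < 0" for j
      using that exp_int_outside[OF e, of j] by (auto simp: \<alpha>_def exp_int_def[of b])
    ultimately have "\<sigma> \<in> degree_family n t \<alpha>"
      using \<sigma> i i' by (auto simp: degree_family_def degree_complex_def)
    then have "Poly_Mapping.lookup f b = 0"
      using zero[of \<alpha>] by (simp add: components_def \<alpha>_def coeff_at_exp_int)
    then show False using b by (simp add: in_keys_iff)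
  qed
  moreover have "mon w * f \<in> carrier (mpoly_ring n)"
    by (rule mpoly_ring_closed[OF _ f]) (use w \<sigma> in \<open>auto simp: mon_in_carrier\<close>)
  ultimately have "mon w * f \<in> edge_ideal n t"
    unfolding edge_ideal_def by (auto elim!: keys_mon_mult)
  then show ?thesis using w by blast
qed

text \<open>The left side is equality of \<open>f / mon d\<close> and \<open>g / mon e\<close> in
  the localization; both directions pass to the numerator \<open>h\<close> of the difference over
  the common denominator.\<close>

lemma components_eq_iff:
  fixes f g :: "'a::field mpoly"
  assumes f: "f \<in> carrier (mpoly_ring n)" and g: "g \<in> carrier (mpoly_ring n)" and \<sigma>: "\<sigma> \<subseteq> {1..n}"
    and d: "Poly_Mapping.keys d \<subseteq> \<sigma>" and e: "Poly_Mapping.keys e \<subseteq> \<sigma>"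
  shows "(\<exists>w. Poly_Mapping.keys w \<subseteq> \<sigma> \<and> mon w * (mon e * f) - mon w * (mon d * g) \<in> edge_ideal n t) \<longleftrightarrow>
    components n t \<sigma> f d = components n t \<sigma> g e"
proof -
  define h where "h = mon e * f - mon d * g"
  have h: "h \<in> carrier (mpoly_ring n)"
    unfolding h_def by (intro mpoly_ring_closed f g) (use d e \<sigma> in \<open>auto simp: mon_in_carrier\<close>)
  have comp: "components n t \<sigma> h (e + d) \<alpha> = components n t \<sigma> f d \<alpha> - components n t \<sigma> g e \<alpha>" for \<alpha>
    using components_mon_mult[of n t \<sigma> e f d] components_mon_mult[of n t \<sigma> d g e]
    by (simp add: h_def components_diff add.commute)
  have eq: "mon w * (mon e * f) - mon w * (mon d * g) = mon w * h" for w
    by (simp add: h_def right_diff_distrib)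
  have ed: "Poly_Mapping.keys (e + d) \<subseteq> \<sigma>" using d e by (simp add: keys_add_nat)
  show ?thesis
  proof
    assume "\<exists>w. Poly_Mapping.keys w \<subseteq> \<sigma> \<and> mon w * (mon e * f) - mon w * (mon d * g) \<in> edge_ideal n t"
    then obtain w where w: "Poly_Mapping.keys w \<subseteq> \<sigma>" "mon w * h \<in> edge_ideal n t"
      unfolding eq by blast
    have "components n t \<sigma> (mon w * h) (w + (e + d)) \<alpha> = 0" for \<alpha>
      by (rule components_edge_ideal[OF w(2)]) (use w ed in \<open>simp add: keys_add_nat\<close>)
    then show "components n t \<sigma> f d = components n t \<sigma> g e"
      by (intro ext) (simp add: components_mon_mult comp)
  next
    assume "components n t \<sigma> f d = components n t \<sigma> g e"
    then have "\<exists>w. Poly_Mapping.keys w \<subseteq> \<sigma> \<and> mon w * h \<in> edge_ideal n t"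
      by (intro edge_ideal_if_components_0[OF h ed \<sigma>]) (simp add: comp)
    then show "\<exists>w. Poly_Mapping.keys w \<subseteq> \<sigma> \<and> mon w * (mon e * f) - mon w * (mon d * g) \<in> edge_ideal n t"
      unfolding eq .
  qed
qed

lemma components_in_graded_pieces: "components n t \<sigma> f e \<in> graded_pieces n t \<sigma>"
proof -
  have "{\<alpha>. components n t \<sigma> f e \<alpha> \<noteq> 0} \<subseteq> (\<lambda>b i. exp_int b i - exp_int e i) ` Poly_Mapping.keys f"
  proof
    fix \<alpha> assume "\<alpha> \<in> {\<alpha>. components n t \<sigma> f e \<alpha> \<noteq> 0}"
    then have coeff: "coeff_at f (\<lambda>i. \<alpha> i + exp_int e i) \<noteq> 0" by (auto simp: components_def split: if_splits)
    then obtain b where b: "(\<lambda>i. \<alpha> i + exp_int e i) = exp_int b" using coeff_at_outside by blast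
    then have "b \<in> Poly_Mapping.keys f" using coeff by (simp add: coeff_at_exp_int in_keys_iff)
    moreover have "\<alpha> = (\<lambda>i. exp_int b i - exp_int e i)" by (simp flip: b)
    ultimately show "\<alpha> \<in> (\<lambda>b i. exp_int b i - exp_int e i) ` Poly_Mapping.keys f" by blast
  qed
  then have "finite {\<alpha>. components n t \<sigma> f e \<alpha> \<noteq> 0}" by (rule finite_subset) simp
  then show ?thesis by (auto simp: graded_pieces_def components_def split: if_splits)
qed

lemma graded_pieces_components:
  assumes \<phi>: "\<phi> \<in> (graded_pieces n t \<sigma> :: ((nat \<Rightarrow> int) \<Rightarrow> 'a::field) set)" and \<sigma>: "\<sigma> \<subseteq> {1..n}"
  obtains f e where "f \<in> carrier (mpoly_ring n)" "Poly_Mapping.keys e \<subseteq> \<sigma>" "components n t \<sigma> f e = \<phi>"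
proof -
  have fin\<sigma>: "finite \<sigma>" using \<sigma> by (rule finite_subset) simp
  have mem: "\<sigma> \<in> degree_family n t \<alpha>" if "\<phi> \<alpha> \<noteq> 0" for \<alpha>
    using \<phi> that by (simp add: graded_pieces_def)
  have fin: "finite {\<alpha>. \<phi> \<alpha> \<noteq> 0}" using \<phi> by (simp add: graded_pieces_def)
  \<comment> \<open>\<open>N\<close> bounds the absolute values of the entries at
    \<open>\<sigma>\<close> of all degrees that occur, so \<open>mon e\<close> clears their negative
    exponents; outside \<open>\<sigma>\<close> the degrees are nonnegative by membership in the
    family.\<close>
  define N where "N = (\<Sum>\<alpha>\<in>{\<alpha>. \<phi> \<alpha> \<noteq> 0}. \<Sum>i\<in>\<sigma>. nat \<bar>\<alpha> i\<bar>)"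
  define e where "e = (\<Sum>i\<in>\<sigma>. Poly_Mapping.single i N)"
  have lookup_e: "Poly_Mapping.lookup e i = (if i \<in> \<sigma> then N else 0)" for i
    using fin\<sigma> by (simp add: e_def lookup_sum lookup_single when_def)
  have e: "Poly_Mapping.keys e \<subseteq> \<sigma>" by (auto simp: in_keys_iff lookup_e split: if_splits)
  define c where "c b = \<phi> (\<lambda>i. exp_int b i - exp_int e i)" for b
  have inj: "inj (\<lambda>b i. exp_int b i - exp_int e i)"
    by (rule injI) (simp add: fun_eq_iff exp_int_def poly_mapping_eq_iff)
  have "finite ((\<lambda>b i. exp_int b i - exp_int e i) -` {\<alpha>. \<phi> \<alpha> \<noteq> 0})"
    by (rule finite_vimageI[OF fin inj])
  then have "finite {b. c b \<noteq> 0}" by (simp add: c_def vimage_def)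
  define f where "f = Abs_poly_mapping c"
  have lookup_f: "Poly_Mapping.lookup f b = c b" for b
    unfolding f_def using \<open>finite {b. c b \<noteq> 0}\<close> by simp
  have in_range: "\<exists>b. exp_int b = (\<lambda>i. \<alpha> i + exp_int e i)" if \<alpha>: "\<phi> \<alpha> \<noteq> 0" for \<alpha>
  proof -
    have fam: "\<forall>i. i \<notin> {1..n} \<longrightarrow> \<alpha> i = 0" "\<forall>i\<in>{1..n}. \<alpha> i < 0 \<longrightarrow> i \<in> \<sigma>"
      using mem[OF \<alpha>] by (auto simp: degree_family_def degree_complex_def split: if_splits)
    have ge: "0 \<le> \<alpha> i + exp_int e i" for i
    proof (cases "i \<in> \<sigma>")
      case True
      have "nat \<bar>\<alpha> i\<bar> \<le> (\<Sum>i\<in>\<sigma>. nat \<bar>\<alpha> i\<bar>)" using fin\<sigma> True by (intro member_le_sum) auto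
      also have "\<dots> \<le> N" unfolding N_def using fin \<alpha>
        by (intro member_le_sum[where f = "\<lambda>\<alpha>. \<Sum>i\<in>\<sigma>. nat \<bar>\<alpha> i\<bar>"]) auto
      finally show ?thesis using True by (simp add: exp_int_def lookup_e)
    next
      case False
      then show ?thesis using fam by (cases "i \<in> {1..n}") (auto simp: exp_int_def lookup_e not_less)
    qed
    have "{i. nat (\<alpha> i + exp_int e i) \<noteq> 0} \<subseteq> {1..n}"
      using fam(1) e \<sigma> exp_int_outside[of e "{1..n}"] by fastforce
    then have "finite {i. nat (\<alpha> i + exp_int e i) \<noteq> 0}" by (rule finite_subset) simp
    then have "exp_int (Abs_poly_mapping (\<lambda>i. nat (\<alpha> i + exp_int e i))) = (\<lambda>i. \<alpha> i + exp_int e i)"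
      using ge by (auto simp: exp_int_def[abs_def])
    then show ?thesis by blast
  qed
  have "components n t \<sigma> f e = \<phi>"
  proof
    fix \<alpha>
    show "components n t \<sigma> f e \<alpha> = \<phi> \<alpha>"
    proof (cases "(\<lambda>i. \<alpha> i + exp_int e i) \<in> range exp_int")
      case True
      then obtain b where b: "(\<lambda>i. \<alpha> i + exp_int e i) = exp_int b" by blast
      have "coeff_at f (\<lambda>i. \<alpha> i + exp_int e i) = \<phi> \<alpha>"
        unfolding b coeff_at_exp_int lookup_f c_def by (simp flip: b)
      then show ?thesis using mem[of \<alpha>] by (auto simp: components_def)
    next
      case False
      then have "\<phi> \<alpha> = 0" using in_range[of \<alpha>] by (metis rangeI)
      then show ?thesis using False by (simp add: components_def coeff_at_outside)
    qed
  qed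
  moreover have "f \<in> carrier (mpoly_ring n)"
    unfolding mpoly_ring_carrier
  proof (intro ballI subsetI)
    fix b i assume "b \<in> Poly_Mapping.keys f" and i: "i \<in> Poly_Mapping.keys b"
    then have "c b \<noteq> 0" by (simp add: in_keys_iff lookup_f)
    then have "\<sigma> \<in> degree_family n t (\<lambda>i. exp_int b i - exp_int e i)" using mem by (simp add: c_def)
    then have "\<forall>i. i \<notin> {1..n} \<longrightarrow> exp_int b i - exp_int e i = 0"
      by (simp add: degree_family_def split: if_splits)
    then have "exp_int b i = 0" if "i \<notin> {1..n}"
      using that exp_int_outside[of e "{1..n}" i] e \<sigma> by auto
    then show "i \<in> {1..n}" using i by (auto simp: exp_int_def in_keys_iff)
  qed
  ultimately show ?thesis using that e by blast
qed

lemma graded_pieces_zero: "(\<lambda>_. 0) \<in> graded_pieces n t \<sigma>"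
  by (simp add: graded_pieces_def)

lemma graded_pieces_add:
  assumes "\<phi> \<in> graded_pieces n t \<sigma>" "\<psi> \<in> graded_pieces n t \<sigma>"
  shows "(\<lambda>\<alpha>. \<phi> \<alpha> + \<psi> \<alpha>) \<in> graded_pieces n t \<sigma>"
proof -
  have "{\<alpha>. \<phi> \<alpha> + \<psi> \<alpha> \<noteq> 0} \<subseteq> {\<alpha>. \<phi> \<alpha> \<noteq> 0} \<union> {\<alpha>. \<psi> \<alpha> \<noteq> 0}" by auto
  then have "finite {\<alpha>. \<phi> \<alpha> + \<psi> \<alpha> \<noteq> 0}"
    by (rule finite_subset) (use assms in \<open>simp add: graded_pieces_def\<close>)
  moreover have "\<phi> \<alpha> + \<psi> \<alpha> \<noteq> 0 \<Longrightarrow> \<phi> \<alpha> \<noteq> 0 \<or> \<psi> \<alpha> \<noteq> 0" for \<alpha> by auto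
  ultimately show ?thesis using assms unfolding graded_pieces_def by blast
qed

lemma graded_pieces_uminus: "\<phi> \<in> graded_pieces n t \<sigma> \<Longrightarrow> (\<lambda>\<alpha>. - \<phi> \<alpha>) \<in> graded_pieces n t \<sigma>"
  by (simp add: graded_pieces_def)

section \<open>Localizations of the quotient module\<close>

abbreviation edge_coset :: "nat \<Rightarrow> nat \<Rightarrow> 'a::field mpoly \<Rightarrow> 'a mpoly set" where
  "edge_coset n t f \<equiv> edge_ideal n t +>\<^bsub>mpoly_ring n\<^esub> f"

abbreviation edge_module :: "nat \<Rightarrow> nat \<Rightarrow> ('a::field mpoly, 'a mpoly set) module" where
  "edge_module n t \<equiv> quotient_module (mpoly_ring n) (edge_ideal n t)"

section \<open>Cosets, denominators and classes of fractions\<close>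

lemma ring_mpoly_ring: "ring (mpoly_ring n :: 'a::field mpoly ring)"
  by (rule cring.axioms(1)[OF cring_mpoly_ring])

lemma edge_coset_eq_iff:
  assumes "f \<in> carrier (mpoly_ring n)" "g \<in> carrier (mpoly_ring n)"
  shows "edge_coset n t f = edge_coset n t g \<longleftrightarrow> f - g \<in> edge_ideal n t"
  using ring.quotient_eq_iff_same_a_r_cos[OF ring_mpoly_ring ideal_edge_ideal assms, of t]
  by (simp add: a_minus_def a_inv_mpoly_ring[OF assms(2)])

lemma carrier_edge_module:
  "carrier (edge_module n t) = edge_coset n t ` carrier (mpoly_ring n)"
  by (auto simp: quotient_module_def FactRing_def A_RCOSETS_def')

lemma zero_edge_module: "\<zero>\<^bsub>edge_module n t\<^esub> = edge_coset n t 0"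
  by (simp add: quotient_module_def FactRing_def
      ring.a_rcos_zero[OF ring_mpoly_ring ideal_edge_ideal edge_ideal_zero])

lemma smult_edge_module:
  assumes "r \<in> carrier (mpoly_ring n)" "f \<in> carrier (mpoly_ring n)"
  shows "r \<odot>\<^bsub>edge_module n t\<^esub> edge_coset n t f = edge_coset n t (r * f)"
  using ideal.rcoset_mult_add[OF ideal_edge_ideal assms, of t]
  by (simp add: quotient_module_def FactRing_def)

lemma add_edge_module:
  assumes "f \<in> carrier (mpoly_ring n)" "g \<in> carrier (mpoly_ring n)"
  shows "edge_coset n t f \<oplus>\<^bsub>edge_module n t\<^esub> edge_coset n t g = edge_coset n t (f + g)"
  using ideal.a_rcos_sum[OF ideal_edge_ideal assms, of t]
  by (simp add: quotient_module_def FactRing_def)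

lemma Var_pow: "Var i [^]\<^bsub>mpoly_ring n\<^esub> (k::nat) = (mon (Poly_Mapping.single i k) :: 'a::field mpoly)"
  by (induction k) (simp_all add: nat_pow_def Var_def mult_single flip: single_add)

lemma denominators_Var:
  assumes \<sigma>: "\<sigma> \<subseteq> {1..n}"
  shows "denominators (mpoly_ring n) Var \<sigma> = (mon ` {e. Poly_Mapping.keys e \<subseteq> \<sigma>} :: 'a::field mpoly set)"
proof -
  interpret cring "mpoly_ring n :: 'a mpoly ring" by (rule cring_mpoly_ring)
  have fin: "finite \<sigma>" using \<sigma> by (rule finite_subset) simp
  have carr: "(mon (Poly_Mapping.single i k) :: 'a mpoly) \<in> carrier (mpoly_ring n)" if "i \<in> {1..n}" for i k
    using that by (simp add: mon_in_carrier)
  have prod: "(\<Otimes>\<^bsub>mpoly_ring n\<^esub>i\<in>\<sigma>. Var i [^]\<^bsub>mpoly_ring n\<^esub> a i) =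
      (mon (\<Sum>i\<in>\<sigma>. Poly_Mapping.single i (a i)) :: 'a mpoly)"
    for a :: "nat \<Rightarrow> nat"
    using fin \<sigma>
  proof (induction \<sigma> rule: finite_induct)
    case (insert i \<sigma>)
    then show ?case
      by (subst finprod_insert) (auto simp: Var_pow carr mult_single)
  qed simp
  have keys: "Poly_Mapping.keys (\<Sum>i\<in>\<sigma>. Poly_Mapping.single i (a i)) \<subseteq> \<sigma>" for a :: "nat \<Rightarrow> nat"
    using fin by (auto simp: in_keys_iff lookup_sum lookup_single when_def split: if_splits)
  have exp: "e = (\<Sum>i\<in>\<sigma>. Poly_Mapping.single i (Poly_Mapping.lookup e i))" if "Poly_Mapping.keys e \<subseteq> \<sigma>" for e :: "nat \<Rightarrow>\<^sub>0 nat"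
    using fin that by (intro poly_mapping_eqI) (auto simp: lookup_sum lookup_single when_def in_keys_iff)
  show ?thesis
    unfolding denominators_def prod
  proof (intro equalityI subsetI)
    fix x :: "'a mpoly" assume "x \<in> mon ` {e. Poly_Mapping.keys e \<subseteq> \<sigma>}"
    then obtain e where e: "x = mon e" "Poly_Mapping.keys e \<subseteq> \<sigma>" by blast
    have "x = mon (\<Sum>i\<in>\<sigma>. Poly_Mapping.single i (Poly_Mapping.lookup e i))"
      unfolding e(1) exp[OF e(2), symmetric] by (rule refl)
    then show "x \<in> {mon (\<Sum>i\<in>\<sigma>. Poly_Mapping.single i (a i)) | a :: nat \<Rightarrow> nat. True}" by blast
  qed (use keys in blast)
qed

text \<open>All representatives of the fraction with components \<open>\<phi>\<close>. By
  \<open>fraction_edge_module\<close> this is an equivalence class, so \<open>\<phi>\<close> serves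
  as a coordinate on the localization.\<close>

definition fraction_class :: "nat \<Rightarrow> nat \<Rightarrow> nat set \<Rightarrow> ((nat \<Rightarrow> int) \<Rightarrow> 'a::field) \<Rightarrow> ('a mpoly set \<times> 'a mpoly) set" where
  "fraction_class n t \<sigma> \<phi> = {(edge_coset n t f, mon e) | f e.
     f \<in> carrier (mpoly_ring n) \<and> Poly_Mapping.keys e \<subseteq> \<sigma> \<and> components n t \<sigma> f e = \<phi>}"

lemma mon_eq_iff: "(mon e :: 'a::field mpoly) = mon d \<longleftrightarrow> e = d"
  by (metis keys_single singleton_inject zero_neq_one)

lemma components_coset:
  assumes "f \<in> carrier (mpoly_ring n)" "g \<in> carrier (mpoly_ring n)" "Poly_Mapping.keys e \<subseteq> \<sigma>"
    and "edge_coset n t f = edge_coset n t g"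
  shows "components n t \<sigma> f e = components n t \<sigma> g e"
proof
  fix \<alpha>
  have "f - g \<in> edge_ideal n t" using assms by (simp add: edge_coset_eq_iff)
  then have "components n t \<sigma> (f - g) e \<alpha> = 0" using assms(3) by (rule components_edge_ideal)
  then show "components n t \<sigma> f e \<alpha> = components n t \<sigma> g e \<alpha>" by (simp add: components_diff)
qed

lemma mem_fraction_class:
  fixes f :: "'a::field mpoly"
  assumes "f \<in> carrier (mpoly_ring n)" "Poly_Mapping.keys e \<subseteq> \<sigma>"
  shows "(edge_coset n t f, mon e) \<in> fraction_class n t \<sigma> \<phi> \<longleftrightarrow> components n t \<sigma> f e = \<phi>"
proof
  assume "(edge_coset n t f, mon e) \<in> fraction_class n t \<sigma> \<phi>"
  then obtain g d where "edge_coset n t f = edge_coset n t g" "(mon e :: 'a mpoly) = mon d"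
    "g \<in> carrier (mpoly_ring n)" "components n t \<sigma> g d = \<phi>"
    unfolding fraction_class_def by blast
  then show "components n t \<sigma> f e = \<phi>"
    using components_coset[OF assms(1) _ assms(2), of g t] by (simp add: mon_eq_iff)
next
  assume "components n t \<sigma> f e = \<phi>"
  then show "(edge_coset n t f, mon e) \<in> fraction_class n t \<sigma> \<phi>"
    using assms unfolding fraction_class_def by blast
qed

lemma fraction_edge_module:
  fixes f :: "'a::field mpoly"
  assumes f: "f \<in> carrier (mpoly_ring n)" and e: "Poly_Mapping.keys e \<subseteq> \<sigma>" and \<sigma>: "\<sigma> \<subseteq> {1..n}"
  shows "fraction (denominators (mpoly_ring n) Var \<sigma>) (edge_module n t) (edge_coset n t f) (mon e) =
    fraction_class n t \<sigma> (components n t \<sigma> f e)"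
proof -
  have carr: "(mon d :: 'a mpoly) \<in> carrier (mpoly_ring n)" if "Poly_Mapping.keys d \<subseteq> \<sigma>" for d
    using that \<sigma> by (auto simp: mon_in_carrier)
  have rel: "((edge_coset n t f, mon e), (edge_coset n t g, mon d)) \<in>
      frac_rel (denominators (mpoly_ring n) Var \<sigma>) (edge_module n t) \<longleftrightarrow> components n t \<sigma> g d = components n t \<sigma> f e"
    if g: "g \<in> carrier (mpoly_ring n)" and d: "Poly_Mapping.keys d \<subseteq> \<sigma>" for g :: "'a mpoly" and d
  proof -
    have "((edge_coset n t f, mon e), (edge_coset n t g, mon d)) \<in>
      frac_rel (denominators (mpoly_ring n) Var \<sigma>) (edge_module n t) \<longleftrightarrow>
      (\<exists>w. Poly_Mapping.keys w \<subseteq> \<sigma> \<and> mon w \<odot>\<^bsub>edge_module n t\<^esub> (mon d \<odot>\<^bsub>edge_module n t\<^esub> edge_coset n t f) =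
         mon w \<odot>\<^bsub>edge_module n t\<^esub> (mon e \<odot>\<^bsub>edge_module n t\<^esub> edge_coset n t g))"
      using f g e d by (auto simp: frac_rel_def denominators_Var[OF \<sigma>] carrier_edge_module)
    also have "\<dots> \<longleftrightarrow> (\<exists>w. Poly_Mapping.keys w \<subseteq> \<sigma> \<and> mon w * (mon d * f) - mon w * (mon e * g) \<in> edge_ideal n t)"
      using f g e d carr by (intro ex_cong1 conj_cong refl) (simp add: smult_edge_module mpoly_ring_closed edge_coset_eq_iff)
    also have "\<dots> \<longleftrightarrow> components n t \<sigma> f e = components n t \<sigma> g d"
      by (rule components_eq_iff[OF f g \<sigma> e d])
    finally show ?thesis by auto
  qed
  have mem: "v \<in> edge_coset n t ` carrier (mpoly_ring n) \<and> s \<in> mon ` {e. Poly_Mapping.keys e \<subseteq> \<sigma>}"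
    if "((edge_coset n t f, mon e), (v, s)) \<in> frac_rel (denominators (mpoly_ring n) Var \<sigma>) (edge_module n t)" for v s
    using that by (auto simp: frac_rel_def denominators_Var[OF \<sigma>] carrier_edge_module)
  show ?thesis
  proof (intro equalityI subsetI)
    fix x assume "x \<in> fraction (denominators (mpoly_ring n) Var \<sigma>) (edge_module n t) (edge_coset n t f) (mon e)"
    then have x: "((edge_coset n t f, mon e), x) \<in> frac_rel (denominators (mpoly_ring n) Var \<sigma>) (edge_module n t)"
      by (simp add: fraction_def)
    then obtain g d where "x = (edge_coset n t g, mon d)" "g \<in> carrier (mpoly_ring n)" "Poly_Mapping.keys d \<subseteq> \<sigma>"
      using mem[of "fst x" "snd x"] by (cases x) auto
    then show "x \<in> fraction_class n t \<sigma> (components n t \<sigma> f e)"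
      using x rel by (simp add: mem_fraction_class)
  next
    fix x assume "x \<in> fraction_class n t \<sigma> (components n t \<sigma> f e)"
    then show "x \<in> fraction (denominators (mpoly_ring n) Var \<sigma>) (edge_module n t) (edge_coset n t f) (mon e)"
    proof -
      obtain g d where "x = (edge_coset n t g, mon d)" "g \<in> carrier (mpoly_ring n)" "Poly_Mapping.keys d \<subseteq> \<sigma>"
        "components n t \<sigma> g d = components n t \<sigma> f e"
        using \<open>x \<in> _\<close> unfolding fraction_class_def by blast
      then show ?thesis unfolding fraction_def using rel by simp
    qed
  qed
qed

lemma fraction_class_cases:
  assumes "(u, s) \<in> fraction_class n t \<sigma> \<phi>"
  obtains f e where "u = edge_coset n t f" "s = mon e" "f \<in> carrier (mpoly_ring n)"
    "Poly_Mapping.keys e \<subseteq> \<sigma>" "components n t \<sigma> f e = \<phi>"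
  using assms by (auto simp: fraction_class_def)

lemma fraction_class_nonempty:
  assumes "\<phi> \<in> graded_pieces n t \<sigma>" "\<sigma> \<subseteq> {1..n}"
  shows "fraction_class n t \<sigma> \<phi> \<noteq> {}"
proof -
  obtain f e where "f \<in> carrier (mpoly_ring n)" "Poly_Mapping.keys e \<subseteq> \<sigma>" "components n t \<sigma> f e = \<phi>"
    using graded_pieces_components[OF assms] by blast
  then have "(edge_coset n t f, mon e) \<in> fraction_class n t \<sigma> \<phi>" by (simp add: mem_fraction_class)
  then show ?thesis by blast
qed

lemma fraction_class_inj:
  assumes "\<phi> \<in> graded_pieces n t \<sigma>" "\<sigma> \<subseteq> {1..n}" "fraction_class n t \<sigma> \<phi> = fraction_class n t \<sigma> \<psi>"
  shows "\<phi> = \<psi>"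
proof -
  obtain f e where fe: "f \<in> carrier (mpoly_ring n)" "Poly_Mapping.keys e \<subseteq> \<sigma>" "components n t \<sigma> f e = \<phi>"
    using graded_pieces_components[OF assms(1,2)] by blast
  then show ?thesis using mem_fraction_class[OF fe(1,2)] assms(3) by metis
qed

section \<open>Cech summands in coordinates\<close>

abbreviation cech_piece :: "nat \<Rightarrow> nat \<Rightarrow> nat set \<Rightarrow> ('a::field mpoly, ('a mpoly set \<times> 'a mpoly) set) module" where
  "cech_piece n t \<sigma> \<equiv> cech_summand (mpoly_ring n) Var (edge_module n t) \<sigma>"

lemma carrier_cech_piece:
  assumes \<sigma>: "\<sigma> \<subseteq> {1..n}"
  shows "carrier (cech_piece n t \<sigma>) = fraction_class n t \<sigma> ` (graded_pieces n t \<sigma> :: ((nat \<Rightarrow> int) \<Rightarrow> 'a::field) set)"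
proof -
  let ?S = "denominators (mpoly_ring n) Var \<sigma> :: 'a mpoly set"
  have "carrier (cech_piece n t \<sigma>) = {fraction ?S (edge_module n t) u s | u s. u \<in> carrier (edge_module n t) \<and> s \<in> ?S}"
    by (auto simp: cech_summand_def localization_def quotient_def fraction_def)
  also have "\<dots> = {fraction ?S (edge_module n t) (edge_coset n t f) (mon e) | f e.
      f \<in> carrier (mpoly_ring n) \<and> Poly_Mapping.keys e \<subseteq> \<sigma>}"
    unfolding carrier_edge_module denominators_Var[OF \<sigma>] by blast
  also have "\<dots> = {fraction_class n t \<sigma> (components n t \<sigma> f e) | f e.
      f \<in> carrier (mpoly_ring n) \<and> Poly_Mapping.keys e \<subseteq> \<sigma>}"
    by (intro Collect_cong ex_cong1) (auto simp: fraction_edge_module[OF _ _ \<sigma>])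
  also have "\<dots> = fraction_class n t \<sigma> ` graded_pieces n t \<sigma>"
  proof (intro equalityI subsetI)
    fix X assume "X \<in> fraction_class n t \<sigma> ` (graded_pieces n t \<sigma> :: ((nat \<Rightarrow> int) \<Rightarrow> 'a) set)"
    then obtain \<phi> :: "(nat \<Rightarrow> int) \<Rightarrow> 'a" where \<phi>: "X = fraction_class n t \<sigma> \<phi>" "\<phi> \<in> graded_pieces n t \<sigma>"
      by blast
    obtain f e where "f \<in> carrier (mpoly_ring n)" "Poly_Mapping.keys e \<subseteq> \<sigma>" "components n t \<sigma> f e = \<phi>"
      using graded_pieces_components[OF \<phi>(2) \<sigma>] by blast
    then show "X \<in> {fraction_class n t \<sigma> (components n t \<sigma> f e) | f e.
        f \<in> carrier (mpoly_ring n) \<and> Poly_Mapping.keys e \<subseteq> \<sigma>}"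
      using \<phi>(1) by blast
  qed (use components_in_graded_pieces in blast)
  finally show ?thesis .
qed

lemma zero_cech_piece:
  assumes "\<sigma> \<subseteq> {1..n}"
  shows "\<zero>\<^bsub>cech_piece n t \<sigma>\<^esub> = fraction_class n t \<sigma> (\<lambda>_. 0)"
proof -
  have "\<zero>\<^bsub>cech_piece n t \<sigma>\<^esub> =
      fraction (denominators (mpoly_ring n) Var \<sigma>) (edge_module n t) (edge_coset n t 0) (mon 0)"
    by (simp add: cech_summand_def localization_def zero_edge_module)
  also have "\<dots> = fraction_class n t \<sigma> (components n t \<sigma> 0 0)"
    by (rule fraction_edge_module) (use assms in \<open>auto simp: mpoly_ring_carrier\<close>)
  also have "components n t \<sigma> 0 0 = (\<lambda>_. 0)" by (auto simp: components_def coeff_at_def)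
  finally show ?thesis .
qed

text \<open>Evaluates the operations of \<open>localization\<close>, which are unions over all
  representatives: there is one, and each yields the same class.\<close>

lemma UN_pairs_const:
  assumes "X \<noteq> {}" "\<And>u s. (u, s) \<in> X \<Longrightarrow> g u s = A"
  shows "(\<Union>(u, s)\<in>X. g u s) = A"
  using assms by fast

lemma add_cech_piece:
  fixes \<phi> \<psi> :: "(nat \<Rightarrow> int) \<Rightarrow> 'a::field"
  assumes \<sigma>: "\<sigma> \<subseteq> {1..n}" and \<phi>: "\<phi> \<in> graded_pieces n t \<sigma>" and \<psi>: "\<psi> \<in> graded_pieces n t \<sigma>"
  shows "fraction_class n t \<sigma> \<phi> \<oplus>\<^bsub>cech_piece n t \<sigma>\<^esub> fraction_class n t \<sigma> \<psi> =
    fraction_class n t \<sigma> (\<lambda>\<alpha>. \<phi> \<alpha> + \<psi> \<alpha>)"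
proof -
  let ?S = "denominators (mpoly_ring n) Var \<sigma>" and ?M = "edge_module n t"
  have "fraction ?S ?M (s \<odot>\<^bsub>?M\<^esub> u \<oplus>\<^bsub>?M\<^esub> r \<odot>\<^bsub>?M\<^esub> v) (r * s) =
      fraction_class n t \<sigma> (\<lambda>\<alpha>. \<phi> \<alpha> + \<psi> \<alpha>)"
    if us: "(u, r) \<in> fraction_class n t \<sigma> \<phi>" and vt: "(v, s) \<in> fraction_class n t \<sigma> \<psi>" for u r v s
  proof -
    obtain f e where fe: "u = edge_coset n t f" "r = mon e" "f \<in> carrier (mpoly_ring n)"
      "Poly_Mapping.keys e \<subseteq> \<sigma>" "components n t \<sigma> f e = \<phi>" using us by (rule fraction_class_cases)
    obtain g d where gd: "v = edge_coset n t g" "s = mon d" "g \<in> carrier (mpoly_ring n)"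
      "Poly_Mapping.keys d \<subseteq> \<sigma>" "components n t \<sigma> g d = \<psi>" using vt by (rule fraction_class_cases)
    have carr: "(mon e :: 'a mpoly) \<in> carrier (mpoly_ring n)" "(mon d :: 'a mpoly) \<in> carrier (mpoly_ring n)"
      using fe gd \<sigma> by (auto simp: mon_in_carrier)
    have "fraction ?S ?M (s \<odot>\<^bsub>?M\<^esub> u \<oplus>\<^bsub>?M\<^esub> r \<odot>\<^bsub>?M\<^esub> v) (r * s) =
        fraction ?S ?M (edge_coset n t (mon d * f + mon e * g)) (mon (e + d))"
      using fe gd carr by (simp add: smult_edge_module add_edge_module mpoly_ring_closed mon_mult)
    also have "\<dots> = fraction_class n t \<sigma> (components n t \<sigma> (mon d * f + mon e * g) (e + d))"
      by (rule fraction_edge_module) (use fe gd carr \<sigma> in \<open>auto simp: mpoly_ring_closed keys_add_nat\<close>)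
    also have "components n t \<sigma> (mon d * f + mon e * g) (e + d) = (\<lambda>\<alpha>. \<phi> \<alpha> + \<psi> \<alpha>)"
      using components_mon_mult[of n t \<sigma> d f e] components_mon_mult[of n t \<sigma> e g d] fe(5) gd(5)
      by (intro ext) (simp add: components_add add.commute[of e])
    finally show ?thesis .
  qed
  then have "(\<Union>(u, r)\<in>fraction_class n t \<sigma> \<phi>. \<Union>(v, s)\<in>fraction_class n t \<sigma> \<psi>.
      fraction ?S ?M (s \<odot>\<^bsub>?M\<^esub> u \<oplus>\<^bsub>?M\<^esub> r \<odot>\<^bsub>?M\<^esub> v) (r * s)) = fraction_class n t \<sigma> (\<lambda>\<alpha>. \<phi> \<alpha> + \<psi> \<alpha>)"
    by (intro UN_pairs_const fraction_class_nonempty \<phi> \<psi> \<sigma>)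
  then show ?thesis by (simp add: cech_summand_def localization_def)
qed

definition restrict_degrees :: "nat \<Rightarrow> nat \<Rightarrow> nat set \<Rightarrow> ((nat \<Rightarrow> int) \<Rightarrow> 'a::field) \<Rightarrow> (nat \<Rightarrow> int) \<Rightarrow> 'a" where
  "restrict_degrees n t \<tau> \<phi> \<alpha> = (if \<tau> \<in> degree_family n t \<alpha> then \<phi> \<alpha> else 0)"

text \<open>Missing an edge passes to subsets, so a degree present at \<open>\<tau>\<close> and
  absent at \<open>\<sigma>\<close> has a negative entry outside \<open>\<sigma>\<close>. A
  denominator supported in \<open>\<sigma>\<close> cannot produce it; hence further localization
  only kills components.\<close>

lemma components_mono:
  assumes "\<sigma> \<subseteq> \<tau>" "Poly_Mapping.keys e \<subseteq> \<sigma>"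
  shows "components n t \<tau> f e = restrict_degrees n t \<tau> (components n t \<sigma> f e)"
proof
  fix \<alpha>
  show "components n t \<tau> f e \<alpha> = restrict_degrees n t \<tau> (components n t \<sigma> f e) \<alpha>"
  proof (cases "\<tau> \<in> degree_family n t \<alpha> \<and> \<sigma> \<notin> degree_family n t \<alpha>")
    case True
    then have "\<exists>i. \<alpha> i < 0 \<and> i \<notin> \<sigma>"
      using assms(1) by (auto simp: degree_family_def degree_complex_def split: if_splits)
    then obtain i where "\<alpha> i < 0" "i \<notin> \<sigma>" by blast
    then have "\<alpha> i + exp_int e i < 0" using exp_int_outside[OF assms(2)] by simp
    then have "(\<lambda>i. \<alpha> i + exp_int e i) \<noteq> exp_int b" for b
      by (metis exp_int_def not_less of_nat_0_le_iff)
    then have "coeff_at f (\<lambda>i. \<alpha> i + exp_int e i) = 0" by (intro coeff_at_outside) blast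
    then show ?thesis using True by (simp add: restrict_degrees_def components_def)
  qed (auto simp: restrict_degrees_def components_def)
qed

lemma localization_map_fraction_class:
  assumes \<phi>: "\<phi> \<in> graded_pieces n t \<sigma>" and \<sigma>: "\<sigma> \<subseteq> \<tau>" and \<tau>: "\<tau> \<subseteq> {1..n}"
  shows "localization_map (denominators (mpoly_ring n) Var \<tau>) (edge_module n t) (fraction_class n t \<sigma> \<phi>) =
    fraction_class n t \<tau> (restrict_degrees n t \<tau> \<phi>)"
  unfolding localization_map_def
proof (rule UN_pairs_const)
  show "fraction_class n t \<sigma> \<phi> \<noteq> {}" using fraction_class_nonempty[OF \<phi>] \<sigma> \<tau> by simp
  fix u s assume "(u, s) \<in> fraction_class n t \<sigma> \<phi>"
  then obtain f e where fe: "u = edge_coset n t f" "s = mon e" "f \<in> carrier (mpoly_ring n)"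
      "Poly_Mapping.keys e \<subseteq> \<sigma>" "components n t \<sigma> f e = \<phi>" by (rule fraction_class_cases)
  then show "fraction (denominators (mpoly_ring n) Var \<tau>) (edge_module n t) u s =
      fraction_class n t \<tau> (restrict_degrees n t \<tau> \<phi>)"
    using fraction_edge_module[OF fe(3) _ \<tau>, of e t] components_mono[OF \<sigma> fe(4), of n t f] \<sigma> by simp
qed

lemma restrict_degrees_graded:
  assumes "\<phi> \<in> graded_pieces n t \<sigma>"
  shows "restrict_degrees n t \<tau> \<phi> \<in> graded_pieces n t \<tau>"
proof -
  have "{\<alpha>. restrict_degrees n t \<tau> \<phi> \<alpha> \<noteq> 0} \<subseteq> {\<alpha>. \<phi> \<alpha> \<noteq> 0}" by (auto simp: restrict_degrees_def)
  then have "finite {\<alpha>. restrict_degrees n t \<tau> \<phi> \<alpha> \<noteq> 0}"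
    by (rule finite_subset) (use assms in \<open>simp add: graded_pieces_def\<close>)
  then show ?thesis by (auto simp: graded_pieces_def restrict_degrees_def split: if_splits)
qed

lemma comm_group_cech_piece:
  assumes \<sigma>: "\<sigma> \<subseteq> {1..n}"
  shows "comm_group (add_monoid (cech_piece n t \<sigma> :: ('a::field mpoly, _) module))"
proof (rule comm_groupI)
  let ?G = "add_monoid (cech_piece n t \<sigma> :: ('a mpoly, _) module)"
  note simps = carrier_cech_piece[OF \<sigma>] zero_cech_piece[OF \<sigma>] add_cech_piece[OF \<sigma>]
    graded_pieces_add graded_pieces_zero graded_pieces_uminus
  fix X assume "X \<in> carrier ?G"
  then obtain \<phi> where \<phi>: "X = fraction_class n t \<sigma> \<phi>" "\<phi> \<in> graded_pieces n t \<sigma>" by (auto simp: simps)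
  show "\<one>\<^bsub>?G\<^esub> \<otimes>\<^bsub>?G\<^esub> X = X" using \<phi> by (simp add: simps)
  show "\<exists>Y\<in>carrier ?G. Y \<otimes>\<^bsub>?G\<^esub> X = \<one>\<^bsub>?G\<^esub>"
    using \<phi> by (intro bexI[of _ "fraction_class n t \<sigma> (\<lambda>\<alpha>. - \<phi> \<alpha>)"]) (simp_all add: simps)
  fix Y assume "Y \<in> carrier ?G"
  then obtain \<psi> where \<psi>: "Y = fraction_class n t \<sigma> \<psi>" "\<psi> \<in> graded_pieces n t \<sigma>" by (auto simp: simps)
  show "X \<otimes>\<^bsub>?G\<^esub> Y \<in> carrier ?G" using \<phi> \<psi> by (simp add: simps)
  show "X \<otimes>\<^bsub>?G\<^esub> Y = Y \<otimes>\<^bsub>?G\<^esub> X" using \<phi> \<psi> by (simp add: simps add.commute)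
  fix Z assume "Z \<in> carrier ?G"
  then obtain \<chi> where \<chi>: "Z = fraction_class n t \<sigma> \<chi>" "\<chi> \<in> graded_pieces n t \<sigma>" by (auto simp: simps)
  show "X \<otimes>\<^bsub>?G\<^esub> Y \<otimes>\<^bsub>?G\<^esub> Z = X \<otimes>\<^bsub>?G\<^esub> (Y \<otimes>\<^bsub>?G\<^esub> Z)" using \<phi> \<psi> \<chi> by (simp add: simps add.assoc)
next
  show "\<one>\<^bsub>add_monoid (cech_piece n t \<sigma>)\<^esub> \<in> carrier (add_monoid (cech_piece n t \<sigma> :: ('a mpoly, _) module))"
    by (simp add: carrier_cech_piece[OF \<sigma>] zero_cech_piece[OF \<sigma>] graded_pieces_zero)
qed

lemma uminus_cech_piece:
  assumes \<sigma>: "\<sigma> \<subseteq> {1..n}" and \<phi>: "\<phi> \<in> (graded_pieces n t \<sigma> :: ((nat \<Rightarrow> int) \<Rightarrow> 'a::field) set)"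
  shows "\<ominus>\<^bsub>cech_piece n t \<sigma>\<^esub> fraction_class n t \<sigma> \<phi> = fraction_class n t \<sigma> (\<lambda>\<alpha>. - \<phi> \<alpha>)"
proof -
  interpret comm_group "add_monoid (cech_piece n t \<sigma> :: ('a mpoly, _) module)"
    by (rule comm_group_cech_piece[OF \<sigma>])
  show ?thesis
    unfolding a_inv_def using \<phi>
    by (intro inv_equality)
      (simp_all add: carrier_cech_piece[OF \<sigma>] zero_cech_piece[OF \<sigma>] add_cech_piece[OF \<sigma>] graded_pieces_uminus)
qed

text \<open>Membership of the sum goes through the induction as well, since
  \<open>add_cech_piece\<close> asks for it.\<close>

lemma finsum_cech_piece:
  assumes \<sigma>: "\<sigma> \<subseteq> {1..n}" and "finite A"
    and "\<And>i. i \<in> A \<Longrightarrow> \<phi> i \<in> (graded_pieces n t \<sigma> :: ((nat \<Rightarrow> int) \<Rightarrow> 'a::field) set)"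
  shows "(\<Oplus>\<^bsub>cech_piece n t \<sigma>\<^esub>i\<in>A. fraction_class n t \<sigma> (\<phi> i)) = fraction_class n t \<sigma> (\<lambda>\<alpha>. \<Sum>i\<in>A. \<phi> i \<alpha>) \<and>
    (\<lambda>\<alpha>. \<Sum>i\<in>A. \<phi> i \<alpha>) \<in> graded_pieces n t \<sigma>"
  using assms(2,3)
proof (induction A rule: finite_induct)
  case empty
  interpret comm_group "add_monoid (cech_piece n t \<sigma> :: ('a mpoly, _) module)"
    by (rule comm_group_cech_piece[OF \<sigma>])
  have "(\<Oplus>\<^bsub>cech_piece n t \<sigma>\<^esub>i\<in>{}. fraction_class n t \<sigma> (\<phi> i)) = \<zero>\<^bsub>cech_piece n t \<sigma>\<^esub>"
    unfolding finsum_def finprod_empty by simp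
  then show ?case by (simp add: zero_cech_piece[OF \<sigma>] graded_pieces_zero)
next
  case (insert i A)
  interpret comm_group "add_monoid (cech_piece n t \<sigma> :: ('a mpoly, _) module)"
    by (rule comm_group_cech_piece[OF \<sigma>])
  have "(\<Oplus>\<^bsub>cech_piece n t \<sigma>\<^esub>i\<in>insert i A. fraction_class n t \<sigma> (\<phi> i)) =
      fraction_class n t \<sigma> (\<phi> i) \<oplus>\<^bsub>cech_piece n t \<sigma>\<^esub> (\<Oplus>\<^bsub>cech_piece n t \<sigma>\<^esub>i\<in>A. fraction_class n t \<sigma> (\<phi> i))"
    unfolding finsum_def using insert by (subst finprod_insert) (auto simp: carrier_cech_piece[OF \<sigma>])
  then show ?case using insert by (simp add: add_cech_piece[OF \<sigma>] graded_pieces_add)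
qed

section \<open>Local cohomology and depth\<close>

lemma interval_closed_degree_family: "interval_closed (degree_family n t \<alpha>)"
proof (cases "\<forall>i. i \<notin> {1..n} \<longrightarrow> \<alpha> i = 0")
  case True
  then have "degree_family n t \<alpha> = degree_complex t n \<alpha>" unfolding degree_family_def by (rule if_P)
  then show ?thesis by (simp only: interval_closed_degree_complex)
next
  case False
  then have "degree_family n t \<alpha> = {}" unfolding degree_family_def by (rule if_not_P)
  then show ?thesis by (simp add: interval_closed_def)
qed

lemma degree_family_subset: "\<sigma> \<in> degree_family n t \<alpha> \<Longrightarrow> \<sigma> \<subseteq> {1..n}"
  by (auto simp: degree_family_def degree_complex_def split: if_splits)

text \<open>One function carries cochains of all levels at once; \<open>to_cech\<close> selects the
  sets of cardinality \<open>p\<close>.\<close>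

definition graded_cochains :: "nat \<Rightarrow> nat \<Rightarrow> (nat set \<Rightarrow> (nat \<Rightarrow> int) \<Rightarrow> 'a::field) set" where
  "graded_cochains n t = {\<Phi>. \<forall>\<sigma>. \<Phi> \<sigma> \<in> graded_pieces n t \<sigma>}"

definition graded_diff :: "nat \<Rightarrow> nat \<Rightarrow> (nat set \<Rightarrow> (nat \<Rightarrow> int) \<Rightarrow> 'a::field) \<Rightarrow> nat set \<Rightarrow> (nat \<Rightarrow> int) \<Rightarrow> 'a" where
  "graded_diff n t \<Phi> \<tau> \<alpha> = (if \<tau> \<in> degree_family n t \<alpha> then cobd (\<lambda>\<sigma>. \<Phi> \<sigma> \<alpha>) \<tau> else 0)"

definition to_cech :: "nat \<Rightarrow> nat \<Rightarrow> nat \<Rightarrow> (nat set \<Rightarrow> (nat \<Rightarrow> int) \<Rightarrow> 'a::field) \<Rightarrow> nat set \<Rightarrow> ('a mpoly set \<times> 'a mpoly) set" where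
  "to_cech n t p \<Phi> = (\<lambda>\<sigma>\<in>cech_index n p. fraction_class n t \<sigma> (\<Phi> \<sigma>))"

abbreviation edge_cochains :: "nat \<Rightarrow> nat \<Rightarrow> nat \<Rightarrow> (nat set \<Rightarrow> ('a::field mpoly set \<times> 'a mpoly) set) monoid" where
  "edge_cochains n t p \<equiv> cech_cochains (mpoly_ring n) Var n (edge_module n t) p"

lemma cech_indexD: "\<sigma> \<in> cech_index n p \<Longrightarrow> \<sigma> \<subseteq> {1..n}" "\<sigma> \<in> cech_index n p \<Longrightarrow> card \<sigma> = p"
  by (auto simp: cech_index_def)

lemma graded_cochainsD: "\<Phi> \<in> graded_cochains n t \<Longrightarrow> \<Phi> \<sigma> \<in> graded_pieces n t \<sigma>"
  by (simp add: graded_cochains_def)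

lemma graded_cochains_outside: "\<Phi> \<in> graded_cochains n t \<Longrightarrow> \<sigma> \<notin> degree_family n t \<alpha> \<Longrightarrow> \<Phi> \<sigma> \<alpha> = 0"
  by (auto simp: graded_cochains_def graded_pieces_def)

lemma graded_cochains_finite: "\<Phi> \<in> graded_cochains n t \<Longrightarrow> finite {\<alpha>. \<Phi> \<sigma> \<alpha> \<noteq> 0}"
  by (auto simp: graded_cochains_def graded_pieces_def)

lemma graded_cochains_zero: "(\<lambda>_ _. 0) \<in> graded_cochains n t"
  by (simp add: graded_cochains_def graded_pieces_zero)

lemma graded_diff_closed:
  assumes "\<Phi> \<in> graded_cochains n t"
  shows "graded_diff n t \<Phi> \<in> graded_cochains n t"
  unfolding graded_cochains_def graded_pieces_def
proof (intro CollectI allI conjI impI)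
  fix \<tau>
  show "finite {\<alpha>. graded_diff n t \<Phi> \<tau> \<alpha> \<noteq> 0}"
  proof (cases "finite \<tau>")
    case True
    have "{\<alpha>. graded_diff n t \<Phi> \<tau> \<alpha> \<noteq> 0} \<subseteq> (\<Union>i\<in>\<tau>. {\<alpha>. \<Phi> (\<tau> - {i}) \<alpha> \<noteq> 0})"
    proof
      fix \<alpha> assume "\<alpha> \<in> {\<alpha>. graded_diff n t \<Phi> \<tau> \<alpha> \<noteq> 0}"
      then have "cobd (\<lambda>\<sigma>. \<Phi> \<sigma> \<alpha>) \<tau> \<noteq> 0" by (simp add: graded_diff_def split: if_splits)
      then show "\<alpha> \<in> (\<Union>i\<in>\<tau>. {\<alpha>. \<Phi> (\<tau> - {i}) \<alpha> \<noteq> 0})" using cobd_zero[of \<tau> "\<lambda>\<sigma>. \<Phi> \<sigma> \<alpha>"] by blast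
    qed
    then show ?thesis by (rule finite_subset) (use True graded_cochains_finite[OF assms] in auto)
  qed (simp add: graded_diff_def cobd_def)
qed (auto simp: graded_diff_def split: if_splits)

lemma to_cech_carrier:
  assumes "\<Phi> \<in> graded_cochains n t"
  shows "to_cech n t p \<Phi> \<in> carrier (edge_cochains n t p)"
  using graded_cochainsD[OF assms]
  by (auto simp: to_cech_def cech_cochains_def carrier_cech_piece[OF cech_indexD(1)[of _ n p]])

lemma carrier_edge_cochains:
  "carrier (edge_cochains n t p) = to_cech n t p ` (graded_cochains n t :: (nat set \<Rightarrow> (nat \<Rightarrow> int) \<Rightarrow> 'a::field) set)"
proof (intro equalityI subsetI)
  fix c :: "nat set \<Rightarrow> ('a mpoly set \<times> 'a mpoly) set" assume c: "c \<in> carrier (edge_cochains n t p)"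
  have "\<exists>\<phi> \<in> graded_pieces n t \<sigma>. \<sigma> \<in> cech_index n p \<longrightarrow> c \<sigma> = fraction_class n t \<sigma> \<phi>" for \<sigma>
  proof (cases "\<sigma> \<in> cech_index n p")
    case True
    then have "c \<sigma> \<in> carrier (cech_piece n t \<sigma>)" using c by (auto simp: cech_cochains_def)
    then show ?thesis using True by (auto simp: carrier_cech_piece[OF cech_indexD(1)[of _ n p]])
  qed (use graded_pieces_zero in blast)
  then obtain \<Phi> where \<Phi>: "\<And>\<sigma>. \<Phi> \<sigma> \<in> graded_pieces n t \<sigma>"
    "\<And>\<sigma>. \<sigma> \<in> cech_index n p \<Longrightarrow> c \<sigma> = fraction_class n t \<sigma> (\<Phi> \<sigma>)" by metis
  then have "c = to_cech n t p \<Phi>"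
    using c by (intro ext) (auto simp: to_cech_def cech_cochains_def PiE_def extensional_def restrict_def)
  then show "c \<in> to_cech n t p ` graded_cochains n t" using \<Phi>(1) by (auto simp: graded_cochains_def)
qed (use to_cech_carrier in blast)

lemma to_cech_eq_iff:
  assumes "\<Phi> \<in> graded_cochains n t"
  shows "to_cech n t p \<Phi> = to_cech n t p \<Psi> \<longleftrightarrow> (\<forall>\<sigma>\<in>cech_index n p. \<Phi> \<sigma> = \<Psi> \<sigma>)"
proof
  assume eq: "to_cech n t p \<Phi> = to_cech n t p \<Psi>"
  show "\<forall>\<sigma>\<in>cech_index n p. \<Phi> \<sigma> = \<Psi> \<sigma>"
  proof
    fix \<sigma> assume \<sigma>: "\<sigma> \<in> cech_index n p"
    then show "\<Phi> \<sigma> = \<Psi> \<sigma>"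
      using fun_cong[OF eq, of \<sigma>] fraction_class_inj[OF graded_cochainsD[OF assms] cech_indexD(1)[OF \<sigma>]]
      by (simp add: to_cech_def)
  qed
qed (auto simp: to_cech_def intro!: restrict_ext)

lemma one_edge_cochains: "\<one>\<^bsub>edge_cochains n t p\<^esub> = to_cech n t p (\<lambda>_ _. 0)"
  by (auto simp: cech_cochains_def to_cech_def zero_cech_piece[OF cech_indexD(1)[of _ n p]] intro!: restrict_ext)

lemma mult_edge_cochains:
  assumes "\<Phi> \<in> graded_cochains n t" "\<Psi> \<in> graded_cochains n t"
  shows "to_cech n t p \<Phi> \<otimes>\<^bsub>edge_cochains n t p\<^esub> to_cech n t p \<Psi> = to_cech n t p (\<lambda>\<sigma> \<alpha>. \<Phi> \<sigma> \<alpha> + \<Psi> \<sigma> \<alpha>)"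
  using graded_cochainsD[OF assms(1)] graded_cochainsD[OF assms(2)]
  by (auto simp: cech_cochains_def to_cech_def add_cech_piece[OF cech_indexD(1)[of _ n p]] intro!: restrict_ext)

lemma group_edge_cochains: "group (edge_cochains n t p :: (nat set \<Rightarrow> ('a::field mpoly set \<times> 'a mpoly) set) monoid)"
  unfolding cech_cochains_def
  by (intro product_group comm_group.axioms(2) comm_group_cech_piece cech_indexD)

text \<open>Localization maps only restrict degrees, and both differentials take their signs from
  the number of smaller elements of \<open>\<tau>\<close>. So the Cech differential is
  \<open>cobd\<close> in each degree, cut off to the family.\<close>

lemma cech_diff_to_cech:
  fixes \<Phi> :: "nat set \<Rightarrow> (nat \<Rightarrow> int) \<Rightarrow> 'a::field"
  assumes \<Phi>: "\<Phi> \<in> graded_cochains n t"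
  shows "cech_diff (mpoly_ring n) Var n (edge_module n t) p (to_cech n t p \<Phi>) = to_cech n t (Suc p) (graded_diff n t \<Phi>)"
proof
  fix \<tau>
  show "cech_diff (mpoly_ring n) Var n (edge_module n t) p (to_cech n t p \<Phi>) \<tau> = to_cech n t (Suc p) (graded_diff n t \<Phi>) \<tau>"
  proof (cases "\<tau> \<in> cech_index n (Suc p)")
    case True
    note \<tau> = cech_indexD[OF True]
    have fin: "finite \<tau>" using \<tau>(1) by (rule finite_subset) simp
    define s where "s i = (-1 :: 'a) ^ card {j \<in> \<tau>. j < i}" for i
    define \<phi> where "\<phi> i \<alpha> = s i * restrict_degrees n t \<tau> (\<Phi> (\<tau> - {i})) \<alpha>" for i \<alpha>
    have res: "restrict_degrees n t \<tau> (\<Phi> (\<tau> - {i})) \<in> graded_pieces n t \<tau>" for i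
      by (rule restrict_degrees_graded[OF graded_cochainsD[OF \<Phi>]])
    have \<phi>_in: "\<phi> i \<in> graded_pieces n t \<tau>" for i
      using res[of i] graded_pieces_uminus[OF res[of i]]
      by (cases "even (card {j \<in> \<tau>. j < i})") (simp_all add: \<phi>_def[abs_def] s_def)
    have summand: "(let y = localization_map (denominators (mpoly_ring n) Var \<tau>) (edge_module n t) (to_cech n t p \<Phi> (\<tau> - {i})) in
        if even (card {j \<in> \<tau>. j < i}) then y else \<ominus>\<^bsub>cech_piece n t \<tau>\<^esub> y) = fraction_class n t \<tau> (\<phi> i)"
      if i: "i \<in> \<tau>" for i
    proof -
      have "\<tau> - {i} \<in> cech_index n p" using \<tau> fin i by (auto simp: cech_index_def)
      then have "to_cech n t p \<Phi> (\<tau> - {i}) = fraction_class n t (\<tau> - {i}) (\<Phi> (\<tau> - {i}))"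
        by (simp add: to_cech_def)
      then have y: "localization_map (denominators (mpoly_ring n) Var \<tau>) (edge_module n t) (to_cech n t p \<Phi> (\<tau> - {i})) =
          fraction_class n t \<tau> (restrict_degrees n t \<tau> (\<Phi> (\<tau> - {i})))"
        using localization_map_fraction_class[OF graded_cochainsD[OF \<Phi>] _ \<tau>(1)] by simp
      show ?thesis
        unfolding y Let_def
        by (cases "even (card {j \<in> \<tau>. j < i})")
          (simp_all add: uminus_cech_piece[OF \<tau>(1) res] \<phi>_def[abs_def] s_def)
    qed
    have "cech_diff (mpoly_ring n) Var n (edge_module n t) p (to_cech n t p \<Phi>) \<tau> =
        (\<Oplus>\<^bsub>cech_piece n t \<tau>\<^esub>i\<in>\<tau>. (let y = localization_map (denominators (mpoly_ring n) Var \<tau>) (edge_module n t) (to_cech n t p \<Phi> (\<tau> - {i})) in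
        if even (card {j \<in> \<tau>. j < i}) then y else \<ominus>\<^bsub>cech_piece n t \<tau>\<^esub> y))"
      using True by (simp add: cech_diff_def)
    also have "\<dots> = (\<Oplus>\<^bsub>cech_piece n t \<tau>\<^esub>i\<in>\<tau>. fraction_class n t \<tau> (\<phi> i))"
    proof -
      interpret comm_group "add_monoid (cech_piece n t \<tau> :: ('a mpoly, _) module)"
        by (rule comm_group_cech_piece[OF \<tau>(1)])
      show ?thesis
        unfolding finsum_def
        by (rule finprod_cong') (use summand \<phi>_in in \<open>auto simp: carrier_cech_piece[OF \<tau>(1)]\<close>)
    qed
    also have "\<dots> = fraction_class n t \<tau> (\<lambda>\<alpha>. \<Sum>i\<in>\<tau>. \<phi> i \<alpha>)"
      using finsum_cech_piece[where \<phi> = \<phi>, OF \<tau>(1) fin \<phi>_in] by blast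
    also have "(\<lambda>\<alpha>. \<Sum>i\<in>\<tau>. \<phi> i \<alpha>) = graded_diff n t \<Phi> \<tau>"
      by (auto simp: graded_diff_def cobd_def \<phi>_def s_def restrict_degrees_def)
    finally show ?thesis by (simp only: to_cech_def[of n t "Suc p"] restrict_apply'[OF True])
  qed (simp add: cech_diff_def to_cech_def)
qed

lemma graded_diff_add:
  "graded_diff n t (\<lambda>\<sigma> \<alpha>. \<Phi> \<sigma> \<alpha> + \<Psi> \<sigma> \<alpha>) = (\<lambda>\<tau> \<alpha>. graded_diff n t \<Phi> \<tau> \<alpha> + graded_diff n t \<Psi> \<tau> \<alpha>)"
  by (auto simp: graded_diff_def cobd_add fun_eq_iff)

lemma graded_cochains_add:
  "\<Phi> \<in> graded_cochains n t \<Longrightarrow> \<Psi> \<in> graded_cochains n t \<Longrightarrow> (\<lambda>\<sigma> \<alpha>. \<Phi> \<sigma> \<alpha> + \<Psi> \<sigma> \<alpha>) \<in> graded_cochains n t"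
  by (simp add: graded_cochains_def graded_pieces_add)

section \<open>Cocycles and coboundaries degree by degree\<close>

lemma subgroup_cech_cocycles:
  "subgroup (cech_cocycles (mpoly_ring n) Var n (edge_module n t) p)
    (edge_cochains n t p :: (nat set \<Rightarrow> ('a::field mpoly set \<times> 'a mpoly) set) monoid)"
proof -
  have "group_hom (edge_cochains n t p :: (nat set \<Rightarrow> ('a mpoly set \<times> 'a mpoly) set) monoid)
      (edge_cochains n t (Suc p)) (cech_diff (mpoly_ring n) Var n (edge_module n t) p)"
  proof (intro group_hom.intro group_hom_axioms.intro group_edge_cochains homI)
    fix x y :: "nat set \<Rightarrow> ('a mpoly set \<times> 'a mpoly) set"
    assume "x \<in> carrier (edge_cochains n t p)"
    then obtain \<Phi> where \<Phi>: "x = to_cech n t p \<Phi>" "\<Phi> \<in> graded_cochains n t" by (auto simp: carrier_edge_cochains)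
    show "cech_diff (mpoly_ring n) Var n (edge_module n t) p x \<in> carrier (edge_cochains n t (Suc p))"
      using \<Phi> by (simp add: cech_diff_to_cech to_cech_carrier graded_diff_closed)
    assume "y \<in> carrier (edge_cochains n t p)"
    then obtain \<Psi> where \<Psi>: "y = to_cech n t p \<Psi>" "\<Psi> \<in> graded_cochains n t" by (auto simp: carrier_edge_cochains)
    show "cech_diff (mpoly_ring n) Var n (edge_module n t) p (x \<otimes>\<^bsub>edge_cochains n t p\<^esub> y) =
        cech_diff (mpoly_ring n) Var n (edge_module n t) p x \<otimes>\<^bsub>edge_cochains n t (Suc p)\<^esub>
        cech_diff (mpoly_ring n) Var n (edge_module n t) p y"
      using \<Phi> \<Psi> by (simp add: cech_diff_to_cech mult_edge_cochains graded_diff_closed graded_cochains_add graded_diff_add)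
  qed
  then show ?thesis
    unfolding cech_cocycles_def using group_hom.subgroup_kernel by simp
qed

lemma cech_cocycles_eq:
  "cech_cocycles (mpoly_ring n) Var n (edge_module n t) p =
    to_cech n t p ` {\<Phi> \<in> graded_cochains n t :: (nat set \<Rightarrow> (nat \<Rightarrow> int) \<Rightarrow> 'a::field) set.
      \<forall>\<tau>\<in>cech_index n (Suc p). graded_diff n t \<Phi> \<tau> = (\<lambda>_. 0)}"
  by (auto simp: cech_cocycles_def kernel_def carrier_edge_cochains one_edge_cochains cech_diff_to_cech
      to_cech_eq_iff graded_diff_closed)

lemma cech_coboundaries_Suc:
  "cech_coboundaries (mpoly_ring n) Var n (edge_module n t) (Suc q) =
    to_cech n t (Suc q) ` graded_diff n t ` (graded_cochains n t :: (nat set \<Rightarrow> (nat \<Rightarrow> int) \<Rightarrow> 'a::field) set)"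
  by (force simp: cech_coboundaries_def carrier_edge_cochains image_iff cech_diff_to_cech)

lemma cech_coboundaries_0:
  "cech_coboundaries (mpoly_ring n) Var n (edge_module n t) 0 = {to_cech n t 0 (\<lambda>_ _. 0)}"
  by (simp add: cech_coboundaries_def one_edge_cochains)

lemma graded_diff_0: "graded_diff n t (\<lambda>_ _. 0) = (\<lambda>_ _. 0)"
  by (auto simp: graded_diff_def cobd_def fun_eq_iff)

lemma graded_diff_diff:
  assumes \<Phi>: "\<Phi> \<in> graded_cochains n t"
  shows "graded_diff n t (graded_diff n t \<Phi>) = (\<lambda>_ _. 0)"
proof (intro ext)
  fix \<tau> \<alpha>
  show "graded_diff n t (graded_diff n t \<Phi>) \<tau> \<alpha> = 0"
  proof (cases "\<tau> \<in> degree_family n t \<alpha>")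
    case True
    have "cobd (\<lambda>\<sigma>. graded_diff n t \<Phi> \<sigma> \<alpha>) \<tau> = cobd (cobd (\<lambda>\<sigma>. \<Phi> \<sigma> \<alpha>)) \<tau>"
    proof (rule cobd_cong)
      fix i
      show "graded_diff n t \<Phi> (\<tau> - {i}) \<alpha> = cobd (\<lambda>\<sigma>. \<Phi> \<sigma> \<alpha>) (\<tau> - {i})"
        using cobd_outside[OF interval_closed_degree_family graded_cochains_outside[OF \<Phi>] True]
        by (auto simp: graded_diff_def)
    qed
    then show ?thesis by (simp add: graded_diff_def cobd_cobd)
  qed (simp add: graded_diff_def)
qed

lemma cech_coboundaries_subset:
  "cech_coboundaries (mpoly_ring n) Var n (edge_module n t) p \<subseteq>
    (cech_cocycles (mpoly_ring n) Var n (edge_module n t) p :: (nat set \<Rightarrow> ('a::field mpoly set \<times> 'a mpoly) set) set)"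
proof (cases p)
  case 0
  then show ?thesis
    by (auto simp: cech_coboundaries_0 cech_cocycles_eq graded_diff_0 intro!: imageI graded_cochains_zero)
next
  case (Suc q)
  then show ?thesis
    by (auto simp: cech_coboundaries_Suc cech_cocycles_eq graded_diff_diff graded_diff_closed intro!: imageI)
qed

lemma cech_cocycles_subset:
  assumes ex: "\<And>\<alpha>. exact_at TYPE('a::field) (degree_family n t \<alpha>) p"
  shows "(cech_cocycles (mpoly_ring n) Var n (edge_module n t) p :: (nat set \<Rightarrow> ('a mpoly set \<times> 'a mpoly) set) set) \<subseteq>
    cech_coboundaries (mpoly_ring n) Var n (edge_module n t) p"
proof
  fix c :: "nat set \<Rightarrow> ('a mpoly set \<times> 'a mpoly) set"
  assume "c \<in> cech_cocycles (mpoly_ring n) Var n (edge_module n t) p"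
  then obtain \<Phi> where \<Phi>: "c = to_cech n t p \<Phi>" "\<Phi> \<in> graded_cochains n t"
    "\<And>\<tau>. \<tau> \<in> cech_index n (Suc p) \<Longrightarrow> graded_diff n t \<Phi> \<tau> = (\<lambda>_. 0)"
    by (auto simp: cech_cocycles_eq)
  have "\<exists>b. (\<forall>\<sigma>. \<sigma> \<notin> degree_family n t \<alpha> \<longrightarrow> b \<sigma> = 0) \<and>
      (\<forall>\<sigma>\<in>degree_family n t \<alpha>. card \<sigma> = p \<longrightarrow> \<Phi> \<sigma> \<alpha> = cobd b \<sigma>)" for \<alpha>
  proof -
    have "cobd (\<lambda>\<sigma>. \<Phi> \<sigma> \<alpha>) \<tau> = 0" if "\<tau> \<in> degree_family n t \<alpha>" "card \<tau> = Suc p" for \<tau>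
    proof -
      have "\<tau> \<in> cech_index n (Suc p)" using that degree_family_subset by (auto simp: cech_index_def)
      from fun_cong[OF \<Phi>(3)[OF this], of \<alpha>] show ?thesis using that by (simp add: graded_diff_def)
    qed
    from exact_atD[OF ex[of \<alpha>] graded_cochains_outside[OF \<Phi>(2)] this] show ?thesis by metis
  qed
  then obtain b where b0: "\<And>\<alpha> \<sigma>. \<sigma> \<notin> degree_family n t \<alpha> \<Longrightarrow> b \<alpha> \<sigma> = 0"
    and b: "\<And>\<alpha> \<sigma>. \<sigma> \<in> degree_family n t \<alpha> \<Longrightarrow> card \<sigma> = p \<Longrightarrow> \<Phi> \<sigma> \<alpha> = cobd (b \<alpha>) \<sigma>" by metis
  show "c \<in> cech_coboundaries (mpoly_ring n) Var n (edge_module n t) p"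
  proof (cases p)
    case 0
    have "\<Phi> \<sigma> = (\<lambda>_. 0)" if \<sigma>: "\<sigma> \<in> cech_index n p" for \<sigma>
    proof
      fix \<alpha>
      have "finite \<sigma>" using cech_indexD(1)[OF \<sigma>] by (rule finite_subset) simp
      then have "\<sigma> = {}" using cech_indexD(2)[OF \<sigma>] 0 by simp
      then show "\<Phi> \<sigma> \<alpha> = 0"
        using b[of \<sigma> \<alpha>] graded_cochains_outside[OF \<Phi>(2), of \<sigma> \<alpha>] 0
        by (cases "\<sigma> \<in> degree_family n t \<alpha>") (auto simp: cobd_def)
    qed
    then have "c = to_cech n t p (\<lambda>_ _. 0)" by (simp add: \<Phi>(1) to_cech_eq_iff[OF \<Phi>(2)])
    then show ?thesis using 0 by (simp add: cech_coboundaries_0)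
  next
    case (Suc q)
    \<comment> \<open>Exactness gives a primitive in each of infinitely many degrees. Only the
      finitely many in \<open>A\<close> are kept, to have finite support; elsewhere
      \<open>\<Phi>\<close> is zero in level \<open>p\<close> and so is the primitive.\<close>
    define A where "A = (\<Union>\<sigma>\<in>cech_index n p. {\<alpha>. \<Phi> \<sigma> \<alpha> \<noteq> 0})"
    have "finite (cech_index n p)" by (rule finite_subset[of _ "Pow {1..n}"]) (auto simp: cech_index_def)
    then have finA: "finite A" using graded_cochains_finite[OF \<Phi>(2)] by (simp add: A_def)
    define \<Psi> where "\<Psi> \<sigma> \<alpha> = (if \<alpha> \<in> A then b \<alpha> \<sigma> else 0)" for \<sigma> \<alpha>
    have "{\<alpha>. \<Psi> \<sigma> \<alpha> \<noteq> 0} \<subseteq> A" for \<sigma> by (auto simp: \<Psi>_def)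
    then have "finite {\<alpha>. \<Psi> \<sigma> \<alpha> \<noteq> 0}" for \<sigma> using finA by (rule finite_subset)
    then have \<Psi>: "\<Psi> \<in> graded_cochains n t"
      using b0 by (auto simp: graded_cochains_def graded_pieces_def \<Psi>_def split: if_splits)
    have "\<Phi> \<sigma> = graded_diff n t \<Psi> \<sigma>" if \<sigma>: "\<sigma> \<in> cech_index n p" for \<sigma>
    proof
      fix \<alpha>
      show "\<Phi> \<sigma> \<alpha> = graded_diff n t \<Psi> \<sigma> \<alpha>"
      proof (cases "\<sigma> \<in> degree_family n t \<alpha>")
        case True
        show ?thesis
        proof (cases "\<alpha> \<in> A")
          case False
          then have "\<Phi> \<sigma> \<alpha> = 0" using \<sigma> by (auto simp: A_def)
          then show ?thesis using False by (simp add: graded_diff_def \<Psi>_def cobd_def)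
        qed (use True b cech_indexD(2)[OF \<sigma>] in \<open>simp add: graded_diff_def \<Psi>_def\<close>)
      qed (simp add: graded_diff_def graded_cochains_outside[OF \<Phi>(2)])
    qed
    then have "c = to_cech n t p (graded_diff n t \<Psi>)" by (simp add: \<Phi>(1) to_cech_eq_iff[OF \<Phi>(2)])
    then show ?thesis using \<Psi> Suc by (auto simp: cech_coboundaries_Suc)
  qed
qed

lemma cech_cocycle_not_coboundary:
  assumes ex: "\<not> exact_at TYPE('a::field) (degree_family n t \<alpha>) p"
  shows "\<exists>c :: nat set \<Rightarrow> ('a mpoly set \<times> 'a mpoly) set.
    c \<in> cech_cocycles (mpoly_ring n) Var n (edge_module n t) p \<and>
    c \<notin> cech_coboundaries (mpoly_ring n) Var n (edge_module n t) p"
proof -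
  obtain c :: "nat set \<Rightarrow> 'a" where c: "\<forall>\<sigma>. \<sigma> \<notin> degree_family n t \<alpha> \<longrightarrow> c \<sigma> = 0"
      "\<forall>\<tau>\<in>degree_family n t \<alpha>. card \<tau> = Suc p \<longrightarrow> cobd c \<tau> = 0"
      "\<not> (\<exists>b. (\<forall>\<sigma>. \<sigma> \<notin> degree_family n t \<alpha> \<longrightarrow> b \<sigma> = 0) \<and>
        (\<forall>\<sigma>\<in>degree_family n t \<alpha>. card \<sigma> = p \<longrightarrow> c \<sigma> = cobd b \<sigma>))"
    using ex unfolding exact_at_def not_all not_imp by (elim exE conjE)
  note c0 = c(1)[rule_format] and nb = c(3)
  \<comment> \<open>The obstruction sits in the single degree \<open>\<alpha>\<close>; the part of a
    primitive in this degree would be a primitive of \<open>c\<close>.\<close>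
  define \<Phi> where "\<Phi> \<sigma> \<beta> = (if \<beta> = \<alpha> then c \<sigma> else 0)" for \<sigma> \<beta>
  have "{\<beta>. \<Phi> \<sigma> \<beta> \<noteq> 0} \<subseteq> {\<alpha>}" for \<sigma> by (auto simp: \<Phi>_def)
  then have "finite {\<beta>. \<Phi> \<sigma> \<beta> \<noteq> 0}" for \<sigma> by (rule finite_subset) simp
  then have \<Phi>: "\<Phi> \<in> graded_cochains n t"
    using c0 by (auto simp: graded_cochains_def graded_pieces_def \<Phi>_def split: if_splits)
  have "graded_diff n t \<Phi> \<tau> = (\<lambda>_. 0)" if "\<tau> \<in> cech_index n (Suc p)" for \<tau>
  proof
    fix \<beta>
    show "graded_diff n t \<Phi> \<tau> \<beta> = 0"
      using c(2) cech_indexD(2)[OF that] by (cases "\<beta> = \<alpha>") (auto simp: graded_diff_def \<Phi>_def cobd_def)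
  qed
  then have cocycle: "to_cech n t p \<Phi> \<in> cech_cocycles (mpoly_ring n) Var n (edge_module n t) p"
    using \<Phi> by (auto simp: cech_cocycles_eq)
  have "to_cech n t p \<Phi> \<notin> cech_coboundaries (mpoly_ring n) Var n (edge_module n t) p"
  proof
    assume cob: "to_cech n t p \<Phi> \<in> cech_coboundaries (mpoly_ring n) Var n (edge_module n t) p"
    have "\<exists>\<Psi> \<in> graded_cochains n t. \<forall>\<sigma>\<in>cech_index n p. \<Phi> \<sigma> = graded_diff n t \<Psi> \<sigma>"
    proof (cases p)
      case 0
      then have "to_cech n t p \<Phi> = to_cech n t p (graded_diff n t (\<lambda>_ _. 0))"
        using cob by (simp add: cech_coboundaries_0 graded_diff_0)
      then show ?thesis using graded_cochains_zero to_cech_eq_iff[OF \<Phi>] by blast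
    next
      case (Suc q)
      then obtain \<Psi> where "\<Psi> \<in> graded_cochains n t" "to_cech n t p \<Phi> = to_cech n t p (graded_diff n t \<Psi>)"
        using cob by (auto simp: cech_coboundaries_Suc)
      then show ?thesis using to_cech_eq_iff[OF \<Phi>] by blast
    qed
    then obtain \<Psi> where \<Psi>: "\<Psi> \<in> graded_cochains n t"
      "\<And>\<sigma>. \<sigma> \<in> cech_index n p \<Longrightarrow> \<Phi> \<sigma> = graded_diff n t \<Psi> \<sigma>" by blast
    obtain \<sigma> where \<sigma>: "\<sigma> \<in> degree_family n t \<alpha>" "card \<sigma> = p" "c \<sigma> \<noteq> cobd (\<lambda>\<sigma>. \<Psi> \<sigma> \<alpha>) \<sigma>"
      using nb[unfolded not_ex, THEN spec, of "\<lambda>\<sigma>. \<Psi> \<sigma> \<alpha>"] graded_cochains_outside[OF \<Psi>(1), of _ \<alpha>]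
      by blast
    then have "\<sigma> \<in> cech_index n p" using degree_family_subset by (auto simp: cech_index_def)
    then show False using fun_cong[OF \<Psi>(2), of \<sigma> \<alpha>] \<sigma> by (simp add: \<Phi>_def graded_diff_def)
  qed
  then show ?thesis using cocycle by blast
qed

section \<open>Vanishing and nonvanishing of local cohomology\<close>

lemma (in group) trivial_self_quotient: "trivial_group (G Mod carrier G)"
proof -
  have "carrier G \<lhd> G"
    by (rule normal_inv_iff[THEN iffD2]) (simp add: subgroup_self)
  then interpret normal "carrier G" G .
  have "carrier G #> x = carrier G" if "x \<in> carrier G" for x
    using that coset_join2 subgroup_self by blast
  then have "carrier (G Mod carrier G) = {\<one>\<^bsub>G Mod carrier G\<^esub>}"
    using one_closed by (auto simp: FactGroup_def RCOSETS_def)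
  then show ?thesis by (simp add: trivial_group_def factorgroup_is_group)
qed

lemma trivial_local_cohomology:
  assumes "\<And>\<alpha>. exact_at TYPE('a::field) (degree_family n t \<alpha>) p"
  shows "trivial_group (local_cohomology (mpoly_ring n) Var n (edge_module n t :: ('a mpoly, 'a mpoly set) module) p)"
proof -
  let ?Z = "cech_cocycles (mpoly_ring n) Var n (edge_module n t) p :: (nat set \<Rightarrow> ('a mpoly set \<times> 'a mpoly) set) set"
  have eq: "?Z = cech_coboundaries (mpoly_ring n) Var n (edge_module n t) p"
    using cech_cocycles_subset[OF assms] cech_coboundaries_subset by blast
  interpret group "(edge_cochains n t p :: (nat set \<Rightarrow> ('a mpoly set \<times> 'a mpoly) set) monoid)\<lparr>carrier := ?Z\<rparr>"
    by (rule subgroup.subgroup_is_group[OF subgroup_cech_cocycles group_edge_cochains])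
  show ?thesis using trivial_self_quotient by (simp add: local_cohomology_def eq)
qed

lemma nontrivial_local_cohomology:
  assumes "\<not> exact_at TYPE('a::field) (degree_family n t \<alpha>) p"
  shows "\<not> trivial_group (local_cohomology (mpoly_ring n) Var n (edge_module n t :: ('a mpoly, 'a mpoly set) module) p)"
proof
  let ?Z = "cech_cocycles (mpoly_ring n) Var n (edge_module n t) p :: (nat set \<Rightarrow> ('a mpoly set \<times> 'a mpoly) set) set"
  let ?B = "cech_coboundaries (mpoly_ring n) Var n (edge_module n t) p :: (nat set \<Rightarrow> ('a mpoly set \<times> 'a mpoly) set) set"
  let ?C = "edge_cochains n t p :: (nat set \<Rightarrow> ('a mpoly set \<times> 'a mpoly) set) monoid"
  obtain z where z: "z \<in> ?Z" "z \<notin> ?B" using cech_cocycle_not_coboundary[OF assms] by blast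
  assume "trivial_group (local_cohomology (mpoly_ring n) Var n (edge_module n t :: ('a mpoly, 'a mpoly set) module) p)"
  \<comment> \<open>The unit of the quotient is \<open>?B\<close>, so triviality makes the coset of
    \<open>z\<close> equal to \<open>?B\<close>; this coset contains \<open>z\<close>, as the
    neutral cochain is a coboundary.\<close>
  then have "rcosets\<^bsub>?C\<lparr>carrier := ?Z\<rparr>\<^esub> ?B = {?B}"
    by (simp add: trivial_group_def local_cohomology_def FactGroup_def)
  then have "?B #>\<^bsub>?C\<lparr>carrier := ?Z\<rparr>\<^esub> z = ?B" using z(1) by (auto simp: RCOSETS_def)
  moreover have one: "\<one>\<^bsub>?C\<^esub> \<in> ?B"
  proof (cases p)
    case (Suc q)
    have "to_cech n t p (graded_diff n t (\<lambda>_ _. 0)) \<in> ?B"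
      unfolding Suc cech_coboundaries_Suc by (intro imageI graded_cochains_zero)
    then show ?thesis by (simp add: one_edge_cochains graded_diff_0)
  qed (simp add: one_edge_cochains cech_coboundaries_0)
  moreover have "\<one>\<^bsub>?C\<^esub> \<otimes>\<^bsub>?C\<^esub> z = z"
  proof (rule monoid.l_one[OF group.is_monoid[OF group_edge_cochains]])
    show "z \<in> carrier ?C" using z(1) by (simp add: cech_cocycles_def kernel_def)
  qed
  ultimately have "z \<in> ?B" by (force simp: r_coset_def)
  then show False using z(2) by contradiction
qed

section \<open>The depth\<close>

lemma degree_complex_cong:
  assumes "\<And>i. i \<in> {1..n} \<Longrightarrow> \<alpha> i = \<beta> i"
  shows "degree_complex t n \<alpha> = degree_complex t n \<beta>"
  unfolding degree_complex_def using assms by (intro Collect_cong conj_cong refl ball_cong bex_cong) auto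

theorem theorem3p3:
  fixes k t :: nat and J :: "'a::field mpoly set"
  defines "J \<equiv> cover_ideal (2 * k) (path_edges (2 * k))"
  assumes "k \<ge> 1" and "t \<ge> 1"
  shows "depth (2 * k) (quotient_module (mpoly_ring (2 * k))
           (J [^]\<^bsub>ideals_set (mpoly_ring (2 * k))\<^esub> t)) =
         (if t \<le> k - 1 then k - 1 + (k + t) div (2 * t + 1) else k - 1)"
proof -
  define q where "q = (k + t) div (2 * t + 1)"
  have q1: "q * (2 * t + 1) \<le> k + t" unfolding q_def by (rule div_times_less_eq_dividend)
  have q2: "k + t < Suc q * (2 * t + 1)" unfolding q_def
    by (metis dividend_less_div_times mult_Suc add.commute zero_less_Suc Suc_eq_plus1)
  \<comment> \<open>For \<open>t \<ge> k\<close> the dividend \<open>k + t\<close> is less than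
    \<open>2 * t + 1\<close>, so both cases of the formula are \<open>k - 1 + q\<close>.\<close>
  have "q = 0" if "\<not> t \<le> k - 1"
    unfolding q_def using that by (intro div_less) simp
  then have rhs: "(if t \<le> k - 1 then k - 1 + (k + t) div (2 * t + 1) else k - 1) = k - 1 + q"
    by (auto simp: q_def)
  \<comment> \<open>This leaves at least one pair, as \<open>degree_complex_not_exact\<close>
    requires.\<close>
  have "q < k"
  proof (rule ccontr)
    assume "\<not> q < k"
    then have "k * (2 * t + 1) \<le> k + t" using q1 by (meson le_trans mult_le_mono1 not_less)
    then have "2 * (k * t) \<le> t" by (simp add: algebra_simps)
    moreover have "t \<le> k * t" using assms(2) by simp
    ultimately show False using assms(3) by linarith
  qed
  \<comment> \<open>There are \<open>Suc f = k - q\<close> pairs and \<open>2 * q\<close> forced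
    vertices; \<open>q2\<close> is exactly the capacity bound for them.\<close>
  define f where "f = k - q - 1"
  have kf: "k = Suc f + q" using \<open>q < k\<close> by (simp add: f_def)
  have "Suc f \<le> (2 * q + 1) * t" using q2 by (simp add: kf algebra_simps)
  then obtain \<alpha> where \<alpha>: "\<not> exact_at TYPE('a) (degree_complex t (2 * k) \<alpha>) (2 * k - Suc (Suc f))"
    using degree_complex_not_exact[where n = "2 * k" and f = f and w = "2 * q" and t = t and ?'a = 'a] kf assms(3)
    by auto
  \<comment> \<open>Nonzero degrees off the path would make \<open>degree_family\<close>
    empty.\<close>
  define \<beta> where "\<beta> i = (if i \<in> {1..2 * k} then \<alpha> i else 0)" for i
  have "degree_family (2 * k) t \<beta> = degree_complex t (2 * k) \<beta>"
    unfolding degree_family_def by (rule if_P) (auto simp: \<beta>_def)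
  also have "\<dots> = degree_complex t (2 * k) \<alpha>" by (rule degree_complex_cong) (simp add: \<beta>_def)
  finally have fam: "degree_family (2 * k) t \<beta> = degree_complex t (2 * k) \<alpha>" .
  have "2 * k - Suc (Suc f) = k - 1 + q" using kf by simp
  then have "\<not> exact_at TYPE('a) (degree_family (2 * k) t \<beta>) (k - 1 + q)"
    using \<alpha> fam by simp
  note nontriv = nontrivial_local_cohomology[OF this]
  have triv: "trivial_group (local_cohomology (mpoly_ring (2 * k)) Var (2 * k)
      (edge_module (2 * k) t :: ('a mpoly, 'a mpoly set) module) p)" if p: "p < k - 1 + q" for p
  proof (rule trivial_local_cohomology, rule ccontr)
    fix \<alpha> assume "\<not> exact_at TYPE('a) (degree_family (2 * k) t \<alpha>) p"
    then have "\<not> exact_at TYPE('a) (degree_complex t (2 * k) \<alpha>) p"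
      using exact_at_empty by (auto simp: degree_family_def split: if_splits)
    from degree_complex_exact_bound[OF this]
    have b: "p < 2 * k" "k \<le> Suc p" "int (2 * k - Suc p) \<le> int (2 * Suc p - 2 * k) * int t + int t" by auto
    \<comment> \<open>Cohomology in level \<open>p\<close> takes \<open>2 * r\<close> forced
      vertices and \<open>k - r\<close> pairs; with \<open>r < q\<close> there are too many pairs
      for the \<open>2 * r + 1\<close> blocks.\<close>
    define r where "r = Suc p - k"
    have r: "Suc p = k + r" "r < q" using b(2) p assms(2) by (simp_all add: r_def)
    have "2 * k - Suc p = k - r" "2 * Suc p - 2 * k = 2 * r" using r by auto
    then have "int (k - r) \<le> int (2 * r) * int t + int t" using b(3) by simp
    then have "k - r \<le> 2 * r * t + t" by (metis of_nat_add of_nat_le_iff of_nat_mult)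
    then have "k + t \<le> r * (2 * t + 1) + 2 * t" by (simp add: algebra_simps)
    also have "\<dots> < Suc r * (2 * t + 1)" by simp
    also have "\<dots> \<le> q * (2 * t + 1)" using r(2) by (intro mult_le_mono1) simp
    finally show False using q1 by simp
  qed
  show ?thesis
    unfolding J_def cover_ideal_power depth_def rhs
    by (rule Least_equality) (use nontriv triv in \<open>auto simp: not_less[symmetric]\<close>)
qed

end
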